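(* Let $n\ge 1$ be an integer, $\vec a=(a_1,a_2),\vec b=(b_1,b_2),\vec c=(c_1,c_2)\in\mathbb{R}^2$, and $\vec\alpha=(\alpha_1,\alpha_2),\vec\beta=(\beta_1,\beta_2)\in(-1,\infty)^2$. Let $\vec p=(p_1,p_2)$ and $\vec q=(q_1,q_2)$ satisfy $1<p_-\le p_+\le q_-<\infty$, where $p_+:=\max\{p_1,p_2\}$, $p_-:=\min\{p_1,p_2\}$ and $q_-:=\min\{q_1,q_2\}$. Then the following statements are equivalent. (i) The operator $S_{\vec a,\vec b,\vec c}$ is bounded from $L^{\vec p}_{\vec\alpha}$ to $L^{\vec q}_{\vec\beta}$. (ii) The operator $T_{\vec a,\vec b,\vec c}$ is bounded from $L^{\vec p}_{\vec\alpha}$ to $L^{\vec q}_{\vec\beta}$. (iii) For every $i\in\{1,2\}$: $-q_ia_i<\beta_i+1$, $\ \alpha_i+1<p_i(b_i+1)$, and $$c_i\le n+1+a_i+b_i+\frac{n+1+\beta_i}{q_i}-\frac{n+1+\alpha_i}{p_i}.$$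
   Context: $\mathbb{B}_n$ is the open unit ball of $\mathbb{C}^n$, $\langle z,w\rangle=\sum_j z_j\overline{w_j}$, and $dv$ is Lebesgue volume measure on $\mathbb{B}_n$ normalized so that $v(\mathbb{B}_n)=1$. For $\theta>-1$, $dv_\theta(z)=c_\theta(1-|z|^2)^\theta dv(z)$ with $c_\theta=\frac{\Gamma(n+\theta+1)}{n!\,\Gamma(\theta+1)}$, so $v_\theta(\mathbb{B}_n)=1$. For $\vec p=(p_1,p_2)\in[1,\infty]^2$ and $\vec\alpha\in(-1,\infty)^2$, $L^{\vec p}_{\vec\alpha}$ is the space of measurable $f$ on $\mathbb{B}_n\times\mathbb{B}_n$ with $$\|f\|_{L^{\vec p}_{\vec\alpha}}=\Big\{\int_{\mathbb{B}_n}\Big[\int_{\mathbb{B}_n}|f(z,w)|^{p_1}dv_{\alpha_1}(z)\Big]^{p_2/p_1}dv_{\alpha_2}(w)\Big\}^{1/p_2}<\infty$$ (usual modifications when some $p_i=\infty$). The operators are $$T_{\vec a,\vec b,\vec c}f(z,w)=(1-|z|^2)^{a_1}(1-|w|^2)^{a_2}\int_{\mathbb{B}_n}\int_{\mathbb{B}_n}\frac{(1-|u|^2)^{b_1}(1-|\eta|^2)^{b_2}}{(1-\langle z,u\rangle)^{c_1}(1-\langle w,\eta\rangle)^{c_2}}f(u,\eta)\,dv(u)\,dv(\eta),$$ $$S_{\vec a,\vec b,\vec c}f(z,w)=(1-|z|^2)^{a_1}(1-|w|^2)^{a_2}\int_{\mathbb{B}_n}\int_{\mathbb{B}_n}\frac{(1-|u|^2)^{b_1}(1-|\eta|^2)^{b_2}}{|1-\langle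 z,u\rangle|^{c_1}|1-\langle w,\eta\rangle|^{c_2}}f(u,\eta)\,dv(u)\,dv(\eta),$$ with principal branches of complex powers. Bounded from $X$ to $Y$ means $\|Tf\|_Y\le C\|f\|_X$ for all $f\in X$ with a constant $C$ independent of $f$. *)

theory Defs
  imports "HOL-Analysis.Analysis"
begin

text \<open>The dimension is \<open>n = CARD('n)\<close>; pairs of real parameters \<open>(x\<^sub>1, x\<^sub>2)\<close> are vectors in
  \<open>real ^ 2\<close>. Points of \<open>\<complex>\<^sup>n \<times> \<complex>\<^sup>n\<close> are pairs.\<close>

definition hinner :: "complex ^ 'n \<Rightarrow> complex ^ 'n \<Rightarrow> complex" where
  "hinner z w = (\<Sum>j\<in>UNIV. z $ j * cnj (w $ j))"

text \<open>Normalized volume measure. The underlying space of \<open>ball_vol\<close> and of \<open>ball_vol_wt\<close> is the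
  open unit ball itself, so measurability never refers to values outside the ball.\<close>

definition ball_vol :: "(complex ^ 'n) measure" where
  "ball_vol = restrict_space (uniform_measure lborel (ball 0 1)) (ball 0 1)"

definition ball_vol_wt :: "real \<Rightarrow> (complex ^ 'n) measure" where
  "ball_vol_wt \<theta> = density ball_vol
     (\<lambda>z. ennreal (Gamma (real CARD('n) + \<theta> + 1) / (fact CARD('n) * Gamma (\<theta> + 1))
                   * (1 - (norm z)\<^sup>2) powr \<theta>))"

text \<open>Real powers of extended nonnegative reals, intended for exponents \<open>r > 0\<close> only.\<close>

definition ennreal_powr :: "ennreal \<Rightarrow> real \<Rightarrow> ennreal" where
  "ennreal_powr x r = (if x = \<infinity> then \<infinity> else ennreal (enn2real x powr r))"

text \<open>Finite exponents only. The inner integral is over the first variable.\<close>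

definition mixed_norm ::
  "real ^ 2 \<Rightarrow> real ^ 2 \<Rightarrow> ((complex ^ 'n) \<times> (complex ^ 'n) \<Rightarrow> complex) \<Rightarrow> ennreal" where
  "mixed_norm p \<alpha> f =
     ennreal_powr
       (\<integral>\<^sup>+ w. ennreal_powr
                 (\<integral>\<^sup>+ z. ennreal (cmod (f (z, w)) powr (p $ 1)) \<partial>ball_vol_wt (\<alpha> $ 1))
                 (p $ 2 / p $ 1)
          \<partial>ball_vol_wt (\<alpha> $ 2))
       (1 / p $ 2)"

definition mixed_Lp ::
  "real ^ 2 \<Rightarrow> real ^ 2 \<Rightarrow> ((complex ^ 'n) \<times> (complex ^ 'n) \<Rightarrow> complex) set" where
  "mixed_Lp p \<alpha> = {f \<in> borel_measurable (ball_vol \<Otimes>\<^sub>M ball_vol). mixed_norm p \<alpha> f < \<infinity>}"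

text \<open>On the ball \<open>1 - hinner z u\<close> has positive real part, and \<open>powr\<close> on the complex numbers is
  the principal branch.\<close>

definition T_integrand ::
  "real ^ 2 \<Rightarrow> real ^ 2 \<Rightarrow> ((complex ^ 'n) \<times> (complex ^ 'n) \<Rightarrow> complex)
    \<Rightarrow> (complex ^ 'n) \<times> (complex ^ 'n) \<Rightarrow> (complex ^ 'n) \<times> (complex ^ 'n) \<Rightarrow> complex" where
  "T_integrand b c f = (\<lambda>(z, w) (u, \<eta>).
     of_real ((1 - (norm u)\<^sup>2) powr (b $ 1) * (1 - (norm \<eta>)\<^sup>2) powr (b $ 2))
     / ((1 - hinner z u) powr of_real (c $ 1) * (1 - hinner w \<eta>) powr of_real (c $ 2))
     * f (u, \<eta>))"

definition S_integrand ::
  "real ^ 2 \<Rightarrow> real ^ 2 \<Rightarrow> ((complex ^ 'n) \<times> (complex ^ 'n) \<Rightarrow> complex)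
    \<Rightarrow> (complex ^ 'n) \<times> (complex ^ 'n) \<Rightarrow> (complex ^ 'n) \<times> (complex ^ 'n) \<Rightarrow> complex" where
  "S_integrand b c f = (\<lambda>(z, w) (u, \<eta>).
     of_real ((1 - (norm u)\<^sup>2) powr (b $ 1) * (1 - (norm \<eta>)\<^sup>2) powr (b $ 2)
       / (cmod (1 - hinner z u) powr (c $ 1) * cmod (1 - hinner w \<eta>) powr (c $ 2)))
     * f (u, \<eta>))"

definition T_op ::
  "real ^ 2 \<Rightarrow> real ^ 2 \<Rightarrow> real ^ 2 \<Rightarrow> ((complex ^ 'n) \<times> (complex ^ 'n) \<Rightarrow> complex)
    \<Rightarrow> (complex ^ 'n) \<times> (complex ^ 'n) \<Rightarrow> complex" where
  "T_op a b c f = (\<lambda>(z, w).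
     of_real ((1 - (norm z)\<^sup>2) powr (a $ 1) * (1 - (norm w)\<^sup>2) powr (a $ 2))
     * (\<integral>u\<eta>. T_integrand b c f (z, w) u\<eta> \<partial>(ball_vol \<Otimes>\<^sub>M ball_vol)))"

definition S_op ::
  "real ^ 2 \<Rightarrow> real ^ 2 \<Rightarrow> real ^ 2 \<Rightarrow> ((complex ^ 'n) \<times> (complex ^ 'n) \<Rightarrow> complex)
    \<Rightarrow> (complex ^ 'n) \<times> (complex ^ 'n) \<Rightarrow> complex" where
  "S_op a b c f = (\<lambda>(z, w).
     of_real ((1 - (norm z)\<^sup>2) powr (a $ 1) * (1 - (norm w)\<^sup>2) powr (a $ 2))
     * (\<integral>u\<eta>. S_integrand b c f (z, w) u\<eta> \<partial>(ball_vol \<Otimes>\<^sub>M ball_vol)))"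

text \<open>Boundedness of an integral operator \<open>A\<close> whose value at \<open>(z, w)\<close> is computed from the
  integrand \<open>I f (z, w)\<close>. The Bochner integral of a non-integrable function is \<open>0\<close>, so the
  existence of the defining integral (for almost every point) is required explicitly.\<close>

definition bounded_mixed_Lp ::
  "(((complex ^ 'n) \<times> (complex ^ 'n) \<Rightarrow> complex) \<Rightarrow> (complex ^ 'n) \<times> (complex ^ 'n)
      \<Rightarrow> (complex ^ 'n) \<times> (complex ^ 'n) \<Rightarrow> complex)
    \<Rightarrow> (((complex ^ 'n) \<times> (complex ^ 'n) \<Rightarrow> complex) \<Rightarrow> (complex ^ 'n) \<times> (complex ^ 'n) \<Rightarrow> complex)
    \<Rightarrow> real ^ 2 \<Rightarrow> real ^ 2 \<Rightarrow> real ^ 2 \<Rightarrow> real ^ 2 \<Rightarrow> bool" where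
  "bounded_mixed_Lp I A p \<alpha> q \<beta> \<longleftrightarrow>
     (\<exists>C::real. \<forall>f \<in> mixed_Lp p \<alpha>.
        (AE zw in ball_vol \<Otimes>\<^sub>M ball_vol. integrable (ball_vol \<Otimes>\<^sub>M ball_vol) (I f zw))
        \<and> A f \<in> mixed_Lp q \<beta>
        \<and> mixed_norm q \<beta> (A f) \<le> ennreal C * mixed_norm p \<alpha> f)"

definition T_bounded ::
  "'n::finite itself \<Rightarrow> real ^ 2 \<Rightarrow> real ^ 2 \<Rightarrow> real ^ 2
    \<Rightarrow> real ^ 2 \<Rightarrow> real ^ 2 \<Rightarrow> real ^ 2 \<Rightarrow> real ^ 2 \<Rightarrow> bool" where
  "T_bounded _ a b c p \<alpha> q \<beta> \<longleftrightarrow>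
     bounded_mixed_Lp (T_integrand b c ::
         ((complex ^ 'n) \<times> (complex ^ 'n) \<Rightarrow> complex) \<Rightarrow> _) (T_op a b c) p \<alpha> q \<beta>"

definition S_bounded ::
  "'n::finite itself \<Rightarrow> real ^ 2 \<Rightarrow> real ^ 2 \<Rightarrow> real ^ 2
    \<Rightarrow> real ^ 2 \<Rightarrow> real ^ 2 \<Rightarrow> real ^ 2 \<Rightarrow> real ^ 2 \<Rightarrow> bool" where
  "S_bounded _ a b c p \<alpha> q \<beta> \<longleftrightarrow>
     bounded_mixed_Lp (S_integrand b c ::
         ((complex ^ 'n) \<times> (complex ^ 'n) \<Rightarrow> complex) \<Rightarrow> _) (S_op a b c) p \<alpha> q \<beta>"

lemma space_ball_vol [simp]: "space (ball_vol :: (complex ^ 'n) measure) = ball 0 1"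
  by (simp add: ball_vol_def space_restrict_space)

lemma emeasure_ball_vol_UNIV: "emeasure (ball_vol :: (complex ^ 'n) measure) (ball 0 1) = 1"
proof -
  have "emeasure lborel (ball (0 :: complex ^ 'n) 1) \<noteq> 0"
    using emeasure_lborel_ball_finite[of "0 :: complex ^ 'n" 1]
    by (simp add: emeasure_ball unit_ball_vol_pos less_imp_neq[OF unit_ball_vol_pos, symmetric])
  moreover have "emeasure lborel (ball (0 :: complex ^ 'n) 1) \<noteq> \<infinity>"
    using emeasure_lborel_ball_finite[of "0 :: complex ^ 'n" 1] by auto
  ultimately show ?thesis
    by (simp add: ball_vol_def emeasure_restrict_space emeasure_uniform_measure
        ennreal_divide_self less_top)
qed

end

theory Submission
  imports Defs
begin

text \<open>Sufficiency: the kernel of \<open>S\<close> is a product of two positive kernels, so by Minkowski's integral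
  inequality it is enough to bound each one-variable operator from \<open>L\<^sup>p\<close> to \<open>L\<^sup>q\<close>. With
  \<open>p \<le> q\<close> this is a Schur test (Hoelder, then Minkowski with exponent \<open>q/p\<close>) for powers of
  \<open>1 - |u|\<^sup>2\<close>, which needs only the upper Forelli--Rudin estimate. That estimate is obtained
  without coordinates or rotations: packing translates and dilates of the set
  \<open>|1 - \<langle>z, u\<rangle>| < r\<close> bounds its volume, and dyadic summation does the rest.

  Necessity: only functions \<open>g(u) h(\<eta>) \<ge> 0\<close> are tested, at points where \<open>1 - \<langle>z, u\<rangle>\<close> stays close to a
  fixed positive number on the support of \<open>g\<close> (and similarly for \<open>h\<close>); there the kernel of \<open>T\<close> has
  real part comparable to its modulus, and \<open>S\<close> and \<open>T\<close> can be treated together. Indicators of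
  small balls at the origin, truncations of \<open>(1 - |u|\<^sup>2) powr (- (\<alpha> + 1) / p)\<close> and indicators of
  nonisotropic boxes at distance \<open>\<delta>\<close> from the boundary give the three conditions.\<close>

section \<open>Powers and norms of extended nonnegative functions\<close>

text \<open>The estimates work with nonnegative extended functions, so they carry no integrability
  hypotheses; existence of the defining integrals almost everywhere is read off at the end of the
  sufficiency proof from finiteness of a norm. The obstacle for T is cancellation: its kernel is
  complex, so a bound for T gives no bound for S by comparison. Both operators are therefore
  instances of one locale that knows the modulus of the kernel, which drives sufficiency, and its
  phase near positive real values, which drives necessity. Necessity is separated into single
  variables by freezing a fixed test function in the other variable, whose contribution is a
  positive constant. The exponent p_i > 1 also rules out equality in the second condition: there a
  quantity m tending to infinity would satisfy m <= K m^(1/p_i). The critical c_i is the value for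
  which, after the Schur splitting, the columns of the kernel are bounded by a multiple of (1 -
  |u|^2)^(\<alpha>_i/p_i); smaller c_i follow from |1 - <z,u>| < 2.\<close>

lemma ennreal_powr_ennreal [simp]: "x \<ge> 0 \<Longrightarrow> ennreal_powr (ennreal x) r = ennreal (x powr r)"
  by (simp add: ennreal_powr_def)

lemma ennreal_powr_top [simp]: "ennreal_powr top r = top"
  by (simp add: ennreal_powr_def)

lemma ennreal_powr_zero [simp]: "ennreal_powr 0 r = 0"
  by (simp add: ennreal_powr_def)

lemma ennreal_powr_one [simp]: "ennreal_powr x 1 = x"
  by (cases x) auto


lemma ennreal_powr_eq_0_iff [simp]: "ennreal_powr x r = 0 \<longleftrightarrow> x = 0"
  by (cases x) (auto simp: ennreal_eq_0_iff)

lemma ennreal_powr_eq_top_iff [simp]: "ennreal_powr x r = top \<longleftrightarrow> x = top"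
  by (cases x) auto

lemma ennreal_powr_less_top_iff [simp]: "ennreal_powr x r < top \<longleftrightarrow> x < top"
  by (simp flip: less_top)

lemma ennreal_powr_mono: "x \<le> y \<Longrightarrow> 0 \<le> r \<Longrightarrow> ennreal_powr x r \<le> ennreal_powr y r"
  by (cases x; cases y) (auto intro!: ennreal_leI powr_mono2 simp: top_unique)

lemma ennreal_powr_mult: "ennreal_powr (x * y) r = ennreal_powr x r * ennreal_powr y r"
proof (cases x; cases y)
  fix s t assume "x = ennreal s" "y = ennreal t" "0 \<le> s" "0 \<le> t"
  then show ?thesis
    by (simp add: powr_mult flip: ennreal_mult)
qed (auto simp: ennreal_mult_top ennreal_top_mult ennreal_eq_0_iff)

lemma ennreal_powr_powr: "ennreal_powr (ennreal_powr x r) s = ennreal_powr x (r * s)"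
  by (cases x) (auto simp: powr_powr)

lemma ennreal_powr_add: "ennreal_powr x r * ennreal_powr x s = ennreal_powr x (r + s)"
  by (cases x) (auto simp: powr_add ennreal_top_mult simp flip: ennreal_mult)

lemma measurable_ennreal_powr [measurable]:
  assumes [measurable]: "f \<in> borel_measurable M"
  shows "(\<lambda>x. ennreal_powr (f x) r) \<in> borel_measurable M"
  unfolding ennreal_powr_def by measurable

text \<open>Young's inequality for x / A^(1/p) and y / B^(1/q). With A and B the two power integrals
  in Hoelder's inequality, the bracket integrates to 1/p + 1/q = 1, so no function has to be
  normalized first.\<close>

lemma ennreal_Young:
  fixes x y :: ennreal
  assumes "p > 1" "q > 1" "1 / p + 1 / q = 1" "A > 0" "B > 0"
  shows "x * y \<le> ennreal (A powr (1/p) * B powr (1/q)) *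
     (ennreal (1 / (p * A)) * ennreal_powr x p + ennreal (1 / (q * B)) * ennreal_powr y q)"
proof -
  have nz: "ennreal (A powr (1/p) * B powr (1/q)) \<noteq> 0" "ennreal (1 / (p * A)) \<noteq> 0" "ennreal (1 / (q * B)) \<noteq> 0"
    using assms by (auto simp: ennreal_eq_0_iff not_le mult_pos_pos)
  show ?thesis
proof (cases x; cases y)
  fix s t assume st: "x = ennreal s" "y = ennreal t" "0 \<le> s" "0 \<le> t"
  have "(s / A powr (1/p)) * (t / B powr (1/q))
      \<le> (s / A powr (1/p)) powr p / p + (t / B powr (1/q)) powr q / q"
    using assms st by (intro Youngs_inequality) auto
  also have "\<dots> = 1 / (p * A) * s powr p + 1 / (q * B) * t powr q"
    using assms st by (simp add: powr_divide powr_powr field_simps)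
  finally have "(A powr (1/p) * B powr (1/q)) * ((s / A powr (1/p)) * (t / B powr (1/q)))
      \<le> (A powr (1/p) * B powr (1/q)) * (1 / (p * A) * s powr p + 1 / (q * B) * t powr q)"
    by (intro mult_left_mono) auto
  also have "(A powr (1/p) * B powr (1/q)) * ((s / A powr (1/p)) * (t / B powr (1/q))) = s * t"
    using assms by simp
  finally have "s * t \<le> (A powr (1/p) * B powr (1/q)) * (1 / (p * A) * s powr p + 1 / (q * B) * t powr q)" .
  then show ?thesis using st assms
    by (simp add: ennreal_leI flip: ennreal_mult ennreal_plus)
qed (use nz in \<open>auto simp: ennreal_mult_top ennreal_top_mult\<close>)
qed

section \<open>Hoelder's inequality and Minkowski's integral inequality for extended nonnegative
  functions\<close>

definition Lp_norm :: "real \<Rightarrow> 'a measure \<Rightarrow> ('a \<Rightarrow> ennreal) \<Rightarrow> ennreal" where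
  "Lp_norm p M f = ennreal_powr (\<integral>\<^sup>+x. ennreal_powr (f x) p \<partial>M) (1 / p)"

lemma Lp_norm_mono:
  assumes "p > 0" "\<And>x. x \<in> space M \<Longrightarrow> f x \<le> g x"
  shows "Lp_norm p M f \<le> Lp_norm p M g"
  unfolding Lp_norm_def using assms
  by (intro ennreal_powr_mono nn_integral_mono) auto

lemma Lp_norm_cmult:
  assumes "p > 0" "f \<in> borel_measurable M"
  shows "Lp_norm p M (\<lambda>x. C * f x) = C * Lp_norm p M f"
  unfolding Lp_norm_def using assms
  by (simp add: ennreal_powr_mult nn_integral_cmult ennreal_powr_powr)

lemma Lp_norm_multc:
  assumes "p > 0" "f \<in> borel_measurable M"
  shows "Lp_norm p M (\<lambda>x. f x * C) = Lp_norm p M f * C"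
  using Lp_norm_cmult[OF assms] by (simp add: mult.commute)

lemma Lp_norm_powr:
  assumes "p > 0" "r > 0"
  shows "Lp_norm p M (\<lambda>x. ennreal_powr (f x) r) = ennreal_powr (Lp_norm (r * p) M f) r"
  unfolding Lp_norm_def using assms by (simp add: ennreal_powr_powr)

text \<open>The scaled Young inequality needs 0 < A, B < infinity. If one integral vanishes, the
  integrand is null almost everywhere; if neither vanishes and one is infinite, so is the right-hand
  side.\<close>

lemma nn_integral_Holder:
  fixes f g :: "'a \<Rightarrow> ennreal"
  assumes pq: "p > 1" "q > 1" "1 / p + 1 / q = 1"
    and [measurable]: "f \<in> borel_measurable M" "g \<in> borel_measurable M"
  shows "(\<integral>\<^sup>+x. f x * g x \<partial>M) \<le> Lp_norm p M f * Lp_norm q M g"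
proof -
  define A B where "A = (\<integral>\<^sup>+x. ennreal_powr (f x) p \<partial>M)" and "B = (\<integral>\<^sup>+x. ennreal_powr (g x) q \<partial>M)"
  show ?thesis
  proof (cases "A = 0 \<or> B = 0")
    case True
    then have "AE x in M. f x * g x = 0"
      unfolding A_def B_def by (subst (asm) (1 2) nn_integral_0_iff_AE) auto
    then have "(\<integral>\<^sup>+x. f x * g x \<partial>M) = 0"
      by (subst nn_integral_0_iff_AE) auto
    then show ?thesis by simp
  next
    case nz: False
    show ?thesis
    proof (cases "A = top \<or> B = top")
      case True
      with nz have "Lp_norm p M f * Lp_norm q M g = top"
        unfolding Lp_norm_def A_def[symmetric] B_def[symmetric]
        by (auto simp: ennreal_top_mult ennreal_mult_top)
      then show ?thesis by simp
    next
      case False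
      with nz obtain s t where st: "A = ennreal s" "B = ennreal t" "0 < s" "0 < t"
        by (cases A; cases B) (auto simp: ennreal_eq_0_iff not_le)
      have "(\<integral>\<^sup>+x. f x * g x \<partial>M) \<le> (\<integral>\<^sup>+x. ennreal (s powr (1/p) * t powr (1/q)) *
          (ennreal (1 / (p * s)) * ennreal_powr (f x) p + ennreal (1 / (q * t)) * ennreal_powr (g x) q) \<partial>M)"
        using pq st by (intro nn_integral_mono ennreal_Young) auto
      also have "\<dots> = ennreal (s powr (1/p) * t powr (1/q)) *
          (ennreal (1 / (p * s)) * A + ennreal (1 / (q * t)) * B)"
        by (simp add: nn_integral_cmult nn_integral_add A_def B_def)
      also have "\<dots> = ennreal (s powr (1/p) * t powr (1/q))"
        using st pq by (simp flip: ennreal_mult ennreal_plus)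
      also have "\<dots> = Lp_norm p M f * Lp_norm q M g"
        unfolding Lp_norm_def A_def[symmetric] B_def[symmetric] using st
        by (simp flip: ennreal_mult)
      finally show ?thesis .
    qed
  qed
qed

text \<open>At infinite x the supremum is infinite because k <= k^r for r >= 1. The truncation makes
  integrals finite where they have to be cancelled.\<close>

lemma SUP_ennreal_powr_min:
  assumes "r \<ge> 1"
  shows "(SUP k. ennreal_powr (min x (ennreal (real k))) r) = ennreal_powr x r"
proof (cases x)
  case (real s)
  obtain k :: nat where "s \<le> real k" using real_arch_simple by blast
  then have "ennreal_powr (min x (ennreal (real k))) r = ennreal_powr x r"
    using real by (simp add: min_absorb1 ennreal_leI)
  then have "ennreal_powr x r \<le> (SUP k. ennreal_powr (min x (ennreal (real k))) r)"
    by (metis SUP_upper UNIV_I)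
  moreover have "(SUP k. ennreal_powr (min x (ennreal (real k))) r) \<le> ennreal_powr x r"
    using assms by (intro SUP_least ennreal_powr_mono) auto
  ultimately show ?thesis by (rule antisym[rotated])
next
  case top
  have "of_nat k \<le> ennreal_powr (ennreal (real k)) r" for k
  proof (cases "k = 0")
    case False
    then have "real k \<le> real k powr r" using assms powr_mono[of 1 r "real k"] by simp
    then show ?thesis by (simp add: ennreal_of_nat_eq_real_of_nat ennreal_leI)
  qed simp
  then have "(SUP k. of_nat k :: ennreal) \<le> (SUP k. ennreal_powr (ennreal (real k)) r)"
    by (intro SUP_mono) auto
  then show ?thesis
    using top by (simp add: ennreal_SUP_of_nat_eq_top top_unique)
qed

text \<open>Duality by hand: with G the inner integral and H a truncation of G, H^r is at most G
  H^(r-1), and Fubini with Hoelder in z bounds its integral X by K X^(1/r'), where K is the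
  right-hand side. Cancelling X^(1/r') requires X < infinity, which the truncation and the
  finiteness of N provide; monotone convergence then removes the truncation.\<close>

lemma Minkowski_integral:
  fixes F :: "'a \<Rightarrow> 'b \<Rightarrow> ennreal"
  assumes "finite_measure N" "sigma_finite_measure M" and r: "r \<ge> 1"
    and F [measurable]: "(\<lambda>(z, u). F z u) \<in> borel_measurable (N \<Otimes>\<^sub>M M)"
  shows "Lp_norm r N (\<lambda>z. \<integral>\<^sup>+u. F z u \<partial>M) \<le> (\<integral>\<^sup>+u. Lp_norm r N (\<lambda>z. F z u) \<partial>M)"
proof -
  interpret N: finite_measure N by fact
  interpret M: sigma_finite_measure M by fact
  interpret NM: pair_sigma_finite N M by standard
  define G where "G z = (\<integral>\<^sup>+u. F z u \<partial>M)" for z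
  define K where "K = (\<integral>\<^sup>+u. Lp_norm r N (\<lambda>z. F z u) \<partial>M)"
  have [measurable]: "G \<in> borel_measurable N" unfolding G_def by measurable
  show ?thesis
  proof (cases "r = 1")
    case True
    have "(\<integral>\<^sup>+z. (\<integral>\<^sup>+u. F z u \<partial>M) \<partial>N) = (\<integral>\<^sup>+u. (\<integral>\<^sup>+z. F z u \<partial>N) \<partial>M)"
      by (rule NM.Fubini'[symmetric]) simp
    then show ?thesis using True by (simp add: Lp_norm_def)
  next
    case False
    with r have r: "r > 1" by simp
    define r' where "r' = r / (r - 1)"
    have r': "r' > 1" "1 / r + 1 / r' = 1" using r by (auto simp: r'_def field_simps)
    have trunc: "(\<integral>\<^sup>+z. ennreal_powr (min (G z) (ennreal (real k))) r \<partial>N) \<le> ennreal_powr K r" for k :: nat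
    proof -
      define H where "H z = min (G z) (ennreal (real k))" for z
      have [measurable]: "H \<in> borel_measurable N" unfolding H_def by measurable
      define X where "X = (\<integral>\<^sup>+z. ennreal_powr (H z) r \<partial>N)"
      have "X \<le> (\<integral>\<^sup>+z. ennreal_powr (ennreal (real k)) r \<partial>N)"
        unfolding X_def H_def using r by (intro nn_integral_mono ennreal_powr_mono) auto
      also have "\<dots> < top"
        using N.emeasure_finite[of "space N"]
        by (auto simp: ennreal_mult_eq_top_iff simp flip: less_top)
      finally have Xfin: "X < top" .
      have Hr: "Lp_norm r' N (\<lambda>z. ennreal_powr (H z) (r - 1)) = ennreal_powr X (1 / r')"
        using r by (simp add: Lp_norm_def X_def ennreal_powr_powr r'_def)
      have "X \<le> (\<integral>\<^sup>+z. G z * ennreal_powr (H z) (r - 1) \<partial>N)"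
        unfolding X_def
      proof (intro nn_integral_mono)
        fix z
        have "ennreal_powr (H z) r = H z * ennreal_powr (H z) (r - 1)"
          using ennreal_powr_add[of "H z" 1 "r - 1"] by simp
        also have "\<dots> \<le> G z * ennreal_powr (H z) (r - 1)"
          by (intro mult_right_mono) (auto simp: H_def)
        finally show "ennreal_powr (H z) r \<le> G z * ennreal_powr (H z) (r - 1)" .
      qed
      also have "\<dots> = (\<integral>\<^sup>+z. (\<integral>\<^sup>+u. F z u * ennreal_powr (H z) (r - 1) \<partial>M) \<partial>N)"
        unfolding G_def by (intro nn_integral_cong nn_integral_multc[symmetric]) measurable
      also have "\<dots> = (\<integral>\<^sup>+u. (\<integral>\<^sup>+z. F z u * ennreal_powr (H z) (r - 1) \<partial>N) \<partial>M)"
        by (rule NM.Fubini'[symmetric]) measurable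
      also have "\<dots> \<le> (\<integral>\<^sup>+u. Lp_norm r N (\<lambda>z. F z u) * ennreal_powr X (1 / r') \<partial>M)"
        unfolding Hr[symmetric] using r r'
        by (intro nn_integral_mono nn_integral_Holder) measurable
      also have "\<dots> = K * ennreal_powr X (1 / r')"
        unfolding K_def Lp_norm_def by (intro nn_integral_multc) measurable
      finally have *: "X \<le> K * ennreal_powr X (1 / r')" .
      have "ennreal_powr X (1 / r) \<le> K"
      proof (cases "X = 0")
        case nz: False
        have "X = ennreal_powr X (1 / r) * ennreal_powr X (1 / r')"
          using r' by (simp add: ennreal_powr_add)
        with * have "ennreal_powr X (1 / r') * ennreal_powr X (1 / r) \<le> ennreal_powr X (1 / r') * K"
          by (simp add: mult.commute)
        then show ?thesis using nz Xfin
          by (subst (asm) ennreal_mult_le_mult_iff) auto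
      qed auto
      then have "ennreal_powr (ennreal_powr X (1 / r)) r \<le> ennreal_powr K r"
        using r by (intro ennreal_powr_mono) auto
      then show ?thesis using r by (simp add: ennreal_powr_powr X_def H_def)
    qed
    have "(\<integral>\<^sup>+z. ennreal_powr (G z) r \<partial>N)
        = (\<integral>\<^sup>+z. (SUP k. ennreal_powr (min (G z) (ennreal (real k))) r) \<partial>N)"
      using r by (simp add: SUP_ennreal_powr_min)
    also have "\<dots> = (SUP k. (\<integral>\<^sup>+z. ennreal_powr (min (G z) (ennreal (real k))) r \<partial>N))"
      using r by (intro nn_integral_monotone_convergence_SUP)
        (auto simp: incseq_def le_fun_def intro!: ennreal_powr_mono min.mono ennreal_leI)
    also have "\<dots> \<le> ennreal_powr K r"
      by (intro SUP_least trunc)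
    finally have "ennreal_powr (\<integral>\<^sup>+z. ennreal_powr (G z) r \<partial>N) (1 / r) \<le> ennreal_powr (ennreal_powr K r) (1 / r)"
      using r by (intro ennreal_powr_mono) auto
    then show ?thesis using r by (simp add: ennreal_powr_powr Lp_norm_def G_def K_def)
  qed
qed

section \<open>The Hermitian inner product\<close>

lemma hinner_add_left: "hinner (x + y) z = hinner x z + hinner y z"
  by (simp add: hinner_def distrib_right sum.distrib)

lemma hinner_add_right: "hinner z (x + y) = hinner z x + hinner z y"
  by (simp add: hinner_def distrib_left sum.distrib)

lemma hinner_smult_left: "hinner (l *s x) z = l * hinner x z"
  by (simp add: hinner_def sum_distrib_left mult.assoc)

lemma hinner_commute: "hinner z u = cnj (hinner u z)"
  by (simp add: hinner_def mult.commute)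


lemma hinner_scaleR_right: "hinner z (t *\<^sub>R x) = t *\<^sub>R hinner z x"
  by (simp add: hinner_def scaleR_sum_right)

lemma hinner_zero [simp]: "hinner 0 u = 0" "hinner u 0 = 0"
  by (simp_all add: hinner_def)

lemma norm_vec_square:
  fixes x :: "'b::real_normed_vector ^ 'n"
  shows "(norm x)\<^sup>2 = (\<Sum>j\<in>UNIV. (norm (x $ j))\<^sup>2)"
  by (simp add: norm_vec_def L2_set_def sum_nonneg)

lemma norm_cvec_add_square:
  fixes x y :: "complex ^ 'n"
  shows "(norm (x + y))\<^sup>2 = (norm x)\<^sup>2 + (norm y)\<^sup>2 + 2 * Re (hinner x y)"
proof -
  have "(cmod (a + b))\<^sup>2 = (cmod a)\<^sup>2 + (cmod b)\<^sup>2 + 2 * Re (a * cnj b)" for a b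
    by (simp only: cmod_power2) (simp add: power2_eq_square algebra_simps)
  then show ?thesis
    by (simp add: norm_vec_square hinner_def sum.distrib sum_distrib_left)
qed

lemma hinner_self: "hinner z z = complex_of_real ((norm z)\<^sup>2)"
  by (simp add: hinner_def norm_vec_square complex_norm_square del: of_real_power)

lemma norm_hinner_le: "cmod (hinner z u) \<le> norm z * norm u"
proof -
  have "cmod (hinner z u) \<le> (\<Sum>j\<in>UNIV. cmod (z $ j) * cmod (u $ j))"
    unfolding hinner_def by (rule order.trans[OF norm_sum]) (simp add: norm_mult)
  also have "\<dots> \<le> norm z * norm u"
    unfolding norm_vec_def using L2_set_mult_ineq[of "\<lambda>j. cmod (z $ j)" "\<lambda>j. cmod (u $ j)" UNIV]
    by simp
  finally show ?thesis .
qed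

lemma norm_smult_cvec: "norm (l *s (x :: complex ^ 'n)) = cmod l * norm x"
  by (simp add: norm_vec_def norm_mult L2_set_right_distrib)

lemma continuous_on_hinner [continuous_intros]:
  assumes "continuous_on S f" "continuous_on S g"
  shows "continuous_on S (\<lambda>x. hinner (f x) (g x))"
  unfolding hinner_def by (intro continuous_intros assms)

lemma measurable_hinner [measurable]:
  assumes [measurable]: "f \<in> borel_measurable M" "g \<in> borel_measurable M"
  shows "(\<lambda>x. hinner (f x) (g x)) \<in> borel_measurable M"
proof -
  have "(\<lambda>p. hinner (fst p) (snd p)) \<in> borel_measurable (borel :: ((complex^'n) \<times> (complex^'n)) measure)"
    by (intro borel_measurable_continuous_onI continuous_intros)
  from measurable_compose[OF _ this, of "\<lambda>x. (f x, g x)" M] show ?thesis by simp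
qed

lemma cmod_one_minus_hinner_commute: "cmod (1 - hinner z u) = cmod (1 - hinner u z)"
  by (metis hinner_commute complex_cnj_diff complex_cnj_one complex_mod_cnj)

lemma cmod_one_minus_hinner_ge: "1 - norm z * norm u \<le> cmod (1 - hinner z u)"
  using norm_hinner_le[of z u] norm_triangle_ineq2[of 1 "hinner z u"] by simp

lemma cmod_one_minus_hinner_ge_left:
  "norm u < 1 \<Longrightarrow> 1 - norm z \<le> cmod (1 - hinner z u)"
  using cmod_one_minus_hinner_ge[of z u] mult_left_mono[of "norm u" 1 "norm z"] by simp

lemma cmod_one_minus_hinner_ge_right:
  "norm z < 1 \<Longrightarrow> 1 - norm u \<le> cmod (1 - hinner z u)"
  using cmod_one_minus_hinner_ge_left[of z u] by (simp add: cmod_one_minus_hinner_commute)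

lemma cmod_one_minus_hinner_pos:
  "norm z < 1 \<Longrightarrow> norm u < 1 \<Longrightarrow> 0 < cmod (1 - hinner z u)"
  using cmod_one_minus_hinner_ge_left[of u z] by linarith

lemma cmod_one_minus_hinner_less:
  assumes "norm z < 1" "norm u < 1"
  shows "cmod (1 - hinner z u) < 2"
proof -
  have "norm z * norm u < 1" using assms mult_strict_mono'[of "norm z" 1 "norm u" 1] by simp
  then show ?thesis using norm_hinner_le[of z u] norm_triangle_ineq4[of 1 "hinner z u"] by simp
qed

section \<open>Volume of nonisotropic balls\<close>

lemma affine_image_borel:
  fixes S :: "'a::euclidean_space set"
  assumes "S \<in> sets borel" "m \<noteq> 0"
  shows "(\<lambda>x. m *\<^sub>R x + d) ` S \<in> sets borel"
proof -
  have "(\<lambda>x. m *\<^sub>R x + d) ` S = (\<lambda>y. (1 / m) *\<^sub>R (y - d)) -` S \<inter> space borel"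
    using assms by (force simp: image_iff algebra_simps)
  also have "\<dots> \<in> sets borel"
    using assms(1) by (rule measurable_sets[rotated]) measurable
  finally show ?thesis .
qed

text \<open>Each image has at least \<open>c ^ DIM('a)\<close> times the volume of S, and the images
  are disjoint subsets of B. The lemma serves both translations (all \<open>m i\<close> equal to 1)
  and dilations (all \<open>d i\<close> zero).\<close>

lemma affine_packing:
  fixes S B :: "'a::euclidean_space set" and m :: "'i \<Rightarrow> real"
  assumes S: "S \<in> sets borel" and B: "B \<in> sets borel" "bounded B"
    and I: "finite I" and c: "c > 0" "\<And>i. i \<in> I \<Longrightarrow> c \<le> m i"
    and disj: "pairwise (\<lambda>i j. disjnt ((\<lambda>x. m i *\<^sub>R x + d i) ` S) ((\<lambda>x. m j *\<^sub>R x + d j) ` S)) I"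
    and sub: "\<And>i x. i \<in> I \<Longrightarrow> x \<in> S \<Longrightarrow> m i *\<^sub>R x + d i \<in> B"
  shows "real (card I) * c ^ DIM('a) * measure lebesgue S \<le> measure lebesgue B"
proof -
  have Bm: "B \<in> lmeasurable" using B by (intro bounded_set_imp_lmeasurable) auto
  have im: "(\<lambda>x. m i *\<^sub>R x + d i) ` S \<in> sets borel" if "i \<in> I" for i
    using affine_image_borel[OF S, of "m i" "d i"] c that by force
  have lm: "(\<lambda>x. m i *\<^sub>R x + d i) ` S \<in> lmeasurable" if "i \<in> I" for i
    using that sub im by (intro bounded_set_imp_lmeasurable bounded_subset[OF B(2)]) auto
  have "real (card I) * c ^ DIM('a) * measure lebesgue S
      = (\<Sum>i\<in>I. c ^ DIM('a) * measure lebesgue S)"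
    by simp
  also have "\<dots> \<le> (\<Sum>i\<in>I. measure lebesgue ((\<lambda>x. m i *\<^sub>R x + d i) ` S))"
  proof (intro sum_mono)
    fix i assume "i \<in> I"
    then have "c ^ DIM('a) \<le> \<bar>m i\<bar> ^ DIM('a)" using c by (intro power_mono) force+
    then show "c ^ DIM('a) * measure lebesgue S \<le> measure lebesgue ((\<lambda>x. m i *\<^sub>R x + d i) ` S)"
      by (simp add: measure_lebesgue_affine mult_right_mono)
  qed
  also have "\<dots> = measure lebesgue (\<Union>i\<in>I. (\<lambda>x. m i *\<^sub>R x + d i) ` S)"
    using I lm disj by (intro measure_UNION'[symmetric]) auto
  also have "\<dots> \<le> measure lebesgue B"
    using sub lm I by (intro measure_mono_fmeasurable Bm) (auto intro!: sets.finite_UN)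
  finally show ?thesis .
qed

text \<open>A nonisotropic ball: its extent is about r along the complex line of z and about sqrt r
  in the other directions, which suggests a volume of order r^(n+1). It is empty when r <= 1 -
  |z|.\<close>

definition slab :: "complex ^ 'n \<Rightarrow> real \<Rightarrow> (complex ^ 'n) set" where
  "slab z r = {u. norm u < 1 \<and> cmod (1 - hinner z u) < r}"

lemma slab_borel [measurable]: "slab z r \<in> sets borel"
  unfolding slab_def by measurable

lemma slab_subset_ball: "slab z r \<subseteq> ball 0 1"
  by (auto simp: slab_def)

lemma measure_subset_ball:
  fixes S :: "(complex ^ 'n) set"
  assumes "S \<in> sets borel" "S \<subseteq> ball 0 1"
  shows "measure lebesgue S \<le> unit_ball_vol (2 * real CARD('n))"
proof -
  have "measure lebesgue S \<le> measure lebesgue (ball (0 :: complex ^ 'n) 1)"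
    using assms by (intro measure_mono_fmeasurable) auto
  then show ?thesis by (simp add: content_ball mult.commute)
qed

text \<open>Expanding the square gives |u - z|^2 <= 2 - 2 Re <z,u> <= 2 |1 - <z,u>|.\<close>

lemma slab_near_centre:
  assumes "norm z < 1" "u \<in> slab z r"
  shows "norm (u - z) \<le> sqrt (2 * r)"
proof (rule real_le_rsqrt)
  have "(norm (u - z))\<^sup>2 = (norm u)\<^sup>2 + (norm z)\<^sup>2 - 2 * Re (hinner z u)"
    using norm_cvec_add_square[of "-z" u] by (simp add: hinner_def sum_negf)
  moreover have "(norm u)\<^sup>2 \<le> 1" "(norm z)\<^sup>2 \<le> 1"
    using assms by (auto simp: slab_def power_le_one)
  moreover have "Re (1 - hinner z u) \<le> r"
    using assms complex_Re_le_cmod[of "1 - hinner z u"] by (simp add: slab_def)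
  ultimately show "(norm (u - z))\<^sup>2 \<le> 2 * r" by simp
qed

text \<open>About \<open>1/r\<close> disjoint translates of the slab along the complex line through \<open>z\<close> fit into a
  Euclidean ball of radius comparable to \<open>sqrt r\<close>.\<close>

lemma slab_volume_small:
  fixes z :: "complex ^ 'n"
  assumes z: "norm z < 1" and r: "0 < r" "r \<le> 1 / 2"
  shows "measure lebesgue (slab z r) \<le> unit_ball_vol (2 * real CARD('n)) * 18 ^ (2 * CARD('n)) * r ^ (CARD('n) + 1)"
proof (cases "norm z > 1 / 2")
  case False
  \<comment> \<open>Here 1 - |z| >= 1/2 >= r, and |1 - <z,u>| is never below 1 - |z|.\<close>
  have "slab z r = {}"
  proof (rule ccontr)
    assume "slab z r \<noteq> {}"
    then obtain u where "norm u < 1" "cmod (1 - hinner z u) < r" by (auto simp: slab_def)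
    with cmod_one_minus_hinner_ge_left[of u z] False r show False by simp
  qed
  then show ?thesis using r by simp
next
  case z2: True
  \<comment> \<open>About 1/sqrt r steps in each of two real directions: N^2 >= 1/r, while a
    displacement of order r N is still of order sqrt r.\<close>
  define N where "N = nat \<lceil>1 / sqrt r\<rceil>"
  have N1: "real N \<ge> 1 / sqrt r" unfolding N_def by linarith
  have "1 / sqrt r \<ge> 1" using r by simp
  then have N2: "real N \<le> 2 / sqrt r" unfolding N_def by linarith
  define I where "I = {..<N} \<times> {..<N}"
  \<comment> \<open>Dividing by |z|^2 makes the inner product of \<open>d (k, l)\<close> with z
    equal to 2r(k + i l). On the slab \<open>hinner u z\<close> lies in the open disc of radius r
    about 1, and the shifts of this disc by a lattice of spacing 2r are disjoint.\<close>
  define lam :: "nat \<times> nat \<Rightarrow> complex"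
    where "lam = (\<lambda>(k, l). Complex (2 * r * real k) (2 * r * real l) / of_real ((norm z)\<^sup>2))"
  define d where "d i = lam i *s z" for i
  have hd: "hinner (d (k, l)) z = Complex (2 * r * real k) (2 * r * real l)" for k l
    using z2 by (auto simp: d_def hinner_smult_left hinner_self lam_def)
  have nd: "norm (d i) \<le> 16 * sqrt r" if "i \<in> I" for i
  proof -
    obtain k l where i: "i = (k, l)" by force
    have kl: "real k \<le> real N" "real l \<le> real N" using that by (auto simp: i I_def)
    have "norm (d i) = cmod (Complex (2 * r * real k) (2 * r * real l)) / norm z"
      using z2 by (simp add: d_def norm_smult_cvec lam_def i norm_divide power2_eq_square norm_mult)
    also have "\<dots> \<le> (2 * r * real N + 2 * r * real N) / (1 / 2)"
    proof (intro frac_le)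
      have "cmod (Complex (2 * r * real k) (2 * r * real l)) \<le> 2 * r * real k + 2 * r * real l"
        using complex_norm[of "2 * r * real k" "2 * r * real l"] r
        by (simp add: real_sqrt_sum_squares_less sqrt_sum_squares_le_sum)
      also have "\<dots> \<le> 2 * r * real N + 2 * r * real N"
        using kl r by (intro add_mono mult_left_mono) auto
      finally show "cmod (Complex (2 * r * real k) (2 * r * real l)) \<le> \<dots>" .
    qed (use z2 r in auto)
    also have "\<dots> = 8 * r * real N" by simp
    also have "\<dots> \<le> 8 * r * (2 / sqrt r)" using N2 r by (intro mult_left_mono) auto
    also have "\<dots> = 16 * (r / sqrt r)" by simp
    also have "\<dots> = 16 * sqrt r" using r by (simp only: real_div_sqrt)
    finally show ?thesis .
  qed
  \<comment> \<open>18 = 2 + 16: the slab lies within sqrt (2 r) <= 2 sqrt r of z, and the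
    translations are by at most 16 sqrt r.\<close>
  have "real (card I) * 1 ^ DIM(complex ^ 'n) * measure lebesgue (slab z r)
      \<le> measure lebesgue (cball z (18 * sqrt r))"
  proof (rule affine_packing[where m = "\<lambda>_. 1" and d = d])
    show "pairwise (\<lambda>i j. disjnt ((\<lambda>x. 1 *\<^sub>R x + d i) ` slab z r) ((\<lambda>x. 1 *\<^sub>R x + d j) ` slab z r)) I"
    proof (rule pairwiseI, rule ccontr)
      fix i j assume ij: "i \<in> I" "j \<in> I" "i \<noteq> j"
        and "\<not> disjnt ((\<lambda>x. 1 *\<^sub>R x + d i) ` slab z r) ((\<lambda>x. 1 *\<^sub>R x + d j) ` slab z r)"
      then obtain u v where uv: "u \<in> slab z r" "v \<in> slab z r" "u + d i = v + d j"
        by (auto simp: disjnt_def)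
      obtain k l k' l' where kl: "i = (k, l)" "j = (k', l')" by force
      have "cmod (1 - hinner u z) < r" "cmod (1 - hinner v z) < r"
        using uv by (auto simp: slab_def cmod_one_minus_hinner_commute)
      moreover have "hinner u z + Complex (2 * r * real k) (2 * r * real l)
          = hinner v z + Complex (2 * r * real k') (2 * r * real l')"
        using arg_cong[OF uv(3), of "\<lambda>x. hinner x z"] by (simp add: hinner_add_left hd kl)
      then have "Complex (2 * r * (real k - real k')) (2 * r * (real l - real l'))
          = (1 - hinner u z) - (1 - hinner v z)"
        by (auto simp: complex_eq_iff algebra_simps)
      ultimately have less: "cmod (Complex (2 * r * (real k - real k')) (2 * r * (real l - real l'))) < 2 * r"
        using norm_triangle_ineq4[of "1 - hinner u z" "1 - hinner v z"] by simp
      have "\<bar>2 * r * (real k - real k')\<bar> < 2 * r" "\<bar>2 * r * (real l - real l')\<bar> < 2 * r"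
        using less abs_Re_le_cmod[of "Complex (2 * r * (real k - real k')) (2 * r * (real l - real l'))"]
          abs_Im_le_cmod[of "Complex (2 * r * (real k - real k')) (2 * r * (real l - real l'))"] by auto
      then have "\<bar>real k - real k'\<bar> < 1" "\<bar>real l - real l'\<bar> < 1"
        using r by (auto simp: abs_mult)
      then have "k = k'" "l = l'" by linarith+
      with ij kl show False by simp
    qed
    fix i x assume i: "i \<in> I" and x: "x \<in> slab z r"
    have "norm (x + d i - z) \<le> norm (x - z) + norm (d i)"
      using norm_triangle_ineq[of "x - z" "d i"] by (simp add: algebra_simps)
    also have "\<dots> \<le> sqrt (2 * r) + 16 * sqrt r"
      using slab_near_centre[OF z x] nd[OF i] by simp
    also have "\<dots> \<le> 18 * sqrt r"
      using r real_sqrt_le_mono[of 2 4] by (simp add: real_sqrt_mult mult_right_mono)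
    finally show "1 *\<^sub>R x + d i \<in> cball z (18 * sqrt r)"
      by (simp add: dist_norm norm_minus_commute algebra_simps)
  qed (auto simp: I_def)
  also have "\<dots> = unit_ball_vol (2 * real CARD('n)) * (18 * sqrt r) ^ (2 * CARD('n))"
    using r by (simp add: content_cball mult.commute)
  also have "\<dots> = unit_ball_vol (2 * real CARD('n)) * 18 ^ (2 * CARD('n)) * r ^ CARD('n)"
    using r by (simp add: power_mult_distrib power_mult)
  finally have le: "(real N)\<^sup>2 * measure lebesgue (slab z r) \<le> unit_ball_vol (2 * real CARD('n)) * 18 ^ (2 * CARD('n)) * r ^ CARD('n)"
    by (simp add: I_def power2_eq_square)
  have "1 / r = (1 / sqrt r)\<^sup>2" using r by (simp add: power_divide)
  also have "\<dots> \<le> (real N)\<^sup>2" using N1 r by (intro power_mono) auto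
  finally have "1 / r * measure lebesgue (slab z r) \<le> (real N)\<^sup>2 * measure lebesgue (slab z r)"
    by (intro mult_right_mono) auto
  also note le
  finally show ?thesis using r by (simp add: field_simps)
qed

lemma slab_volume:
  fixes z :: "complex ^ 'n"
  assumes z: "norm z < 1" and r: "0 < r"
  shows "measure lebesgue (slab z r) \<le> unit_ball_vol (2 * real CARD('n)) * 18 ^ (2 * CARD('n)) * r ^ (CARD('n) + 1)"
proof (cases "r \<le> 1 / 2")
  case True
  then show ?thesis using slab_volume_small[OF z r] by simp
next
  case False
  \<comment> \<open>For r > 1/2 the claimed bound already exceeds the volume of the whole unit
    ball.\<close>
  have "(1 :: real) \<le> 18 ^ (CARD('n) - 1) * (18 * r) ^ (CARD('n) + 1)"
    using False mult_mono[OF one_le_power[of "18 :: real" "CARD('n) - 1"] one_le_power[of "18 * r" "CARD('n) + 1"]]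
    by simp
  also have "18 ^ (CARD('n) - 1) * (18 * r) ^ (CARD('n) + 1) = 18 ^ (2 * CARD('n)) * r ^ (CARD('n) + 1)"
  proof -
    have "CARD('n) - 1 + (CARD('n) + 1) = 2 * CARD('n)" using zero_less_card_finite[where 'a='n] by simp
    then show ?thesis by (simp only: power_mult_distrib mult.assoc[symmetric] power_add[symmetric])
  qed
  finally have "unit_ball_vol (2 * real CARD('n)) * 1 \<le> unit_ball_vol (2 * real CARD('n)) * (18 ^ (2 * CARD('n)) * r ^ (CARD('n) + 1))"
    by (intro mult_left_mono) auto
  with measure_subset_ball[OF slab_borel slab_subset_ball, of z r]
  have "measure lebesgue (slab z r) \<le> unit_ball_vol (2 * real CARD('n)) * (18 ^ (2 * CARD('n)) * r ^ (CARD('n) + 1))"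
    by linarith
  then show ?thesis by (simp only: mult.assoc)
qed

text \<open>Inside the slab, the shell \<open>1 - h < |u| < 1\<close> has about \<open>r/h\<close> disjoint dilates
  inside a slab of comparable width.\<close>

lemma slab_shell_volume:
  fixes z :: "complex ^ 'n"
  assumes z: "norm z < 1" and r: "0 < r" and h: "0 < h"
  shows "measure lebesgue {u \<in> slab z r. 1 - h \<le> norm u}
    \<le> unit_ball_vol (2 * real CARD('n)) * 18 ^ (2 * CARD('n)) * 8 ^ CARD('n) * 2 * r ^ CARD('n) * h"
  (is "measure lebesgue ?S \<le> ?V * _ * _ * _ * _ * _")
proof -
  have S: "?S \<in> sets borel" by measurable
  have S_le: "measure lebesgue ?S \<le> measure lebesgue (slab z r)"
    using S by (intro measure_mono_fmeasurable bounded_set_imp_lmeasurable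
        bounded_subset[OF bounded_ball slab_subset_ball]) auto
  consider "r < h" | "h \<le> r" "1 \<le> h" | "h \<le> r" "h < 1" by linarith
  then show ?thesis
  proof cases
    case 1
    have "measure lebesgue ?S \<le> ?V * 18 ^ (2 * CARD('n)) * (r ^ CARD('n) * r)"
      using S_le slab_volume[OF z r] by (simp add: mult_ac)
    also have "\<dots> \<le> ?V * 18 ^ (2 * CARD('n)) * (8 ^ CARD('n) * 2 * (r ^ CARD('n) * h))"
    proof (intro mult_left_mono)
      have "r ^ CARD('n) * r \<le> 1 * (r ^ CARD('n) * h)" using 1 r by simp
      also have "\<dots> \<le> (8 ^ CARD('n) * 2) * (r ^ CARD('n) * h)"
      proof (intro mult_right_mono)
        have "(1 :: real) \<le> 8 ^ CARD('n)" by simp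
        then show "(1 :: real) \<le> 8 ^ CARD('n) * 2" by linarith
      qed (use 1 r in auto)
      finally show "r ^ CARD('n) * r \<le> 8 ^ CARD('n) * 2 * (r ^ CARD('n) * h)" .
    qed auto
    finally show ?thesis by (simp add: mult_ac)
  next
    case 2
    have "measure lebesgue ?S \<le> ?V * 1"
      using measure_subset_ball[OF S] slab_subset_ball[of z r] by auto
    also have "\<dots> \<le> ?V * (18 ^ (2 * CARD('n)) * 8 ^ CARD('n) * 2 * r ^ CARD('n) * h)"
    proof (intro mult_left_mono)
      have ge: "(1 :: real) \<le> a * b" if "1 \<le> a" "1 \<le> b" for a b
        using mult_mono[OF that] that by simp
      show "1 \<le> 18 ^ (2 * CARD('n)) * 8 ^ CARD('n) * 2 * r ^ CARD('n) * h"
        using 2 by (intro ge one_le_power) auto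
    qed auto
    finally show ?thesis by (simp add: mult_ac)
  next
    case 3
    \<comment> \<open>Capping the total shrinkage at 1/2 keeps every factor (1-h)^j with j < N at
      least 1 - \<rho> >= 1/2 by Bernoulli's inequality, and the dilates stay in the slab of width r
      + \<rho>.\<close>
    define \<rho> where "\<rho> = min r (1 / 2)"
    define N where "N = nat \<lceil>\<rho> / h\<rceil>"
    have \<rho>: "0 < \<rho>" "\<rho> \<le> r" "\<rho> \<le> 1 / 2" using r by (auto simp: \<rho>_def)
    have N1: "\<rho> / h \<le> real N" unfolding N_def by linarith
    have N0: "0 < real N" using N1 \<rho> h by (smt (verit) divide_pos_pos)
    have jh: "real j * h \<le> \<rho>" if "j < N" for j
    proof -
      have "real j < \<rho> / h" using that unfolding N_def by linarith
      then show ?thesis using h by (simp add: field_simps)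
    qed
    have tau: "(1 - h) ^ j \<ge> 1 - \<rho>" "(1 - h) ^ j \<le> 1" if "j < N" for j
      using Bernoulli_inequality[of "-h" j] jh[OF that] 3 h by (auto intro!: power_le_one)
    have half: "(1 / 2 :: real) ^ DIM(complex ^ 'n) = (1 / 4) ^ CARD('n)"
    proof -
      have "DIM(complex ^ 'n) = 2 * CARD('n)" by simp
      then have "(1 / 2 :: real) ^ DIM(complex ^ 'n) = ((1 / 2)\<^sup>2) ^ CARD('n)"
        by (simp only: power_mult)
      then show ?thesis by (simp add: power2_eq_square)
    qed
    have "real (card {..<N}) * (1 / 2) ^ DIM(complex ^ 'n) * measure lebesgue ?S
        \<le> measure lebesgue (slab z (r + \<rho>))"
    proof (rule affine_packing[where m = "\<lambda>j. (1 - h) ^ j" and d = "\<lambda>_. 0"])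
      show "bounded (slab z (r + \<rho>))"
        by (rule bounded_subset[OF bounded_ball slab_subset_ball])
      fix j assume j: "j \<in> {..<N}"
      show "1 / 2 \<le> (1 - h) ^ j" using tau[of j] j \<rho> by auto
      fix x assume x: "x \<in> ?S"
      have "cmod (1 - hinner z ((1 - h) ^ j *\<^sub>R x))
          = cmod ((1 - hinner z x) + of_real (1 - (1 - h) ^ j) * hinner z x)"
        by (simp only: hinner_scaleR_right) (simp add: scaleR_conv_of_real algebra_simps)
      also have "\<dots> \<le> cmod (1 - hinner z x) + cmod (of_real (1 - (1 - h) ^ j) * hinner z x)"
        by (rule norm_triangle_ineq)
      also have "cmod (of_real (1 - (1 - h) ^ j) * hinner z x) \<le> \<rho> * 1"
        unfolding norm_mult
      proof (intro mult_mono)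
        show "cmod (of_real (1 - (1 - h) ^ j)) \<le> \<rho>"
          unfolding norm_of_real using tau[of j] j by auto
        show "cmod (hinner z x) \<le> 1"
          using norm_hinner_le[of z x] mult_le_one[of "norm z" "norm x"] x z by (simp add: slab_def)
      qed (use \<rho> in auto)
      finally have "cmod (1 - hinner z ((1 - h) ^ j *\<^sub>R x)) < r + \<rho>"
        using x by (simp add: slab_def)
      moreover have "norm ((1 - h) ^ j *\<^sub>R x) < 1"
      proof -
        have "norm ((1 - h) ^ j *\<^sub>R x) = (1 - h) ^ j * norm x" using 3 by simp
        also have "\<dots> \<le> 1 * norm x" using tau[of j] j by (intro mult_right_mono) auto
        also have "\<dots> < 1" using x by (simp add: slab_def)
        finally show ?thesis .
      qed
      ultimately show "(1 - h) ^ j *\<^sub>R x + 0 \<in> slab z (r + \<rho>)" by (simp add: slab_def)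
    next
      \<comment> \<open>Dilation by (1-h)^j sends the shell to norms from (1-h)^(j+1) up to, but
        excluding, (1-h)^j; distinct j give disjoint ranges.\<close>
      have *: "disjnt ((\<lambda>x. (1 - h) ^ i *\<^sub>R x + 0) ` ?S) ((\<lambda>x. (1 - h) ^ j *\<^sub>R x + 0) ` ?S)"
        if "i < j" for i j
      proof (rule ccontr)
        assume "\<not> ?thesis"
        then obtain u v where uv: "u \<in> ?S" "v \<in> ?S" "(1 - h) ^ i *\<^sub>R u = (1 - h) ^ j *\<^sub>R v"
          by (auto simp: disjnt_def)
        have "(1 - h) ^ Suc i \<le> (1 - h) ^ i * norm u"
          using uv(1) 3 by (simp add: mult_right_mono mult.commute[of "1 - h"] mult_left_mono)
        also have "\<dots> = (1 - h) ^ j * norm v"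
          using arg_cong[OF uv(3), of norm] 3 by simp
        also have "\<dots> < (1 - h) ^ j * 1"
          using uv(2) 3 by (intro mult_strict_left_mono) (auto simp: slab_def)
        also have "\<dots> \<le> (1 - h) ^ Suc i"
          using that 3 h power_decreasing[of "Suc i" j "1 - h"] by simp
        finally show False by simp
      qed
      show "pairwise (\<lambda>i j. disjnt ((\<lambda>x. (1 - h) ^ i *\<^sub>R x + 0) ` ?S)
          ((\<lambda>x. (1 - h) ^ j *\<^sub>R x + 0) ` ?S)) {..<N}"
      proof (rule pairwiseI)
        fix i j :: nat assume "i \<noteq> j"
        then consider "i < j" | "j < i" by linarith
        then show "disjnt ((\<lambda>x. (1 - h) ^ i *\<^sub>R x + 0) ` ?S) ((\<lambda>x. (1 - h) ^ j *\<^sub>R x + 0) ` ?S)"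
        proof cases
          case 1
          then show ?thesis by (rule *)
        next
          case 2
          then show ?thesis by (intro disjnt_sym[OF *])
        qed
      qed
    qed (use S in auto)
    also have "measure lebesgue (slab z (r + \<rho>)) \<le> ?V * 18 ^ (2 * CARD('n)) * 2 ^ CARD('n) * 2 * r ^ CARD('n) * \<rho>"
    proof (cases "r \<le> 1 / 2")
      case True
      then have "r + \<rho> = 2 * r" "\<rho> = r" by (auto simp: \<rho>_def)
      then show ?thesis using slab_volume[OF z, of "2 * r"] r by (simp add: power_mult_distrib mult_ac)
    next
      case False
      have "measure lebesgue (slab z (r + \<rho>)) \<le> ?V * 1"
        using measure_subset_ball[OF slab_borel slab_subset_ball, of z "r + \<rho>"] by simp
      also have "\<dots> \<le> ?V * (18 ^ (2 * CARD('n)) * (2 * r) ^ CARD('n))"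
        using False mult_mono[OF one_le_power[of "18 :: real" "2 * CARD('n)"] one_le_power[of "2 * r" "CARD('n)"]]
        by (intro mult_left_mono) auto
      finally show ?thesis using False by (simp add: \<rho>_def power_mult_distrib mult_ac)
    qed
    finally have le: "real N * ((1 / 4) ^ CARD('n) * measure lebesgue ?S)
        \<le> ?V * 18 ^ (2 * CARD('n)) * 2 ^ CARD('n) * 2 * r ^ CARD('n) * \<rho>"
      by (simp only: half card_lessThan mult.assoc)
    have "\<rho> \<le> real N * h" using N1 h by (simp add: field_simps)
    then have "?V * 18 ^ (2 * CARD('n)) * 2 ^ CARD('n) * 2 * r ^ CARD('n) * \<rho>
        \<le> ?V * 18 ^ (2 * CARD('n)) * 2 ^ CARD('n) * 2 * r ^ CARD('n) * (real N * h)"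
      using r by (intro mult_left_mono) auto
    with le have "real N * ((1 / 4) ^ CARD('n) * measure lebesgue ?S)
        \<le> real N * (?V * 18 ^ (2 * CARD('n)) * 2 ^ CARD('n) * 2 * r ^ CARD('n) * h)"
      by (simp add: mult_ac)
    then have "(1 / 4) ^ CARD('n) * measure lebesgue ?S
        \<le> ?V * 18 ^ (2 * CARD('n)) * 2 ^ CARD('n) * 2 * r ^ CARD('n) * h"
      using N0 by simp
    \<comment> \<open>The factor 8^n arises as 4^n from undoing the dilations, whose volume factor
      is at least (1/2)^(2n), times 2^n from a slab of width at most 2r.\<close>
    then have "4 ^ CARD('n) * ((1 / 4) ^ CARD('n) * measure lebesgue ?S)
        \<le> 4 ^ CARD('n) * (?V * 18 ^ (2 * CARD('n)) * 2 ^ CARD('n) * 2 * r ^ CARD('n) * h)"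
      by (intro mult_left_mono) auto
    also have "4 ^ CARD('n) * ((1 / 4) ^ CARD('n) * measure lebesgue ?S) = measure lebesgue ?S"
      by (simp add: power_divide)
    also have "4 ^ CARD('n) * (?V * 18 ^ (2 * CARD('n)) * 2 ^ CARD('n) * 2 * r ^ CARD('n) * h)
        = ?V * 18 ^ (2 * CARD('n)) * (4 * 2) ^ CARD('n) * 2 * r ^ CARD('n) * h"
      by (simp only: power_mult_distrib mult_ac)
    finally show ?thesis by simp
  qed
qed

section \<open>Dyadic decompositions\<close>

lemma power_of_two_index:
  assumes "1 \<le> (y :: real)"
  obtains i :: nat where "2 ^ i \<le> y" "y < 2 ^ (i + 1)"
proof -
  define i where "i = nat \<lfloor>log 2 y\<rfloor>"
  have "0 \<le> log 2 y" using assms by simp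
  then have "real i \<le> log 2 y" "log 2 y < real (i + 1)" unfolding i_def by linarith+
  then have "2 powr real i \<le> y" "y < 2 powr real (i + 1)"
    using assms by (simp_all add: le_log_iff log_less_iff)
  then show ?thesis by (intro that[of i]) (simp_all only: powr_realpow)
qed

lemma power_powr: "(2 ^ i :: real) powr e = (2 powr e) ^ i"
  by (simp add: powr_power powr_realpow[symmetric] powr_powr mult.commute)

lemma le_suminf_ennreal: "(f i :: ennreal) \<le> (\<Sum>i. f i)"
  using sum_le_suminf[of f "{i}"] by simp

text \<open>On the level where X is about \<rho>/2^i the integrand is about (\<rho>/2^i)^s and the
  measure at most A \<rho>/2^i, so the contributions form a geometric series of ratio 2^(-(1+s)),
  convergent because s > -1. The factor 2^|s| absorbs the variation of X within a level for either
  sign of s.\<close>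

lemma dyadic_small:
  fixes X :: "'a \<Rightarrow> real"
  assumes X [measurable]: "X \<in> borel_measurable M" and E [measurable]: "E \<in> sets M"
    and X0: "\<And>x. x \<in> E \<Longrightarrow> 0 < X x" and X\<rho>: "\<And>x. x \<in> E \<Longrightarrow> X x \<le> \<rho>"
    and le: "\<And>h. h > 0 \<Longrightarrow> emeasure M {x \<in> space M. x \<in> E \<and> X x \<le> h} \<le> ennreal (A * h)"
    and A: "0 \<le> A" and \<rho>: "0 < \<rho>" and s: "-1 < s"
  shows "(\<integral>\<^sup>+x. ennreal (X x powr s) * indicator E x \<partial>M)
    \<le> ennreal (A * \<rho> powr (1 + s) * (2 powr \<bar>s\<bar> / (1 - 2 powr - (1 + s))))"
proof -
  define F where "F i = {x \<in> space M. x \<in> E \<and> X x \<le> \<rho> / 2 ^ i}" for i :: nat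
  have [measurable]: "F i \<in> sets M" for i unfolding F_def by measurable
  define a where "a i = 2 powr \<bar>s\<bar> * (\<rho> / 2 ^ i) powr s" for i :: nat
  have pt: "ennreal (X x powr s) * indicator E x \<le> (\<Sum>i. ennreal (a i) * indicator (F i) x)"
    if x: "x \<in> space M" for x
  proof (cases "x \<in> E")
    case xE: True
    have "1 \<le> \<rho> / X x" using X0[OF xE] X\<rho>[OF xE] by simp
    then obtain i :: nat where i: "2 ^ i \<le> \<rho> / X x" "\<rho> / X x < 2 ^ (i + 1)" by (rule power_of_two_index)
    have X_le: "X x \<le> \<rho> / 2 ^ i" and X_ge: "\<rho> / 2 ^ i \<le> 2 * X x"
      using i X0[OF xE] by (simp_all add: field_simps)
    have "X x powr s \<le> a i"
    proof (cases "0 \<le> s")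
      case True
      have "X x powr s \<le> (\<rho> / 2 ^ i) powr s"
        using True X0[OF xE] X_le by (intro powr_mono2) auto
      also have "\<dots> \<le> 2 powr \<bar>s\<bar> * (\<rho> / 2 ^ i) powr s"
        using ge_one_powr_ge_zero[of 2 "\<bar>s\<bar>"] mult_right_mono[of 1 "2 powr \<bar>s\<bar>" "(\<rho> / 2 ^ i) powr s"] by simp
      finally show ?thesis by (simp add: a_def)
    next
      case False
      have "X x powr s = 2 powr \<bar>s\<bar> * (2 * X x) powr s"
        using False X0[OF xE] by (simp add: powr_mult powr_minus)
      also have "\<dots> \<le> 2 powr \<bar>s\<bar> * (\<rho> / 2 ^ i) powr s"
        using False X_ge \<rho> by (intro mult_left_mono powr_mono2') auto
      finally show ?thesis by (simp add: a_def)
    qed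
    then have "ennreal (X x powr s) * indicator E x \<le> ennreal (a i) * indicator (F i) x"
      using x xE X_le by (simp add: F_def ennreal_leI)
    also have "\<dots> \<le> (\<Sum>i. ennreal (a i) * indicator (F i) x)"
      by (rule le_suminf_ennreal)
    finally show ?thesis .
  qed auto
  have q: "2 powr - (1 + s) < 1" using s powr_less_mono[of "- (1 + s)" 0 2] by simp
  have "(\<integral>\<^sup>+x. ennreal (X x powr s) * indicator E x \<partial>M)
      \<le> (\<integral>\<^sup>+x. (\<Sum>i. ennreal (a i) * indicator (F i) x) \<partial>M)"
    by (intro nn_integral_mono pt)
  also have "\<dots> = (\<Sum>i. ennreal (a i) * emeasure M (F i))"
    by (subst nn_integral_suminf) (auto simp: nn_integral_cmult_indicator)
  also have "\<dots> \<le> (\<Sum>i. ennreal (A * \<rho> powr (1 + s) * 2 powr \<bar>s\<bar> * (2 powr - (1 + s)) ^ i))"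
  proof (intro suminf_le allI summableI)
    fix i :: nat
    have "ennreal (a i) * emeasure M (F i) \<le> ennreal (a i) * ennreal (A * (\<rho> / 2 ^ i))"
      unfolding F_def using \<rho> by (intro mult_left_mono le) auto
    also have "\<dots> = ennreal (a i * (A * (\<rho> / 2 ^ i)))"
      using A \<rho> by (intro ennreal_mult[symmetric]) (auto simp: a_def)
    also have "a i * (A * (\<rho> / 2 ^ i)) = A * 2 powr \<bar>s\<bar> * ((\<rho> / 2 ^ i) powr 1 * (\<rho> / 2 ^ i) powr s)"
      using \<rho> by (simp add: a_def)
    also have "(\<rho> / 2 ^ i) powr 1 * (\<rho> / 2 ^ i) powr s = \<rho> powr (1 + s) * (2 powr - (1 + s)) ^ i"
    proof -
      have "(\<rho> / 2 ^ i) powr 1 * (\<rho> / 2 ^ i) powr s = (\<rho> / 2 ^ i) powr (1 + s)"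
        by (simp only: powr_add)
      also have "\<dots> = \<rho> powr (1 + s) * (2 ^ i) powr - (1 + s)"
        using \<rho> by (simp add: powr_divide powr_minus_divide del: minus_add_distrib)
      finally show ?thesis by (simp only: power_powr)
    qed
    finally show "ennreal (a i) * emeasure M (F i) \<le> ennreal (A * \<rho> powr (1 + s) * 2 powr \<bar>s\<bar> * (2 powr - (1 + s)) ^ i)"
      by (simp add: mult_ac)
  qed
  also have "\<dots> = ennreal (A * \<rho> powr (1 + s) * 2 powr \<bar>s\<bar> * (1 / (1 - 2 powr - (1 + s))))"
    using A q by (intro suminf_ennreal_eq sums_mult geometric_sums) auto
  finally show ?thesis by simp
qed

text \<open>The counterpart for X bounded below: the levels are 2^i \<delta>, and the contributions
  (2^i \<delta>)^(-t) A (2^(i+1) \<delta>)^k form a geometric series of ratio 2^(k-t) < 1.\<close>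

lemma dyadic_large:
  fixes X :: "'a \<Rightarrow> real"
  assumes X [measurable]: "X \<in> borel_measurable M"
    and X\<delta>: "\<And>x. x \<in> space M \<Longrightarrow> \<delta> \<le> X x" and \<delta>: "0 < \<delta>"
    and le: "\<And>h. h > 0 \<Longrightarrow> emeasure M {x \<in> space M. X x < h} \<le> ennreal (A * h powr k)"
    and A: "0 \<le> A" and t: "0 \<le> t" "k < t"
  shows "(\<integral>\<^sup>+x. ennreal (X x powr - t) \<partial>M)
    \<le> ennreal (A * 2 powr k * \<delta> powr (k - t) / (1 - 2 powr (k - t)))"
proof -
  define F where "F i = {x \<in> space M. X x < 2 ^ (i + 1) * \<delta>}" for i :: nat
  have [measurable]: "F i \<in> sets M" for i unfolding F_def by measurable
  define a where "a i = (2 ^ i * \<delta>) powr - t" for i :: nat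
  have pt: "ennreal (X x powr - t) \<le> (\<Sum>i. ennreal (a i) * indicator (F i) x)"
    if x: "x \<in> space M" for x
  proof -
    have "1 \<le> X x / \<delta>" using X\<delta>[OF x] \<delta> by simp
    then obtain i :: nat where i: "2 ^ i \<le> X x / \<delta>" "X x / \<delta> < 2 ^ (i + 1)" by (rule power_of_two_index)
    then have i: "2 ^ i * \<delta> \<le> X x" "X x < 2 ^ (i + 1) * \<delta>" using \<delta> by (simp_all add: field_simps)
    have "X x powr - t \<le> a i"
      unfolding a_def using i(1) t \<delta> by (intro powr_mono2') auto
    then have "ennreal (X x powr - t) \<le> ennreal (a i) * indicator (F i) x"
      using x i by (simp add: F_def ennreal_leI)
    also have "\<dots> \<le> (\<Sum>i. ennreal (a i) * indicator (F i) x)"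
      by (rule le_suminf_ennreal)
    finally show ?thesis .
  qed
  have q: "2 powr (k - t) < 1" using t powr_less_mono[of "k - t" 0 2] by simp
  have "(\<integral>\<^sup>+x. ennreal (X x powr - t) \<partial>M)
      \<le> (\<integral>\<^sup>+x. (\<Sum>i. ennreal (a i) * indicator (F i) x) \<partial>M)"
    by (intro nn_integral_mono pt)
  also have "\<dots> = (\<Sum>i. ennreal (a i) * emeasure M (F i))"
    by (subst nn_integral_suminf) (auto simp: nn_integral_cmult_indicator)
  also have "\<dots> \<le> (\<Sum>i. ennreal (A * 2 powr k * \<delta> powr (k - t) * (2 powr (k - t)) ^ i))"
  proof (intro suminf_le allI summableI)
    fix i :: nat
    have "ennreal (a i) * emeasure M (F i) \<le> ennreal (a i) * ennreal (A * (2 ^ (i + 1) * \<delta>) powr k)"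
      unfolding F_def using \<delta> by (intro mult_left_mono le) auto
    also have "\<dots> = ennreal (a i * (A * (2 ^ (i + 1) * \<delta>) powr k))"
      using A by (intro ennreal_mult[symmetric]) (auto simp: a_def)
    also have "a i * (A * (2 ^ (i + 1) * \<delta>) powr k)
        = A * 2 powr k * ((2 ^ i * \<delta>) powr - t * (2 ^ i * \<delta>) powr k)"
      using \<delta> by (simp add: a_def powr_mult mult_ac)
    also have "(2 ^ i * \<delta>) powr - t * (2 ^ i * \<delta>) powr k = \<delta> powr (k - t) * (2 powr (k - t)) ^ i"
    proof -
      have "(2 ^ i * \<delta>) powr - t * (2 ^ i * \<delta>) powr k = (2 ^ i * \<delta>) powr (k - t)"
        by (simp add: powr_add[symmetric])
      also have "\<dots> = \<delta> powr (k - t) * (2 ^ i) powr (k - t)"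
        using \<delta> by (simp add: powr_mult)
      finally show ?thesis by (simp only: power_powr)
    qed
    finally show "ennreal (a i) * emeasure M (F i) \<le> ennreal (A * 2 powr k * \<delta> powr (k - t) * (2 powr (k - t)) ^ i)"
      by (simp add: mult_ac)
  qed
  also have "\<dots> = ennreal (A * 2 powr k * \<delta> powr (k - t) * (1 / (1 - 2 powr (k - t))))"
    using A q by (intro suminf_ennreal_eq sums_mult geometric_sums) auto
  finally show ?thesis by simp
qed

section \<open>The Forelli--Rudin estimate\<close>

lemma emeasure_ball_vol:
  fixes S :: "(complex ^ 'n) set"
  assumes "S \<in> sets borel" "S \<subseteq> ball 0 1"
  shows "emeasure ball_vol S = ennreal (measure lebesgue S / unit_ball_vol (2 * real CARD('n)))"
proof -
  have S: "S \<in> lmeasurable"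
    using assms by (intro bounded_set_imp_lmeasurable bounded_subset[OF bounded_ball]) auto
  have "emeasure lebesgue S = ennreal (measure lebesgue S)"
    using S by (rule emeasure_eq_measure2)
  then have "emeasure lborel S = ennreal (measure lebesgue S)"
    using assms by simp
  moreover have "emeasure lborel (ball (0 :: complex ^ 'n) 1) = ennreal (unit_ball_vol (2 * real CARD('n)))"
    by (simp add: emeasure_ball mult.commute)
  ultimately show ?thesis
    using assms by (simp add: ball_vol_def emeasure_restrict_space emeasure_uniform_measure
        Int_absorb1 divide_ennreal unit_ball_vol_pos)
qed

lemma sets_ball_vol: "sets ball_vol = sets (restrict_space borel (ball 0 1))"
  unfolding ball_vol_def by (intro sets_restrict_space_cong) simp

lemma measurable_ball_vol:
  "f \<in> borel_measurable borel \<Longrightarrow> f \<in> measurable ball_vol borel"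
  unfolding ball_vol_def by (intro measurable_restrict_space1) simp

lemma measurable_ident_ball_vol [measurable]: "(\<lambda>x. x) \<in> measurable ball_vol borel"
  by (rule measurable_ball_vol) simp

lemma subset_ball_sets_ball_vol: "S \<in> sets borel \<Longrightarrow> S \<subseteq> ball 0 1 \<Longrightarrow> S \<in> sets ball_vol"
  unfolding sets_ball_vol by (auto simp: sets_restrict_space_iff)

lemma one_minus_norm_square_pos: "norm (u :: complex ^ 'n) < 1 \<Longrightarrow> 0 < 1 - (norm u)\<^sup>2"
  by (simp add: power_less_one_iff abs_square_less_1)

lemma one_minus_norm_le_square: "norm (u :: complex ^ 'n) < 1 \<Longrightarrow> 1 - norm u \<le> 1 - (norm u)\<^sup>2"
  using power_le_one_iff mult_left_mono[of "norm u" 1 "norm u"] by (simp add: power2_eq_square)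

lemma one_minus_norm_square_le: "norm (u :: complex ^ 'n) < 1 \<Longrightarrow> 1 - (norm u)\<^sup>2 \<le> 2 * (1 - norm u)"
  using zero_le_power2[of "1 - norm u"] by (simp add: power2_eq_square algebra_simps)

text \<open>\<open>dyadic_small\<close> for 1 - |u|^2 on the slab: a shell of thickness k has
  measure at most a constant times h^n k, which gives h^n h^(1+s) in total. The cutoff is 2h because
  1 - |u|^2 <= 2 (1 - |u|) <= 2 |1 - <z,u>| there.\<close>

lemma weighted_slab_measure:
  fixes z :: "complex ^ 'n"
  assumes z: "norm z < 1" and h: "0 < h" and s: "-1 < s"
  shows "(\<integral>\<^sup>+u. ennreal ((1 - (norm u)\<^sup>2) powr s) * indicator (slab z h) u \<partial>ball_vol)
    \<le> ennreal (18 ^ (2 * CARD('n)) * 8 ^ CARD('n) * 2 * 2 powr (1 + s)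
        * (2 powr \<bar>s\<bar> / (1 - 2 powr - (1 + s))) * h powr (real CARD('n) + 1 + s))"
proof -
  have "(\<integral>\<^sup>+u. ennreal ((1 - (norm u)\<^sup>2) powr s) * indicator (slab z h) u \<partial>ball_vol)
    \<le> ennreal ((18 ^ (2 * CARD('n)) * 8 ^ CARD('n) * 2 * h ^ CARD('n)) * (2 * h) powr (1 + s)
        * (2 powr \<bar>s\<bar> / (1 - 2 powr - (1 + s))))"
  proof (rule dyadic_small)
    show "slab z h \<in> sets ball_vol"
      by (intro subset_ball_sets_ball_vol slab_borel slab_subset_ball)
    show "(\<lambda>u. 1 - (norm u)\<^sup>2) \<in> borel_measurable ball_vol" by measurable
    fix k :: real assume k: "0 < k"
    have "emeasure ball_vol {u \<in> space ball_vol. u \<in> slab z h \<and> 1 - (norm u)\<^sup>2 \<le> k}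
        \<le> emeasure ball_vol {u \<in> slab z h. 1 - k \<le> norm u}"
    proof (rule emeasure_mono)
      show "{u \<in> slab z h. 1 - k \<le> norm u} \<in> sets ball_vol"
        by (intro subset_ball_sets_ball_vol) (measurable, auto simp: slab_def)
      show "{u \<in> space ball_vol. u \<in> slab z h \<and> 1 - (norm u)\<^sup>2 \<le> k} \<subseteq> {u \<in> slab z h. 1 - k \<le> norm u}"
        using one_minus_norm_le_square by force
    qed
    also have "\<dots> = ennreal (measure lebesgue {u \<in> slab z h. 1 - k \<le> norm u} / unit_ball_vol (2 * real CARD('n)))"
      by (rule emeasure_ball_vol) (measurable, auto simp: slab_def)
    also have "\<dots> \<le> ennreal (18 ^ (2 * CARD('n)) * 8 ^ CARD('n) * 2 * h ^ CARD('n) * k)"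
      using slab_shell_volume[OF z h k] by (intro ennreal_leI) (simp add: field_simps unit_ball_vol_pos)
    finally show "emeasure ball_vol {u \<in> space ball_vol. u \<in> slab z h \<and> 1 - (norm u)\<^sup>2 \<le> k} \<le> \<dots>" .
  next
    fix u assume u: "u \<in> slab z h"
    then show "0 < 1 - (norm u)\<^sup>2" by (intro one_minus_norm_square_pos) (simp add: slab_def)
    show "1 - (norm u)\<^sup>2 \<le> 2 * h"
      using u one_minus_norm_square_le[of u] cmod_one_minus_hinner_ge_right[OF z, of u] by (auto simp: slab_def)
  qed (use h s in auto)
  also have "(18 ^ (2 * CARD('n)) * 8 ^ CARD('n) * 2 * h ^ CARD('n)) * (2 * h) powr (1 + s)
        * (2 powr \<bar>s\<bar> / (1 - 2 powr - (1 + s)))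
     = 18 ^ (2 * CARD('n)) * 8 ^ CARD('n) * 2 * 2 powr (1 + s)
        * (2 powr \<bar>s\<bar> / (1 - 2 powr - (1 + s))) * (h powr real CARD('n) * h powr (1 + s))"
    using h by (simp add: powr_mult powr_realpow)
  also have "h powr real CARD('n) * h powr (1 + s) = h powr (real CARD('n) + 1 + s)"
    by (simp add: powr_add[symmetric] add.assoc)
  finally show ?thesis .
qed

text \<open>Under the measure with density (1 - |u|^2)^s the slab of width h has mass at most a
  constant times h^(n+1+s). Since |1 - <z,u>| >= 1 - |z|, \<open>dyadic_large\<close> with \<delta>
  = 1 - |z| and k = n+1+s applies as soon as t exceeds k.\<close>

lemma Forelli_Rudin_upper:
  assumes s: "-1 < s" and t: "real CARD('n) + 1 + s < t"
  shows "\<exists>K\<ge>0. \<forall>z :: complex ^ 'n. norm z < 1 \<longrightarrow>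
    (\<integral>\<^sup>+u. ennreal ((1 - (norm u)\<^sup>2) powr s * cmod (1 - hinner z u) powr - t) \<partial>ball_vol)
      \<le> ennreal (K * (1 - (norm z)\<^sup>2) powr (real CARD('n) + 1 + s - t))"
proof -
  define k where "k = real CARD('n) + 1 + s"
  define A where "A = 18 ^ (2 * CARD('n)) * 8 ^ CARD('n) * 2 * 2 powr (1 + s)
        * (2 powr \<bar>s\<bar> / (1 - 2 powr - (1 + s)))"
  have "2 powr - (1 + s) < 1" using s powr_less_mono[of "- (1 + s)" 0 2] by simp
  then have A: "A \<ge> 0" unfolding A_def by simp
  have q: "2 powr (k - t) < 1" using t powr_less_mono[of "k - t" 0 2] by (simp add: k_def)
  define K where "K = A * 2 powr k * 2 powr (t - k) / (1 - 2 powr (k - t))"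
  have "K \<ge> 0" unfolding K_def using A q by simp
  moreover have "(\<integral>\<^sup>+u. ennreal ((1 - (norm u)\<^sup>2) powr s * cmod (1 - hinner z u) powr - t) \<partial>ball_vol)
      \<le> ennreal (K * (1 - (norm z)\<^sup>2) powr (k - t))" if z: "norm z < 1" for z :: "complex ^ 'n"
  proof -
    define M where "M = density ball_vol (\<lambda>u :: complex ^ 'n. ennreal ((1 - (norm u)\<^sup>2) powr s))"
    have [simp]: "space M = ball 0 1" by (simp add: M_def)
    have meas [measurable]: "(\<lambda>u. cmod (1 - hinner z u)) \<in> borel_measurable M"
      unfolding M_def by measurable
    have "(\<integral>\<^sup>+u. ennreal ((1 - (norm u)\<^sup>2) powr s * cmod (1 - hinner z u) powr - t) \<partial>ball_vol)
        = (\<integral>\<^sup>+u. ennreal (cmod (1 - hinner z u) powr - t) \<partial>M)"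
      unfolding M_def by (subst nn_integral_density) (auto simp: ennreal_mult)
    also have "\<dots> \<le> ennreal (A * 2 powr k * (1 - norm z) powr (k - t) / (1 - 2 powr (k - t)))"
    proof (rule dyadic_large[OF meas])
      show "1 - norm z \<le> cmod (1 - hinner z u)" if "u \<in> space M" for u
        using that cmod_one_minus_hinner_ge_left[of u z] by simp
      fix h :: real assume h: "0 < h"
      have *: "{u \<in> space M. cmod (1 - hinner z u) < h} = slab z h"
        by (auto simp: slab_def)
      have "emeasure M (slab z h) = (\<integral>\<^sup>+u. ennreal ((1 - (norm u)\<^sup>2) powr s) * indicator (slab z h) u \<partial>ball_vol)"
        unfolding M_def
        by (intro emeasure_density subset_ball_sets_ball_vol slab_borel slab_subset_ball) measurable
      also have "\<dots> \<le> ennreal (A * h powr k)"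
        unfolding A_def k_def by (rule weighted_slab_measure[OF z h s])
      finally show "emeasure M {u \<in> space M. cmod (1 - hinner z u) < h} \<le> ennreal (A * h powr k)"
        unfolding * .
    qed (use z A s t in \<open>auto simp: k_def\<close>)
    also have "\<dots> \<le> ennreal (K * (1 - (norm z)\<^sup>2) powr (k - t))"
    proof (intro ennreal_leI)
      \<comment> \<open>The exponent is negative, so passing from 1 - |z| to 1 - |z|^2 <= 2 (1 -
        |z|) costs the factor 2^(t-k) contained in K.\<close>
      have "(1 - norm z) powr (k - t) \<le> ((1 - (norm z)\<^sup>2) / 2) powr (k - t)"
        using t one_minus_norm_square_le[OF z] one_minus_norm_square_pos[OF z]
        by (intro powr_mono2') (auto simp: k_def)
      also have "\<dots> = 2 powr (t - k) * (1 - (norm z)\<^sup>2) powr (k - t)"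
        using one_minus_norm_square_pos[OF z] powr_minus[of 2 "k - t"] by (simp add: powr_divide field_simps)
      finally have "A * 2 powr k / (1 - 2 powr (k - t)) * (1 - norm z) powr (k - t)
          \<le> A * 2 powr k / (1 - 2 powr (k - t)) * (2 powr (t - k) * (1 - (norm z)\<^sup>2) powr (k - t))"
        using A q by (intro mult_left_mono) auto
      then show "A * 2 powr k * (1 - norm z) powr (k - t) / (1 - 2 powr (k - t)) \<le> K * (1 - (norm z)\<^sup>2) powr (k - t)"
        by (simp add: K_def mult_ac)
    qed
    finally show ?thesis .
  qed
  ultimately show ?thesis unfolding k_def by blast
qed

section \<open>One variable\<close>

abbreviation bdist :: "complex ^ 'n \<Rightarrow> real" where
  "bdist u \<equiv> 1 - (norm u)\<^sup>2"

definition wt_const :: "'n itself \<Rightarrow> real \<Rightarrow> real" where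
  "wt_const _ \<theta> = Gamma (real CARD('n) + \<theta> + 1) / (fact CARD('n) * Gamma (\<theta> + 1))"

lemma wt_const_pos: "\<theta> > -1 \<Longrightarrow> wt_const TYPE('n::finite) \<theta> > 0"
  by (simp add: wt_const_def Gamma_real_pos)

interpretation ball_vol: finite_measure "ball_vol :: (complex ^ 'n) measure"
  by standard (simp add: emeasure_ball_vol_UNIV)

lemma sets_ball_vol_wt [measurable_cong, simp]: "sets (ball_vol_wt \<theta>) = sets ball_vol"
  by (simp add: ball_vol_wt_def)

lemma space_ball_vol_wt [simp]: "space (ball_vol_wt \<theta>) = ball 0 1"
  by (simp add: ball_vol_wt_def)

text \<open>\<open>ball_vol\<close> carries the trace of the Borel sets on the ball. Components of
  pairs must be read as Borel points of the whole space before measurability of norms and of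
  \<open>hinner\<close> can be applied to them.\<close>

lemma measurable_into_ball_vol_fst [measurable (raw)]:
  assumes "f \<in> measurable N (ball_vol \<Otimes>\<^sub>M P)"
  shows "(\<lambda>x. fst (f x)) \<in> measurable N borel"
  using measurable_compose[OF measurable_fst'[OF assms] measurable_ident_ball_vol] by simp

lemma measurable_into_ball_vol_snd [measurable (raw)]:
  assumes "f \<in> measurable N (P \<Otimes>\<^sub>M ball_vol)"
  shows "(\<lambda>x. snd (f x)) \<in> measurable N borel"
  using measurable_compose[OF measurable_snd'[OF assms] measurable_ident_ball_vol] by simp

lemma bdist_pos: "u \<in> space ball_vol \<Longrightarrow> 0 < bdist u"
  by (rule one_minus_norm_square_pos) simp


lemma nn_integral_ball_vol_wt:
  fixes f :: "complex ^ 'n \<Rightarrow> ennreal"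
  assumes \<theta>: "\<theta> > -1" and f [measurable]: "f \<in> borel_measurable ball_vol"
  shows "(\<integral>\<^sup>+z. f z \<partial>ball_vol_wt \<theta>)
    = ennreal (wt_const TYPE('n) \<theta>) * (\<integral>\<^sup>+z. ennreal (bdist z powr \<theta>) * f z \<partial>ball_vol)"
proof -
  have "(\<integral>\<^sup>+z. f z \<partial>ball_vol_wt \<theta>)
      = (\<integral>\<^sup>+z. ennreal (wt_const TYPE('n) \<theta> * bdist z powr \<theta>) * f z \<partial>ball_vol)"
    unfolding ball_vol_wt_def wt_const_def by (subst nn_integral_density) auto
  also have "\<dots> = (\<integral>\<^sup>+z. ennreal (wt_const TYPE('n) \<theta>) * (ennreal (bdist z powr \<theta>) * f z) \<partial>ball_vol)"
    using wt_const_pos[OF \<theta>, where 'n='n] by (simp add: ennreal_mult mult.assoc)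
  finally show ?thesis by (simp add: nn_integral_cmult)
qed

text \<open>The Forelli-Rudin estimate at z = 0, where the kernel equals 1; n + 2 + s is just one
  exponent above the threshold.\<close>

lemma nn_integral_bdist_powr_finite:
  assumes "s > -1"
  shows "(\<integral>\<^sup>+z. ennreal (bdist (z :: complex ^ 'n) powr s) \<partial>ball_vol) < top"
proof -
  obtain K where "\<And>z :: complex ^ 'n. norm z < 1 \<Longrightarrow>
    (\<integral>\<^sup>+u. ennreal ((1 - (norm u)\<^sup>2) powr s * cmod (1 - hinner z u) powr - (real CARD('n) + 2 + s)) \<partial>ball_vol)
      \<le> ennreal (K * (1 - (norm z)\<^sup>2) powr (real CARD('n) + 1 + s - (real CARD('n) + 2 + s)))"
    using Forelli_Rudin_upper[OF assms, of "real CARD('n) + 2 + s", where 'n='n] by auto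
  from this[of 0] have "(\<integral>\<^sup>+z. ennreal (bdist (z :: complex ^ 'n) powr s) \<partial>ball_vol) \<le> ennreal K" by simp
  then show ?thesis by (rule order.strict_trans1) simp
qed

lemma finite_measure_ball_vol_wt:
  assumes "\<theta> > -1"
  shows "finite_measure (ball_vol_wt \<theta> :: (complex ^ 'n) measure)"
proof
  have "emeasure (ball_vol_wt \<theta>) (space (ball_vol_wt \<theta> :: (complex ^ 'n) measure))
      = (\<integral>\<^sup>+z. 1 \<partial>(ball_vol_wt \<theta> :: (complex ^ 'n) measure))"
    by simp
  also have "\<dots> = ennreal (wt_const TYPE('n) \<theta>) * (\<integral>\<^sup>+z. ennreal (bdist (z :: complex ^ 'n) powr \<theta>) \<partial>ball_vol)"
    using assms by (subst nn_integral_ball_vol_wt) auto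
  also have "\<dots> < top"
    using nn_integral_bdist_powr_finite[OF assms, where 'n = 'n] by (simp add: ennreal_mult_less_top)
  finally show "emeasure (ball_vol_wt \<theta>) (space (ball_vol_wt \<theta> :: (complex ^ 'n) measure)) \<noteq> \<infinity>"
    by simp
qed

section \<open>Schur test for the positive operator in one variable\<close>

definition fr_kernel :: "real \<Rightarrow> real \<Rightarrow> real \<Rightarrow> complex ^ 'n \<Rightarrow> complex ^ 'n \<Rightarrow> ennreal" where
  "fr_kernel a b c z u = ennreal (bdist z powr a * bdist u powr b * cmod (1 - hinner z u) powr - c)"

definition pos_op :: "real \<Rightarrow> real \<Rightarrow> real \<Rightarrow> (complex ^ 'n \<Rightarrow> ennreal) \<Rightarrow> complex ^ 'n \<Rightarrow> ennreal" where
  "pos_op a b c g z = (\<integral>\<^sup>+u. fr_kernel a b c z u * g u \<partial>ball_vol)"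

lemma measurable_fr_kernel [measurable]:
  assumes [measurable]: "f \<in> borel_measurable M" "g \<in> borel_measurable M"
  shows "(\<lambda>x. fr_kernel a b c (f x) (g x)) \<in> borel_measurable M"
  unfolding fr_kernel_def by measurable

lemma measurable_pos_op [measurable]:
  assumes [measurable]: "g \<in> borel_measurable ball_vol"
  shows "pos_op a b c g \<in> borel_measurable ball_vol"
  unfolding pos_op_def by measurable

text \<open>The factor (1 - |u|^2)^y |1 - <z,u>|^(-c1) is split off the kernel and its L^p' norm in
  u is estimated by Forelli-Rudin. The choice of c1 makes n + 1 + y p' - c1 p' equal to -k p', so
  this norm is at most a constant times (1 - |z|^2)^(-k), cancelled by the power k taken out of the
  outer weight; hence a - k on the right.\<close>

lemma pos_op_Holder:
  assumes p: "1 < p" and p': "p' = p / (p - 1)"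
    and y: "-1 < y * p'" and k: "0 < k" and c1: "c1 = (real CARD('n) + 1) / p' + y + k"
  shows "\<exists>C<top. \<forall>g \<in> borel_measurable ball_vol. \<forall>z::complex ^ 'n. norm z < 1 \<longrightarrow> pos_op a b c g z
    \<le> C * ennreal_powr (\<integral>\<^sup>+u. ennreal_powr (fr_kernel (a - k) (b - y) (c - c1) z u * g u) p \<partial>ball_vol) (1 / p)"
proof -
  have p'1: "1 < p'" "1 / p' + 1 / p = 1" using p by (auto simp: p' field_simps)
  have "real CARD('n) + 1 + y * p' < c1 * p'"
    using p'1 k by (simp add: c1 field_simps)
  from Forelli_Rudin_upper[OF y this]
  obtain K where K: "0 \<le> K" "\<And>z :: complex ^ 'n. norm z < 1 \<Longrightarrow>
      (\<integral>\<^sup>+u. ennreal (bdist u powr (y * p') * cmod (1 - hinner z u) powr - (c1 * p')) \<partial>ball_vol)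
      \<le> ennreal (K * bdist z powr (real CARD('n) + 1 + y * p' - c1 * p'))" by auto
  have e: "real CARD('n) + 1 + y * p' - c1 * p' = - k * p'"
    using p'1 by (simp add: c1 field_simps)
  have "pos_op a b c g z \<le> ennreal (K powr (1 / p')) *
      ennreal_powr (\<integral>\<^sup>+u. ennreal_powr (fr_kernel (a - k) (b - y) (c - c1) z u * g u) p \<partial>ball_vol) (1 / p)"
    if [measurable]: "g \<in> borel_measurable ball_vol" and z: "norm z < 1" for g and z :: "complex ^ 'n"
  proof -
    have dz: "0 < bdist z" using z by (rule one_minus_norm_square_pos)
    define f1 where "f1 u = ennreal (bdist u powr y * cmod (1 - hinner z u) powr - c1)" for u :: "complex ^ 'n"
    define f2 where "f2 u = fr_kernel (a - k) (b - y) (c - c1) z u * g u" for u :: "complex ^ 'n"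
    have [measurable]: "f1 \<in> borel_measurable ball_vol" "f2 \<in> borel_measurable ball_vol"
      unfolding f1_def f2_def by measurable
    have "pos_op a b c g z = (\<integral>\<^sup>+u. ennreal (bdist z powr k) * (f1 u * f2 u) \<partial>ball_vol)"
      unfolding pos_op_def
    proof (intro nn_integral_cong)
      fix u :: "complex ^ 'n" assume u: "u \<in> space ball_vol"
      have "fr_kernel a b c z u = ennreal ((bdist z powr k * bdist z powr (a - k)) * (bdist u powr y * bdist u powr (b - y))
          * (cmod (1 - hinner z u) powr - c1 * cmod (1 - hinner z u) powr - (c - c1)))"
        by (simp only: powr_add[symmetric] fr_kernel_def) simp
      also have "\<dots> = ennreal (bdist z powr k) * f1 u * fr_kernel (a - k) (b - y) (c - c1) z u"
        unfolding f1_def fr_kernel_def by (simp add: ennreal_mult[symmetric] mult_ac)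
      finally show "fr_kernel a b c z u * g u = ennreal (bdist z powr k) * (f1 u * f2 u)"
        by (simp add: f2_def mult.assoc)
    qed
    also have "\<dots> = ennreal (bdist z powr k) * (\<integral>\<^sup>+u. f1 u * f2 u \<partial>ball_vol)"
      by (rule nn_integral_cmult) measurable
    also have "\<dots> \<le> ennreal (bdist z powr k) * (Lp_norm p' ball_vol f1 * Lp_norm p ball_vol f2)"
      using p p'1 by (intro mult_left_mono nn_integral_Holder) auto
    also have "Lp_norm p' ball_vol f1 \<le> ennreal (K powr (1 / p') * bdist z powr - k)"
    proof -
      have "(\<integral>\<^sup>+u. ennreal_powr (f1 u) p' \<partial>ball_vol)
          = (\<integral>\<^sup>+u. ennreal (bdist u powr (y * p') * cmod (1 - hinner z u) powr - (c1 * p')) \<partial>ball_vol)"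
        unfolding f1_def by (intro nn_integral_cong) (simp add: powr_mult powr_powr)
      also have "\<dots> \<le> ennreal (K * bdist z powr (- k * p'))"
        using K(2)[OF z] by (simp only: e)
      finally have "Lp_norm p' ball_vol f1 \<le> ennreal_powr (ennreal (K * bdist z powr (- k * p'))) (1 / p')"
        unfolding Lp_norm_def using p'1 by (intro ennreal_powr_mono) auto
      also have "\<dots> = ennreal (K powr (1 / p') * bdist z powr - k)"
        using K(1) p'1 by (simp add: powr_mult powr_powr)
      finally show ?thesis .
    qed
    also have "ennreal (bdist z powr k) * (ennreal (K powr (1 / p') * bdist z powr - k) * Lp_norm p ball_vol f2)
        = ennreal (K powr (1 / p')) * Lp_norm p ball_vol f2"
    proof -
      have "bdist z powr k * (K powr (1 / p') * bdist z powr - k) = K powr (1 / p') * (bdist z powr k * bdist z powr - k)"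
        by simp
      also have "\<dots> = K powr (1 / p')" using dz by (simp only: powr_add[symmetric]) simp
      finally show ?thesis by (simp only: mult.assoc[symmetric] ennreal_mult[symmetric] powr_ge_zero mult_nonneg_nonneg)
    qed
    finally show ?thesis by (simp add: Lp_norm_def f2_def mult_right_mono mult_left_mono)
  qed
  then show ?thesis by (intro exI[of _ "ennreal (K powr (1 / p'))"]) auto
qed

text \<open>For fixed u the variables are exchanged by |1 - <z,u>| = |1 - <u,z>|, and Forelli-Rudin
  is applied in z with weight exponent q a + \<beta> and kernel exponent c q. The resulting power of
  1 - |u|^2, combined with b, is e.\<close>

lemma kernel_column_norm:
  assumes q: "0 < q" and \<beta>: "-1 < \<beta>" and s: "-1 < q * a + \<beta>" and t: "real CARD('n) + 1 + (q * a + \<beta>) < c * q"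
    and e: "e = (real CARD('n) + 1 + \<beta>) / q + a + b - c"
  shows "\<exists>C<top. \<forall>u::complex ^ 'n. norm u < 1 \<longrightarrow>
    Lp_norm q (ball_vol_wt \<beta>) (\<lambda>z. fr_kernel a b c z u) \<le> C * ennreal (bdist u powr e)"
proof -
  from Forelli_Rudin_upper[OF s t]
  obtain K where K: "0 \<le> K" "\<And>u :: complex ^ 'n. norm u < 1 \<Longrightarrow>
      (\<integral>\<^sup>+z. ennreal (bdist z powr (q * a + \<beta>) * cmod (1 - hinner u z) powr - (c * q)) \<partial>ball_vol)
      \<le> ennreal (K * bdist u powr (real CARD('n) + 1 + (q * a + \<beta>) - c * q))" by auto
  define w where "w = wt_const TYPE('n) \<beta>"
  have w: "w > 0" unfolding w_def using \<beta> by (rule wt_const_pos)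
  have "Lp_norm q (ball_vol_wt \<beta>) (\<lambda>z. fr_kernel a b c z u) \<le> ennreal ((w * K) powr (1 / q)) * ennreal (bdist u powr e)"
    if u: "norm u < 1" for u :: "complex ^ 'n"
  proof -
    have du: "0 < bdist u" using u by (rule one_minus_norm_square_pos)
    have "(\<integral>\<^sup>+z. ennreal_powr (fr_kernel a b c z u) q \<partial>ball_vol_wt \<beta>)
        = ennreal w * (\<integral>\<^sup>+z. ennreal (bdist z powr \<beta>) * ennreal_powr (fr_kernel a b c z u) q \<partial>ball_vol)"
      unfolding w_def by (intro nn_integral_ball_vol_wt \<beta>) measurable
    also have "(\<integral>\<^sup>+z. ennreal (bdist z powr \<beta>) * ennreal_powr (fr_kernel a b c z u) q \<partial>ball_vol)
        = (\<integral>\<^sup>+z. ennreal (bdist u powr (b * q)) *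
            ennreal (bdist z powr (q * a + \<beta>) * cmod (1 - hinner u z) powr - (c * q)) \<partial>ball_vol)"
    proof (intro nn_integral_cong)
      fix z :: "complex ^ 'n" assume z: "z \<in> space ball_vol"
      then have dz: "0 < bdist z" by (rule bdist_pos)
      have R: "cmod (1 - hinner z u) = cmod (1 - hinner u z)" by (rule cmod_one_minus_hinner_commute)
      show "ennreal (bdist z powr \<beta>) * ennreal_powr (fr_kernel a b c z u) q = ennreal (bdist u powr (b * q)) *
            ennreal (bdist z powr (q * a + \<beta>) * cmod (1 - hinner u z) powr - (c * q))"
        unfolding fr_kernel_def R using dz du
        by (simp add: powr_mult powr_powr powr_add ennreal_mult[symmetric] mult_ac)
    qed
    also have "\<dots> = ennreal (bdist u powr (b * q)) *
        (\<integral>\<^sup>+z. ennreal (bdist z powr (q * a + \<beta>) * cmod (1 - hinner u z) powr - (c * q)) \<partial>ball_vol)"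
      by (rule nn_integral_cmult) measurable
    also have "ennreal w * \<dots> \<le> ennreal w * (ennreal (bdist u powr (b * q)) *
        ennreal (K * bdist u powr (real CARD('n) + 1 + (q * a + \<beta>) - c * q)))"
      by (intro mult_left_mono K(2) u) auto
    also have "\<dots> = ennreal (w * K * (bdist u powr (b * q) * bdist u powr (real CARD('n) + 1 + (q * a + \<beta>) - c * q)))"
      using w K(1) by (simp add: ennreal_mult[symmetric] mult_ac)
    also have "bdist u powr (b * q) * bdist u powr (real CARD('n) + 1 + (q * a + \<beta>) - c * q) = bdist u powr (e * q)"
      unfolding powr_add[symmetric] e using q by (intro arg_cong[where f = "\<lambda>x. bdist u powr x"]) (simp add: field_simps)
    finally have "Lp_norm q (ball_vol_wt \<beta>) (\<lambda>z. fr_kernel a b c z u) \<le> ennreal_powr (ennreal (w * K * bdist u powr (e * q))) (1 / q)"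
      unfolding Lp_norm_def using q by (intro ennreal_powr_mono) auto
    also have "\<dots> = ennreal ((w * K) powr (1 / q)) * ennreal (bdist u powr e)"
      using w K(1) q by (simp add: powr_mult powr_powr ennreal_mult[symmetric])
    finally show ?thesis .
  qed
  then show ?thesis by (intro exI[of _ "ennreal ((w * K) powr (1 / q))"]) auto
qed

text \<open>The Schur test has two free parameters, the power \<open>y\<close> of \<open>1 - |u|\<^sup>2\<close> and the exponent \<open>c1\<close>
  moved to the first factor; the two strict inequalities say exactly that the intervals for \<open>y\<close>
  and for \<open>k\<close> (hence \<open>c1\<close>) are nonempty.\<close>

lemma pos_op_bounded_critical:
  assumes p: "1 < p" and pq: "p \<le> q" and \<alpha>: "-1 < \<alpha>" and \<beta>: "-1 < \<beta>"
    and 1: "- q * a < \<beta> + 1" and 2: "\<alpha> + 1 < p * (b + 1)"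
    and c: "c = real CARD('n) + 1 + a + b + (real CARD('n) + 1 + \<beta>) / q - (real CARD('n) + 1 + \<alpha>) / p"
  shows "\<exists>C<top. \<forall>g \<in> borel_measurable (ball_vol :: (complex ^ 'n) measure).
    Lp_norm q (ball_vol_wt \<beta>) (pos_op a b c g) \<le> C * Lp_norm p (ball_vol_wt \<alpha>) g"
proof -
  define p' where "p' = p / (p - 1)"
  have p': "0 < p'" "1 / p' = 1 - 1 / p" using p by (auto simp: p'_def field_simps)
  have q: "1 < q" using p pq by simp
  have "(\<alpha> + 1) / p < b + 1" using 2 p by (simp add: field_simps)
  then have "- (1 / p') < b - \<alpha> / p" by (simp add: p' add_divide_distrib)
  \<comment> \<open>The lower bound on y is integrability of the first Hoelder factor, -1 < y p';
    the upper bound is the inequality \<open>t\<close> that lets Forelli-Rudin act on the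
    columns.\<close>
  then obtain y where y: "- (1 / p') < y" "y < b - \<alpha> / p" using dense by blast
  have "0 < a + (\<beta> + 1) / q" using 1 q by (simp add: field_simps)
  \<comment> \<open>Positivity of k puts the Hoelder factor above the Forelli-Rudin threshold; the
    upper bound keeps the z-weight exponent q (a - k) + \<beta> above -1.\<close>
  then obtain k where k: "0 < k" "k < a + (\<beta> + 1) / q" using dense by blast
  define c1 where "c1 = (real CARD('n) + 1) / p' + y + k"
  have c2: "c - c1 = a + b + (real CARD('n) + 1 + \<beta>) / q - \<alpha> / p - y - k"
    unfolding c1_def c using p p' by (simp add: divide_inverse algebra_simps) (simp add: inverse_eq_divide p' algebra_simps)
  have yp: "-1 < y * p'" using y(1) p'(1) by (simp add: field_simps)
  obtain C1 where C1: "C1 < top" "\<And>g z. g \<in> borel_measurable (ball_vol :: (complex ^ 'n) measure) \<Longrightarrow> norm z < 1 \<Longrightarrow> pos_op a b c g z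
      \<le> C1 * ennreal_powr (\<integral>\<^sup>+u. ennreal_powr (fr_kernel (a - k) (b - y) (c - c1) z u * g u) p \<partial>ball_vol) (1 / p)"
    using pos_op_Holder[OF p p'_def yp k(1) c1_def, of a b c] by blast
  have s: "-1 < q * (a - k) + \<beta>" using k(2) q by (simp add: field_simps)
  have t: "real CARD('n) + 1 + (q * (a - k) + \<beta>) < (c - c1) * q"
  proof -
    have "(c - c1) * q = real CARD('n) + 1 + (q * (a - k) + \<beta>) + q * (b - \<alpha> / p - y)"
      unfolding c2 using q by (simp add: field_simps)
    moreover have "0 < q * (b - \<alpha> / p - y)" using q y(2) by simp
    ultimately show ?thesis by simp
  qed
  \<comment> \<open>This is where the critical value of c is used: the p-th power of the column
    bound is exactly the weight (1 - |u|^2)^\<alpha> of the source space.\<close>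
  have e: "\<alpha> / p = (real CARD('n) + 1 + \<beta>) / q + (a - k) + (b - y) - (c - c1)"
    unfolding c2 by simp
  obtain C2 where C2: "C2 < top" "\<And>u :: complex ^ 'n. norm u < 1 \<Longrightarrow>
      Lp_norm q (ball_vol_wt \<beta>) (\<lambda>z. fr_kernel (a - k) (b - y) (c - c1) z u) \<le> C2 * ennreal (bdist u powr (\<alpha> / p))"
    using kernel_column_norm[OF _ \<beta> s t e] q by auto
  define w where "w = wt_const TYPE('n) \<alpha>"
  have w: "w > 0" unfolding w_def using \<alpha> by (rule wt_const_pos)
  have "Lp_norm q (ball_vol_wt \<beta>) (pos_op a b c g)
      \<le> (C1 * (C2 * ennreal ((1 / w) powr (1 / p)))) * Lp_norm p (ball_vol_wt \<alpha>) g"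
    if [measurable]: "g \<in> borel_measurable ball_vol" for g :: "complex ^ 'n \<Rightarrow> ennreal"
  proof -
    define F where "F z u = ennreal_powr (fr_kernel (a - k) (b - y) (c - c1) z u * g u) p" for z u
    have F_meas [measurable]: "(\<lambda>(z, u). F z u) \<in> borel_measurable (ball_vol_wt \<beta> \<Otimes>\<^sub>M ball_vol)"
      unfolding F_def by measurable
    have "Lp_norm q (ball_vol_wt \<beta>) (pos_op a b c g)
        \<le> Lp_norm q (ball_vol_wt \<beta>) (\<lambda>z. C1 * ennreal_powr (\<integral>\<^sup>+u. F z u \<partial>ball_vol) (1 / p))"
      unfolding F_def using q by (intro Lp_norm_mono C1) auto
    also have "\<dots> = C1 * Lp_norm q (ball_vol_wt \<beta>) (\<lambda>z. ennreal_powr (\<integral>\<^sup>+u. F z u \<partial>ball_vol) (1 / p))"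
      using q by (intro Lp_norm_cmult) auto
    also have "Lp_norm q (ball_vol_wt \<beta>) (\<lambda>z. ennreal_powr (\<integral>\<^sup>+u. F z u \<partial>ball_vol) (1 / p))
        = ennreal_powr (Lp_norm (q / p) (ball_vol_wt \<beta>) (\<lambda>z. \<integral>\<^sup>+u. F z u \<partial>ball_vol)) (1 / p)"
      using p q by (subst Lp_norm_powr) auto
    \<comment> \<open>Minkowski with exponent q/p, which is at least 1 because p <= q.\<close>
    also have "\<dots> \<le> ennreal_powr (\<integral>\<^sup>+u. Lp_norm (q / p) (ball_vol_wt \<beta>) (\<lambda>z. F z u) \<partial>ball_vol) (1 / p)"
      using p pq by (intro ennreal_powr_mono Minkowski_integral finite_measure_ball_vol_wt \<beta> F_meas)
        (auto intro: ball_vol.sigma_finite_measure_axioms)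
    also have "\<dots> \<le> ennreal_powr (\<integral>\<^sup>+u. ennreal_powr C2 p * (ennreal (bdist u powr \<alpha>) * ennreal_powr (g u) p) \<partial>ball_vol) (1 / p)"
    proof (intro ennreal_powr_mono nn_integral_mono)
      fix u :: "complex ^ 'n" assume u: "u \<in> space ball_vol"
      have "Lp_norm (q / p) (ball_vol_wt \<beta>) (\<lambda>z. F z u)
          = ennreal_powr (Lp_norm q (ball_vol_wt \<beta>) (\<lambda>z. fr_kernel (a - k) (b - y) (c - c1) z u * g u)) p"
        unfolding F_def using p q by (subst Lp_norm_powr) auto
      also have "\<dots> = ennreal_powr (Lp_norm q (ball_vol_wt \<beta>) (\<lambda>z. fr_kernel (a - k) (b - y) (c - c1) z u) * g u) p"
        using q by (subst Lp_norm_multc) auto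
      also have "\<dots> \<le> ennreal_powr (C2 * ennreal (bdist u powr (\<alpha> / p)) * g u) p"
        using u p C2(2)[of u] by (intro ennreal_powr_mono mult_right_mono) auto
      also have "\<dots> = ennreal_powr C2 p * (ennreal (bdist u powr \<alpha>) * ennreal_powr (g u) p)"
        using p by (simp add: ennreal_powr_mult powr_powr mult.assoc)
      finally show "Lp_norm (q / p) (ball_vol_wt \<beta>) (\<lambda>z. F z u) \<le> \<dots>" .
    qed (use p in auto)
    also have "(\<integral>\<^sup>+u. ennreal_powr C2 p * (ennreal (bdist u powr \<alpha>) * ennreal_powr (g u) p) \<partial>ball_vol)
        = ennreal_powr C2 p * (\<integral>\<^sup>+u. ennreal (bdist u powr \<alpha>) * ennreal_powr (g u) p \<partial>ball_vol)"
      by (rule nn_integral_cmult) measurable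
    also have "(\<integral>\<^sup>+u. ennreal (bdist u powr \<alpha>) * ennreal_powr (g u) p \<partial>ball_vol)
        = ennreal (1 / w) * (\<integral>\<^sup>+u. ennreal_powr (g u) p \<partial>ball_vol_wt \<alpha>)"
    proof -
      have "(\<integral>\<^sup>+u. ennreal_powr (g u) p \<partial>ball_vol_wt \<alpha>)
          = ennreal w * (\<integral>\<^sup>+u. ennreal (bdist u powr \<alpha>) * ennreal_powr (g u) p \<partial>ball_vol)"
        unfolding w_def by (rule nn_integral_ball_vol_wt[OF \<alpha>]) measurable
      then have "ennreal (1 / w) * (\<integral>\<^sup>+u. ennreal_powr (g u) p \<partial>ball_vol_wt \<alpha>)
          = ennreal (1 / w) * ennreal w * (\<integral>\<^sup>+u. ennreal (bdist u powr \<alpha>) * ennreal_powr (g u) p \<partial>ball_vol)"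
        by (simp add: mult.assoc)
      also have "ennreal (1 / w) * ennreal w = 1" using w by (simp flip: ennreal_mult)
      finally show ?thesis by simp
    qed
    also have "ennreal_powr (ennreal_powr C2 p * (ennreal (1 / w) * (\<integral>\<^sup>+u. ennreal_powr (g u) p \<partial>ball_vol_wt \<alpha>))) (1 / p)
        = (C2 * ennreal ((1 / w) powr (1 / p))) * Lp_norm p (ball_vol_wt \<alpha>) g"
      using p w by (simp add: ennreal_powr_mult ennreal_powr_powr Lp_norm_def mult.assoc)
    finally show ?thesis by (simp add: mult.assoc mult_left_mono)
  qed
  moreover have "C1 * (C2 * ennreal ((1 / w) powr (1 / p))) < top"
    using C1 C2 by (simp add: ennreal_mult_less_top)
  ultimately show ?thesis by blast
qed

text \<open>Since |1 - <z,u>| < 2 on the ball, lowering the exponent from c' to c costs at most the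
  factor 2^(c'-c).\<close>

lemma kernel_mono_exponent:
  assumes "c \<le> c'" "norm z < 1" "norm u < 1"
  shows "fr_kernel a b c z u \<le> ennreal (2 powr (c' - c)) * fr_kernel a b c' z u"
proof -
  have "cmod (1 - hinner z u) powr - c = cmod (1 - hinner z u) powr - c' * cmod (1 - hinner z u) powr (c' - c)"
    by (simp add: powr_add[symmetric])
  also have "\<dots> \<le> cmod (1 - hinner z u) powr - c' * 2 powr (c' - c)"
    using assms cmod_one_minus_hinner_less[of z u] by (intro mult_left_mono powr_mono2) auto
  finally have "bdist z powr a * bdist u powr b * cmod (1 - hinner z u) powr - c
      \<le> bdist z powr a * bdist u powr b * (cmod (1 - hinner z u) powr - c' * 2 powr (c' - c))"
    by (intro mult_left_mono) auto
  then show ?thesis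
    unfolding fr_kernel_def by (simp add: ennreal_mult[symmetric] ennreal_leI mult_ac)
qed

text \<open>Any c below the critical value reduces to that value by domination of the
  kernels.\<close>

lemma pos_op_bounded:
  assumes p: "1 < p" and pq: "p \<le> q" and \<alpha>: "-1 < \<alpha>" and \<beta>: "-1 < \<beta>"
    and 1: "- q * a < \<beta> + 1" and 2: "\<alpha> + 1 < p * (b + 1)"
    and c: "c \<le> real CARD('n) + 1 + a + b + (real CARD('n) + 1 + \<beta>) / q - (real CARD('n) + 1 + \<alpha>) / p"
  shows "\<exists>C<top. \<forall>g \<in> borel_measurable (ball_vol :: (complex ^ 'n) measure).
    Lp_norm q (ball_vol_wt \<beta>) (pos_op a b c g) \<le> C * Lp_norm p (ball_vol_wt \<alpha>) g"
proof -
  define c' where "c' = real CARD('n) + 1 + a + b + (real CARD('n) + 1 + \<beta>) / q - (real CARD('n) + 1 + \<alpha>) / p"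
  obtain C where C: "C < top" "\<And>g. g \<in> borel_measurable (ball_vol :: (complex ^ 'n) measure) \<Longrightarrow>
      Lp_norm q (ball_vol_wt \<beta>) (pos_op a b c' g) \<le> C * Lp_norm p (ball_vol_wt \<alpha>) g"
    using pos_op_bounded_critical[OF p pq \<alpha> \<beta> 1 2 c'_def] by blast
  have "Lp_norm q (ball_vol_wt \<beta>) (pos_op a b c g) \<le> (ennreal (2 powr (c' - c)) * C) * Lp_norm p (ball_vol_wt \<alpha>) g"
    if [measurable]: "g \<in> borel_measurable ball_vol" for g :: "complex ^ 'n \<Rightarrow> ennreal"
  proof -
    have "Lp_norm q (ball_vol_wt \<beta>) (pos_op a b c g)
        \<le> Lp_norm q (ball_vol_wt \<beta>) (\<lambda>z. ennreal (2 powr (c' - c)) * pos_op a b c' g z)"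
    proof (rule Lp_norm_mono)
      fix z :: "complex ^ 'n" assume z: "z \<in> space (ball_vol_wt \<beta>)"
      have "pos_op a b c g z \<le> (\<integral>\<^sup>+u. ennreal (2 powr (c' - c)) * (fr_kernel a b c' z u * g u) \<partial>ball_vol)"
        unfolding pos_op_def mult.assoc[symmetric]
        using c z by (intro nn_integral_mono mult_right_mono kernel_mono_exponent) (auto simp: c'_def)
      then show "pos_op a b c g z \<le> ennreal (2 powr (c' - c)) * pos_op a b c' g z"
        by (simp add: pos_op_def nn_integral_cmult)
    qed (use p pq in auto)
    also have "\<dots> = ennreal (2 powr (c' - c)) * Lp_norm q (ball_vol_wt \<beta>) (pos_op a b c' g)"
      using p pq by (intro Lp_norm_cmult) auto
    also have "\<dots> \<le> ennreal (2 powr (c' - c)) * (C * Lp_norm p (ball_vol_wt \<alpha>) g)"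
      using that by (intro mult_left_mono C) auto
    finally show ?thesis by (simp add: mult.assoc)
  qed
  moreover have "ennreal (2 powr (c' - c)) * C < top" using C by (simp add: ennreal_mult_less_top)
  ultimately show ?thesis by blast
qed

section \<open>Two variables: sufficiency\<close>

lemma mixed_norm_eq_Lp_norm:
  assumes "p $ 1 > 0" "p $ 2 > 0"
  shows "mixed_norm p \<alpha> f = Lp_norm (p $ 2) (ball_vol_wt (\<alpha> $ 2))
    (\<lambda>w. Lp_norm (p $ 1) (ball_vol_wt (\<alpha> $ 1)) (\<lambda>z. ennreal (cmod (f (z, w)))))"
  using assms by (simp add: mixed_norm_def Lp_norm_def ennreal_powr_powr)

lemma measurable_pair_first:
  assumes "f \<in> measurable (ball_vol \<Otimes>\<^sub>M ball_vol) N" "w \<in> ball 0 1"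
  shows "(\<lambda>z. f (z, w)) \<in> measurable ball_vol N"
  using assms by (auto intro: measurable_Pair1')

lemma measurable_Lp_norm [measurable]:
  assumes [measurable]: "(\<lambda>(x, y). F x y) \<in> borel_measurable (N \<Otimes>\<^sub>M M)" and "sigma_finite_measure M"
  shows "(\<lambda>x. Lp_norm p M (F x)) \<in> borel_measurable N"
proof -
  interpret sigma_finite_measure M by fact
  show ?thesis unfolding Lp_norm_def by measurable
qed

text \<open>The density is strictly positive on the ball, so the null sets coincide. This transfers
  finiteness of a weighted norm to a statement almost everywhere for volume.\<close>

lemma AE_ball_vol_wt:
  assumes "\<theta> > -1"
  shows "(AE z in ball_vol_wt \<theta>. P z) \<longleftrightarrow> (AE z in (ball_vol :: (complex ^ 'n) measure). P z)"
proof -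
  have "(AE z in (ball_vol_wt \<theta> :: (complex ^ 'n) measure). P z)
    \<longleftrightarrow> (AE z in ball_vol. 0 < ennreal (wt_const TYPE('n) \<theta> * bdist z powr \<theta>) \<longrightarrow> P z)"
    unfolding ball_vol_wt_def wt_const_def by (rule AE_density) measurable
  also have "\<dots> \<longleftrightarrow> (AE z in ball_vol. P z)"
  proof (rule AE_cong)
    fix z :: "complex ^ 'n" assume z: "z \<in> space ball_vol"
    have "0 < wt_const TYPE('n) \<theta> * bdist z powr \<theta>"
      using wt_const_pos[OF assms, where 'n='n] bdist_pos[OF z] by (intro mult_pos_pos) auto
    then show "(0 < ennreal (wt_const TYPE('n) \<theta> * bdist z powr \<theta>) \<longrightarrow> P z) = P z" by simp
  qed
  finally show ?thesis .
qed

definition pos_op2 :: "real ^ 2 \<Rightarrow> real ^ 2 \<Rightarrow> real ^ 2 \<Rightarrow> (complex ^ 'n \<Rightarrow> complex ^ 'n \<Rightarrow> ennreal)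
    \<Rightarrow> complex ^ 'n \<Rightarrow> complex ^ 'n \<Rightarrow> ennreal" where
  "pos_op2 a b c F z w = (\<integral>\<^sup>+x. fr_kernel (a $ 1) (b $ 1) (c $ 1) z (fst x)
     * fr_kernel (a $ 2) (b $ 2) (c $ 2) w (snd x) * F (fst x) (snd x) \<partial>(ball_vol \<Otimes>\<^sub>M ball_vol))"

interpretation ball_vol2: pair_sigma_finite "ball_vol :: (complex ^ 'n) measure" "ball_vol :: (complex ^ 'n) measure"
  by standard

lemma sigma_finite_ball_vol2:
  "sigma_finite_measure (ball_vol \<Otimes>\<^sub>M ball_vol :: ((complex ^ 'n) \<times> (complex ^ 'n)) measure)"
  by (rule sigma_finite_pair_measure) standard

lemma measurable_pos_op2:
  fixes F :: "complex ^ 'n \<Rightarrow> complex ^ 'n \<Rightarrow> ennreal"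
  assumes [measurable]: "(\<lambda>(u, \<eta>). F u \<eta>) \<in> borel_measurable (ball_vol \<Otimes>\<^sub>M ball_vol)"
  shows "(\<lambda>(z, w). pos_op2 a b c F z w) \<in> borel_measurable (ball_vol \<Otimes>\<^sub>M ball_vol)"
proof -
  interpret sigma_finite_measure "ball_vol \<Otimes>\<^sub>M ball_vol :: ((complex ^ 'n) \<times> (complex ^ 'n)) measure"
    by (rule sigma_finite_ball_vol2)
  show ?thesis unfolding pos_op2_def by measurable
qed

lemma pos_op2_iterated:
  fixes F :: "complex ^ 'n \<Rightarrow> complex ^ 'n \<Rightarrow> ennreal"
  assumes [measurable]: "(\<lambda>(u, \<eta>). F u \<eta>) \<in> borel_measurable (ball_vol \<Otimes>\<^sub>M ball_vol)"
  shows "pos_op2 a b c F z w = (\<integral>\<^sup>+\<eta>. fr_kernel (a $ 2) (b $ 2) (c $ 2) w \<eta>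
    * pos_op (a $ 1) (b $ 1) (c $ 1) (\<lambda>u. F u \<eta>) z \<partial>ball_vol)"
proof -
  have "pos_op2 a b c F z w = (\<integral>\<^sup>+\<eta>. (\<integral>\<^sup>+u. fr_kernel (a $ 1) (b $ 1) (c $ 1) z u
     * fr_kernel (a $ 2) (b $ 2) (c $ 2) w \<eta> * F u \<eta> \<partial>ball_vol) \<partial>ball_vol)"
    unfolding pos_op2_def by (subst ball_vol2.nn_integral_snd[symmetric]) auto
  also have "\<dots> = (\<integral>\<^sup>+\<eta>. fr_kernel (a $ 2) (b $ 2) (c $ 2) w \<eta>
    * pos_op (a $ 1) (b $ 1) (c $ 1) (\<lambda>u. F u \<eta>) z \<partial>ball_vol)"
    unfolding pos_op_def
    by (intro nn_integral_cong, subst nn_integral_cmult[symmetric]) (measurable, simp add: mult_ac)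
  finally show ?thesis .
qed

text \<open>Minkowski moves the L^q1 norm in z inside the integral over \<eta>, where the first
  one-variable bound applies to every slice of F. What remains is the second operator acting on
  \<open>F1\<close>, the L^p1 norm of the slices, so the second bound finishes. The order of the
  variables in the mixed norm is exactly the one this needs.\<close>

lemma pos_op2_bounded:
  fixes a b c p q \<alpha> \<beta> :: "real ^ 2"
  assumes p: "1 < p $ 1" "1 < p $ 2" and q: "1 < q $ 1" "1 < q $ 2" and \<beta>: "-1 < \<beta> $ 1"
    and \<alpha>: "-1 < \<alpha> $ 1"
    and C1: "\<And>g. g \<in> borel_measurable (ball_vol :: (complex ^ 'n) measure) \<Longrightarrow>
      Lp_norm (q $ 1) (ball_vol_wt (\<beta> $ 1)) (pos_op (a $ 1) (b $ 1) (c $ 1) g) \<le> C1 * Lp_norm (p $ 1) (ball_vol_wt (\<alpha> $ 1)) g"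
    and C2: "\<And>g. g \<in> borel_measurable (ball_vol :: (complex ^ 'n) measure) \<Longrightarrow>
      Lp_norm (q $ 2) (ball_vol_wt (\<beta> $ 2)) (pos_op (a $ 2) (b $ 2) (c $ 2) g) \<le> C2 * Lp_norm (p $ 2) (ball_vol_wt (\<alpha> $ 2)) g"
    and F [measurable]: "(\<lambda>(u, \<eta>). F u \<eta>) \<in> borel_measurable (ball_vol \<Otimes>\<^sub>M ball_vol)"
  shows "Lp_norm (q $ 2) (ball_vol_wt (\<beta> $ 2)) (\<lambda>w. Lp_norm (q $ 1) (ball_vol_wt (\<beta> $ 1)) (\<lambda>z::complex ^ 'n. pos_op2 a b c F z w))
    \<le> C1 * C2 * Lp_norm (p $ 2) (ball_vol_wt (\<alpha> $ 2)) (\<lambda>w. Lp_norm (p $ 1) (ball_vol_wt (\<alpha> $ 1)) (\<lambda>z. F z w))"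
proof -
  define G where "G \<eta> z = pos_op (a $ 1) (b $ 1) (c $ 1) (\<lambda>u. F u \<eta>) z" for \<eta> z
  have G [measurable]: "(\<lambda>(\<eta>, z). G \<eta> z) \<in> borel_measurable (ball_vol \<Otimes>\<^sub>M ball_vol)"
    unfolding G_def pos_op_def by measurable
  define F1 where "F1 \<eta> = Lp_norm (p $ 1) (ball_vol_wt (\<alpha> $ 1)) (\<lambda>z. F z \<eta>)" for \<eta>
  have sf\<alpha>: "sigma_finite_measure (ball_vol_wt (\<alpha> $ 1) :: (complex ^ 'n) measure)"
    by (intro finite_measure.axioms(1) finite_measure_ball_vol_wt \<alpha>)
  have F1 [measurable]: "F1 \<in> borel_measurable ball_vol"
    unfolding F1_def by (rule measurable_Lp_norm[OF _ sf\<alpha>]) measurable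
  have "Lp_norm (q $ 1) (ball_vol_wt (\<beta> $ 1)) (\<lambda>z. pos_op2 a b c F z w)
      \<le> C1 * pos_op (a $ 2) (b $ 2) (c $ 2) F1 w" for w
  proof -
    have "Lp_norm (q $ 1) (ball_vol_wt (\<beta> $ 1)) (\<lambda>z. pos_op2 a b c F z w)
        = Lp_norm (q $ 1) (ball_vol_wt (\<beta> $ 1)) (\<lambda>z. \<integral>\<^sup>+\<eta>. fr_kernel (a $ 2) (b $ 2) (c $ 2) w \<eta> * G \<eta> z \<partial>ball_vol)"
      unfolding G_def by (simp add: pos_op2_iterated)
    also have "\<dots> \<le> (\<integral>\<^sup>+\<eta>. Lp_norm (q $ 1) (ball_vol_wt (\<beta> $ 1)) (\<lambda>z. fr_kernel (a $ 2) (b $ 2) (c $ 2) w \<eta> * G \<eta> z) \<partial>ball_vol)"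
    proof (rule Minkowski_integral)
      show "(\<lambda>(z, \<eta>). fr_kernel (a $ 2) (b $ 2) (c $ 2) w \<eta> * G \<eta> z)
          \<in> borel_measurable (ball_vol_wt (\<beta> $ 1) \<Otimes>\<^sub>M ball_vol)"
        unfolding G_def pos_op_def by measurable
    qed (use q \<beta> in \<open>auto intro: finite_measure_ball_vol_wt ball_vol.sigma_finite_measure_axioms\<close>)
    also have "\<dots> \<le> (\<integral>\<^sup>+\<eta>. C1 * (fr_kernel (a $ 2) (b $ 2) (c $ 2) w \<eta> * F1 \<eta>) \<partial>ball_vol)"
    proof (intro nn_integral_mono)
      fix \<eta> :: "complex ^ 'n" assume \<eta>: "\<eta> \<in> space ball_vol"
      have [measurable]: "(\<lambda>u. F u \<eta>) \<in> borel_measurable ball_vol"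
        using measurable_pair_first[OF F] \<eta> by simp
      have "Lp_norm (q $ 1) (ball_vol_wt (\<beta> $ 1)) (\<lambda>z. fr_kernel (a $ 2) (b $ 2) (c $ 2) w \<eta> * G \<eta> z)
          = fr_kernel (a $ 2) (b $ 2) (c $ 2) w \<eta> * Lp_norm (q $ 1) (ball_vol_wt (\<beta> $ 1)) (G \<eta>)"
        using q unfolding G_def by (intro Lp_norm_cmult) auto
      also have "\<dots> \<le> fr_kernel (a $ 2) (b $ 2) (c $ 2) w \<eta> * (C1 * F1 \<eta>)"
        unfolding G_def F1_def by (intro mult_left_mono C1) auto
      finally show "Lp_norm (q $ 1) (ball_vol_wt (\<beta> $ 1)) (\<lambda>z. fr_kernel (a $ 2) (b $ 2) (c $ 2) w \<eta> * G \<eta> z)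
          \<le> C1 * (fr_kernel (a $ 2) (b $ 2) (c $ 2) w \<eta> * F1 \<eta>)" by (simp add: mult_ac)
    qed
    also have "\<dots> = C1 * pos_op (a $ 2) (b $ 2) (c $ 2) F1 w"
      unfolding pos_op_def by (rule nn_integral_cmult) measurable
    finally show ?thesis .
  qed
  then have "Lp_norm (q $ 2) (ball_vol_wt (\<beta> $ 2)) (\<lambda>w. Lp_norm (q $ 1) (ball_vol_wt (\<beta> $ 1)) (\<lambda>z. pos_op2 a b c F z w))
      \<le> Lp_norm (q $ 2) (ball_vol_wt (\<beta> $ 2)) (\<lambda>w. C1 * pos_op (a $ 2) (b $ 2) (c $ 2) F1 w)"
    using q by (intro Lp_norm_mono) auto
  also have "\<dots> = C1 * Lp_norm (q $ 2) (ball_vol_wt (\<beta> $ 2)) (pos_op (a $ 2) (b $ 2) (c $ 2) F1)"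
    using q by (intro Lp_norm_cmult) auto
  also have "\<dots> \<le> C1 * (C2 * Lp_norm (p $ 2) (ball_vol_wt (\<alpha> $ 2)) F1)"
    by (intro mult_left_mono C2) auto
  finally show ?thesis by (simp add: F1_def[abs_def] mult.assoc)
qed

text \<open>The kernels \<open>\<kappa>\<close> of \<open>S\<close> and \<open>T\<close> have the same modulus. When both \<open>1 - \<langle>z, u\<rangle>\<close> and
  \<open>1 - \<langle>w, \<eta>\<rangle>\<close> are relatively close to positive real numbers, the real part of \<open>\<kappa>\<close> is at least
  half of that modulus.\<close>

locale mixed_operator =
  fixes \<kappa> :: "complex ^ 'n \<Rightarrow> complex ^ 'n \<Rightarrow> complex ^ 'n \<Rightarrow> complex ^ 'n \<Rightarrow> complex"
    and a b c :: "real ^ 2"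
    and I :: "((complex ^ 'n) \<times> (complex ^ 'n) \<Rightarrow> complex)
      \<Rightarrow> (complex ^ 'n) \<times> (complex ^ 'n) \<Rightarrow> (complex ^ 'n) \<times> (complex ^ 'n) \<Rightarrow> complex"
    and A :: "((complex ^ 'n) \<times> (complex ^ 'n) \<Rightarrow> complex) \<Rightarrow> (complex ^ 'n) \<times> (complex ^ 'n) \<Rightarrow> complex"
  assumes I_eq: "I f (z, w) (u, \<eta>)
      = of_real (bdist u powr (b $ 1) * bdist \<eta> powr (b $ 2)) * \<kappa> z w u \<eta> * f (u, \<eta>)"
    and A_eq: "A f (z, w) = of_real (bdist z powr (a $ 1) * bdist w powr (a $ 2))
      * (\<integral>x. I f (z, w) x \<partial>(ball_vol \<Otimes>\<^sub>M ball_vol))"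
    and norm_\<kappa>: "\<lbrakk>norm z < 1; norm w < 1; norm u < 1; norm \<eta> < 1\<rbrakk> \<Longrightarrow>
      cmod (\<kappa> z w u \<eta>) = cmod (1 - hinner z u) powr - (c $ 1) * cmod (1 - hinner w \<eta>) powr - (c $ 2)"
    and phase_\<kappa>: "\<exists>\<epsilon>>0. \<epsilon> \<le> 1 / 2 \<and> (\<forall>z w u \<eta> x y. norm z < 1 \<longrightarrow> norm w < 1 \<longrightarrow> norm u < 1 \<longrightarrow> norm \<eta> < 1 \<longrightarrow>
      0 < x \<longrightarrow> 0 < y \<longrightarrow> cmod (1 - hinner z u - of_real x) \<le> \<epsilon> * x \<longrightarrow>
      cmod (1 - hinner w \<eta> - of_real y) \<le> \<epsilon> * y \<longrightarrow> cmod (\<kappa> z w u \<eta>) \<le> 2 * Re (\<kappa> z w u \<eta>))"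
    and measurable_\<kappa>: "(\<lambda>x. \<kappa> (fst (fst x)) (snd (fst x)) (fst (snd x)) (snd (snd x)))
      \<in> borel_measurable ((ball_vol \<Otimes>\<^sub>M ball_vol) \<Otimes>\<^sub>M (ball_vol \<Otimes>\<^sub>M ball_vol))"
begin

lemma measurable_I:
  assumes [measurable]: "f \<in> borel_measurable (ball_vol \<Otimes>\<^sub>M ball_vol)"
  shows "(\<lambda>(x, y). I f x y) \<in> borel_measurable ((ball_vol \<Otimes>\<^sub>M ball_vol) \<Otimes>\<^sub>M (ball_vol \<Otimes>\<^sub>M ball_vol))"
proof -
  note measurable_\<kappa> [measurable]
  have "(\<lambda>(x, y). I f x y) = (\<lambda>x. of_real (bdist (fst (snd x)) powr (b $ 1) * bdist (snd (snd x)) powr (b $ 2))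
      * \<kappa> (fst (fst x)) (snd (fst x)) (fst (snd x)) (snd (snd x)) * f (snd x))"
    by (auto simp: fun_eq_iff I_eq)
  then show ?thesis by simp
qed

lemma norm_I:
  assumes "norm z < 1" "norm w < 1" "x \<in> space (ball_vol \<Otimes>\<^sub>M ball_vol)"
  shows "ennreal (bdist z powr (a $ 1) * bdist w powr (a $ 2)) * ennreal (cmod (I f (z, w) x))
    = fr_kernel (a $ 1) (b $ 1) (c $ 1) z (fst x) * fr_kernel (a $ 2) (b $ 2) (c $ 2) w (snd x) * ennreal (cmod (f x))"
proof -
  obtain u \<eta> where x: "x = (u, \<eta>)" "norm u < 1" "norm \<eta> < 1"
    using assms(3) by (cases x) (auto simp: space_pair_measure)
  show ?thesis
    using norm_\<kappa>[OF assms(1,2) x(2,3)]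
    by (simp add: x(1) I_eq fr_kernel_def norm_mult ennreal_mult[symmetric] mult_ac)
qed

lemma nn_integral_norm_I:
  assumes z: "norm z < 1" and w: "norm w < 1" and [measurable]: "f \<in> borel_measurable (ball_vol \<Otimes>\<^sub>M ball_vol)"
  shows "ennreal (bdist z powr (a $ 1) * bdist w powr (a $ 2))
      * (\<integral>\<^sup>+x. ennreal (cmod (I f (z, w) x)) \<partial>(ball_vol \<Otimes>\<^sub>M ball_vol))
    = pos_op2 a b c (\<lambda>u \<eta>. ennreal (cmod (f (u, \<eta>)))) z w"
proof -
  have zw: "(z, w) \<in> space (ball_vol \<Otimes>\<^sub>M ball_vol)" using z w by (simp add: space_pair_measure)
  have [measurable]: "I f (z, w) \<in> borel_measurable (ball_vol \<Otimes>\<^sub>M ball_vol)"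
    using measurable_Pair2[OF measurable_I[OF assms(3)] zw] by simp
  have "ennreal (bdist z powr (a $ 1) * bdist w powr (a $ 2))
      * (\<integral>\<^sup>+x. ennreal (cmod (I f (z, w) x)) \<partial>(ball_vol \<Otimes>\<^sub>M ball_vol))
     = (\<integral>\<^sup>+x. ennreal (bdist z powr (a $ 1) * bdist w powr (a $ 2)) * ennreal (cmod (I f (z, w) x)) \<partial>(ball_vol \<Otimes>\<^sub>M ball_vol))"
    by (rule nn_integral_cmult[symmetric]) measurable
  also have "\<dots> = pos_op2 a b c (\<lambda>u \<eta>. ennreal (cmod (f (u, \<eta>)))) z w"
    unfolding pos_op2_def by (intro nn_integral_cong) (simp add: norm_I[OF z w])
  finally show ?thesis .
qed

lemma norm_A_le:
  assumes z: "norm z < 1" and w: "norm w < 1" and f: "f \<in> borel_measurable (ball_vol \<Otimes>\<^sub>M ball_vol)"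
  shows "ennreal (cmod (A f (z, w))) \<le> pos_op2 a b c (\<lambda>u \<eta>. ennreal (cmod (f (u, \<eta>)))) z w"
proof -
  have "ennreal (cmod (\<integral>x. I f (z, w) x \<partial>(ball_vol \<Otimes>\<^sub>M ball_vol)))
      \<le> (\<integral>\<^sup>+x. ennreal (cmod (I f (z, w) x)) \<partial>(ball_vol \<Otimes>\<^sub>M ball_vol))"
    \<comment> \<open>If the integral does not exist, the Bochner integral is 0 and the bound is
      trivial.\<close>
    by (cases "integrable (ball_vol \<Otimes>\<^sub>M ball_vol) (I f (z, w))")
      (auto intro: integral_norm_bound_ennreal simp: not_integrable_integral_eq)
  then show ?thesis
    unfolding nn_integral_norm_I[OF assms, symmetric] A_eq
    by (simp add: norm_mult ennreal_mult mult_left_mono)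
qed

lemma measurable_A:
  assumes [measurable]: "f \<in> borel_measurable (ball_vol \<Otimes>\<^sub>M ball_vol)"
  shows "A f \<in> borel_measurable (ball_vol \<Otimes>\<^sub>M ball_vol)"
proof -
  interpret sigma_finite_measure "ball_vol \<Otimes>\<^sub>M ball_vol :: ((complex ^ 'n) \<times> (complex ^ 'n)) measure"
    by (rule sigma_finite_ball_vol2)
  note measurable_I[OF assms, measurable]
  have "A f = (\<lambda>x. of_real (bdist (fst x) powr (a $ 1) * bdist (snd x) powr (a $ 2))
      * (\<integral>y. I f x y \<partial>(ball_vol \<Otimes>\<^sub>M ball_vol)))"
    by (auto simp: fun_eq_iff A_eq)
  then show ?thesis by simp
qed

text \<open>\<open>N\<close>, the positive operator applied to |f|, dominates the modulus of A f, so
  the norm bound comes from \<open>pos_op2_bounded\<close>. The same finite norm shows that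
  \<open>N\<close> is finite almost everywhere, which is integrability of the defining
  integrand.\<close>

lemma sufficiency:
  fixes p q \<alpha> \<beta> :: "real ^ 2"
  assumes \<alpha>: "\<forall>i. \<alpha> $ i > -1" and \<beta>: "\<forall>i. \<beta> $ i > -1"
    and p: "\<forall>i. 1 < p $ i" and pq: "\<forall>i. p $ i \<le> q $ i"
    and iii: "\<forall>i. - (q $ i) * a $ i < \<beta> $ i + 1
           \<and> \<alpha> $ i + 1 < p $ i * (b $ i + 1)
           \<and> c $ i \<le> real CARD('n) + 1 + a $ i + b $ i
               + (real CARD('n) + 1 + \<beta> $ i) / q $ i - (real CARD('n) + 1 + \<alpha> $ i) / p $ i"
  shows "bounded_mixed_Lp I A p \<alpha> q \<beta>"
proof -
  have "\<exists>C<top. \<forall>g \<in> borel_measurable (ball_vol :: (complex ^ 'n) measure).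
    Lp_norm (q $ i) (ball_vol_wt (\<beta> $ i)) (pos_op (a $ i) (b $ i) (c $ i) g) \<le> C * Lp_norm (p $ i) (ball_vol_wt (\<alpha> $ i)) g" for i
    using assms by (intro pos_op_bounded) auto
  then obtain C where C: "\<And>i. C i < top" "\<And>i g. g \<in> borel_measurable (ball_vol :: (complex ^ 'n) measure) \<Longrightarrow>
    Lp_norm (q $ i) (ball_vol_wt (\<beta> $ i)) (pos_op (a $ i) (b $ i) (c $ i) g) \<le> C i * Lp_norm (p $ i) (ball_vol_wt (\<alpha> $ i)) g"
    by metis
  have q: "\<forall>i. 1 < q $ i" using p pq by (meson less_le_trans)
  have p0: "p $ 1 > 0" "p $ 2 > 0" and q0: "q $ 1 > 0" "q $ 2 > 0" using p q by (meson less_trans zero_less_one)+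
  have sf\<beta>: "sigma_finite_measure (ball_vol_wt (\<beta> $ i) :: (complex ^ 'n) measure)" for i
    using \<beta> by (intro finite_measure.axioms(1) finite_measure_ball_vol_wt) auto
  have Cfin: "C 1 * C 2 < top" using C(1) by (simp add: ennreal_mult_less_top)
  show ?thesis unfolding bounded_mixed_Lp_def
  proof (intro exI[of _ "enn2real (C 1 * C 2)"] ballI conjI)
    fix f :: "(complex ^ 'n) \<times> (complex ^ 'n) \<Rightarrow> complex" assume f: "f \<in> mixed_Lp p \<alpha>"
    then have [measurable]: "f \<in> borel_measurable (ball_vol \<Otimes>\<^sub>M ball_vol)" and fin: "mixed_norm p \<alpha> f < \<infinity>"
      by (auto simp: mixed_Lp_def)
    define N where "N z w = pos_op2 a b c (\<lambda>u \<eta>. ennreal (cmod (f (u, \<eta>)))) z w" for z w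
    have N [measurable]: "(\<lambda>(z, w). N z w) \<in> borel_measurable (ball_vol \<Otimes>\<^sub>M ball_vol)"
      unfolding N_def by (intro measurable_pos_op2) measurable
    define N1 where "N1 w = Lp_norm (q $ 1) (ball_vol_wt (\<beta> $ 1)) (\<lambda>z. N z w)" for w
    have N1 [measurable]: "N1 \<in> borel_measurable ball_vol"
      unfolding N1_def by (rule measurable_Lp_norm[OF _ sf\<beta>]) measurable
    note f_meas = \<open>f \<in> borel_measurable (ball_vol \<Otimes>\<^sub>M ball_vol)\<close>
    have le: "Lp_norm (q $ 2) (ball_vol_wt (\<beta> $ 2)) N1 \<le> C 1 * C 2 * mixed_norm p \<alpha> f"
      unfolding mixed_norm_eq_Lp_norm[OF p0] N1_def N_def
      using p q \<alpha> \<beta> by (intro pos_op2_bounded C(2)) auto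
    have "mixed_norm q \<beta> (A f) \<le> Lp_norm (q $ 2) (ball_vol_wt (\<beta> $ 2)) N1"
      unfolding mixed_norm_eq_Lp_norm[OF q0] N1_def N_def
      using q0 by (intro Lp_norm_mono norm_A_le) auto
    also note le
    finally show A_le: "mixed_norm q \<beta> (A f) \<le> ennreal (enn2real (C 1 * C 2)) * mixed_norm p \<alpha> f"
      using Cfin by simp
    also have "\<dots> < \<infinity>" using fin by (simp add: ennreal_mult_less_top)
    finally show "A f \<in> mixed_Lp q \<beta>" using measurable_A[of f] by (simp add: mixed_Lp_def)
    have "Lp_norm (q $ 2) (ball_vol_wt (\<beta> $ 2)) N1 < top"
      using le fin Cfin by (auto simp: ennreal_mult_less_top intro: le_less_trans)
    then have "(\<integral>\<^sup>+w. ennreal_powr (N1 w) (q $ 2) \<partial>ball_vol_wt (\<beta> $ 2)) \<noteq> \<infinity>"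
      by (simp add: Lp_norm_def)
    then have "AE w in ball_vol_wt (\<beta> $ 2). ennreal_powr (N1 w) (q $ 2) \<noteq> \<infinity>"
      by (intro nn_integral_PInf_AE) auto
    then have "AE w in ball_vol. N1 w \<noteq> top"
      using \<beta> by (simp add: AE_ball_vol_wt)
    \<comment> \<open>The mixed norm yields finiteness for almost every w and then for almost every
      z; the product measure lists z first, so the two quantifiers are exchanged afterwards.\<close>
    then have "AE w in ball_vol. AE z in ball_vol. N z w \<noteq> top"
    proof (rule AE_mp[OF _ AE_I2[OF impI]])
      fix w :: "complex ^ 'n" assume w: "w \<in> space ball_vol" and "N1 w \<noteq> top"
      then have "(\<integral>\<^sup>+z. ennreal_powr (N z w) (q $ 1) \<partial>ball_vol_wt (\<beta> $ 1)) \<noteq> \<infinity>"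
        by (simp add: N1_def Lp_norm_def)
      then have "AE z in ball_vol_wt (\<beta> $ 1). ennreal_powr (N z w) (q $ 1) \<noteq> \<infinity>"
        using w by (intro nn_integral_PInf_AE) auto
      then show "AE z in ball_vol. N z w \<noteq> top"
        using \<beta> by (simp add: AE_ball_vol_wt)
    qed
    then have "AE z in ball_vol. AE w in ball_vol. N z w \<noteq> top"
      by (subst ball_vol2.AE_commute) auto
    then have "AE x in ball_vol \<Otimes>\<^sub>M ball_vol. N (fst x) (snd x) \<noteq> top"
      by (intro ball_vol2.AE_pair_measure) auto
    then show "AE zw in ball_vol \<Otimes>\<^sub>M ball_vol. integrable (ball_vol \<Otimes>\<^sub>M ball_vol) (I f zw)"
    proof (rule AE_mp[OF _ AE_I2[OF impI]])
      fix x :: "(complex ^ 'n) \<times> (complex ^ 'n)"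
      assume x: "x \<in> space (ball_vol \<Otimes>\<^sub>M ball_vol)" and fin: "N (fst x) (snd x) \<noteq> top"
      obtain z w where zw: "x = (z, w)" "norm z < 1" "norm w < 1"
        using x by (cases x) (auto simp: space_pair_measure)
      \<comment> \<open>\<open>N\<close> contains the outer weight; it is positive, so finiteness of
        \<open>N\<close> passes to the bare integral.\<close>
      have "0 < bdist z powr (a $ 1) * bdist w powr (a $ 2)"
        using zw one_minus_norm_square_pos[of z] one_minus_norm_square_pos[of w] by (intro mult_pos_pos) auto
      then have "(\<integral>\<^sup>+y. ennreal (cmod (I f x y)) \<partial>(ball_vol \<Otimes>\<^sub>M ball_vol)) < \<infinity>"
        using fin unfolding N_def zw fst_conv snd_conv nn_integral_norm_I[OF zw(2,3) f_meas, symmetric]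
        by (auto simp: ennreal_mult_eq_top_iff ennreal_eq_0_iff simp flip: less_top)
      moreover have "I f x \<in> borel_measurable (ball_vol \<Otimes>\<^sub>M ball_vol)"
        using measurable_Pair2[OF measurable_I[OF f_meas] x] by simp
      ultimately show "integrable (ball_vol \<Otimes>\<^sub>M ball_vol) (I f x)"
        by (intro integrableI_bounded) auto
    qed
  qed
qed

end

section \<open>Two variables: test functions\<close>

lemma powr_comparable:
  fixes r x s :: real
  assumes "0 < x" "x / 2 \<le> r" "r \<le> 2 * x"
  shows "r powr s \<le> 2 powr \<bar>s\<bar> * x powr s" "2 powr - \<bar>s\<bar> * x powr s \<le> r powr s"
proof -
  define y where "y = r / x"
  have y: "1 / 2 \<le> y" "y \<le> 2" and r: "r = y * x" using assms by (auto simp: y_def field_simps)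
  have "y powr s \<le> 2 powr \<bar>s\<bar> \<and> 2 powr - \<bar>s\<bar> \<le> y powr s"
  proof (cases "0 \<le> s")
    case True
    have "(1 / 2) powr s \<le> y powr s" "y powr s \<le> 2 powr s" using True y by (auto intro!: powr_mono2)
    then show ?thesis using True by (simp add: powr_divide powr_minus_divide)
  next
    case False
    have "y powr s \<le> (1 / 2) powr s" "2 powr s \<le> y powr s" using False y by (auto intro!: powr_mono2')
    then show ?thesis using False by (simp add: powr_divide powr_minus_divide)
  qed
  then show "r powr s \<le> 2 powr \<bar>s\<bar> * x powr s" "2 powr - \<bar>s\<bar> * x powr s \<le> r powr s"
    using y assms by (simp_all add: r powr_mult mult_right_mono)
qed

text \<open>One-variable test data: E is the set where the image of g is examined, and x > 0
  approximates 1 - <z,u> with relative error at most \<epsilon> for z in E and u in the ball with g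
  u nonzero. The finite integral makes the integral defining the operator absolutely convergent at
  those points.\<close>

definition admissible :: "real \<Rightarrow> real \<Rightarrow> (complex ^ 'n \<Rightarrow> real) \<Rightarrow> (complex ^ 'n) set \<Rightarrow> real \<Rightarrow> bool" where
  "admissible \<epsilon> b g E x \<longleftrightarrow> g \<in> borel_measurable ball_vol \<and> (\<forall>u. 0 \<le> g u) \<and>
     (\<integral>\<^sup>+u. ennreal (bdist u powr b * g u) \<partial>ball_vol) < top \<and> E \<in> sets ball_vol \<and> 0 < x \<and>
     (\<forall>z\<in>E. \<forall>u. norm u < 1 \<longrightarrow> g u \<noteq> 0 \<longrightarrow> cmod (1 - hinner z u - of_real x) \<le> \<epsilon> * x)"

text \<open>Up to a constant, the L^q norm over E of the one-variable operator applied to g, once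
  the kernel |1 - <z,u>|^(-c) is replaced by x^(-c).\<close>

definition test_value :: "real \<Rightarrow> real \<Rightarrow> real \<Rightarrow> real \<Rightarrow> real \<Rightarrow> (complex ^ 'n \<Rightarrow> real) \<Rightarrow> (complex ^ 'n) set \<Rightarrow> real \<Rightarrow> ennreal" where
  "test_value a b c \<beta> q g E x = Lp_norm q (ball_vol_wt \<beta>) (\<lambda>z. indicator E z * ennreal (bdist z powr a))
     * ennreal (x powr - c) * (\<integral>\<^sup>+u. ennreal (bdist u powr b * g u) \<partial>ball_vol)"

lemma cmod_near:
  assumes "cmod (X - of_real x) \<le> \<epsilon> * x" "0 < x" "\<epsilon> \<le> 1 / 2"
  shows "x / 2 \<le> cmod X" "cmod X \<le> 2 * x"
proof -
  have "cmod (X - of_real x) \<le> 1 / 2 * x"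
    using assms mult_right_mono[of \<epsilon> "1 / 2" x] by linarith
  then show "x / 2 \<le> cmod X" "cmod X \<le> 2 * x"
    using norm_triangle_ineq3[of X "of_real x"] assms(2) by (auto simp: abs_le_iff)
qed

lemma nn_integral_ball_vol_product:
  fixes g h :: "complex ^ 'n \<Rightarrow> ennreal"
  assumes [measurable]: "g \<in> borel_measurable ball_vol" "h \<in> borel_measurable ball_vol"
  shows "(\<integral>\<^sup>+x. g (fst x) * h (snd x) \<partial>(ball_vol \<Otimes>\<^sub>M ball_vol))
    = (\<integral>\<^sup>+u. g u \<partial>ball_vol) * (\<integral>\<^sup>+u. h u \<partial>ball_vol)"
proof -
  have "(\<integral>\<^sup>+x. g (fst x) * h (snd x) \<partial>(ball_vol \<Otimes>\<^sub>M ball_vol))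
      = (\<integral>\<^sup>+u. (\<integral>\<^sup>+\<eta>. g u * h \<eta> \<partial>ball_vol) \<partial>ball_vol)"
    by (subst ball_vol.nn_integral_fst[symmetric]) auto
  also have "\<dots> = (\<integral>\<^sup>+u. g u * (\<integral>\<^sup>+\<eta>. h \<eta> \<partial>ball_vol) \<partial>ball_vol)"
    by (intro nn_integral_cong nn_integral_cmult) auto
  finally show ?thesis by (simp add: nn_integral_multc)
qed

context mixed_operator
begin

text \<open>The modulus of an integral is at least the integral of the real part. On the support of
  f the phase condition costs a factor 1/2, and \<epsilon> <= 1/2 keeps the two quantities |1 -
  <z,u>| and |1 - <w,\<eta>|> within a factor 2 of x and y, which costs 2^(-(|c1| + |c2|)).\<close>

lemma A_product_lower:
  assumes \<epsilon>: "\<epsilon> \<le> 1 / 2"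
    and phase: "\<And>z w u \<eta> x y. \<lbrakk>norm z < 1; norm w < 1; norm u < 1; norm \<eta> < 1; 0 < x; 0 < y;
      cmod (1 - hinner z u - of_real x) \<le> \<epsilon> * x; cmod (1 - hinner w \<eta> - of_real y) \<le> \<epsilon> * y\<rbrakk>
      \<Longrightarrow> cmod (\<kappa> z w u \<eta>) \<le> 2 * Re (\<kappa> z w u \<eta>)"
    and g: "admissible \<epsilon> (b $ 1) g E x" and h: "admissible \<epsilon> (b $ 2) h F y" and z: "z \<in> E" and w: "w \<in> F"
    and f: "f = (\<lambda>(u, \<eta>). of_real (g u * h \<eta>))"
    and G: "G = (\<integral>\<^sup>+u. ennreal (bdist u powr (b $ 1) * g u) \<partial>ball_vol)"
    and H: "H = (\<integral>\<^sup>+u. ennreal (bdist u powr (b $ 2) * h u) \<partial>ball_vol)"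
  shows "ennreal (1 / 2 * 2 powr - (\<bar>c $ 1\<bar> + \<bar>c $ 2\<bar>)) * (ennreal (x powr - (c $ 1)) * G * (ennreal (y powr - (c $ 2)) * H))
      * ennreal (bdist z powr (a $ 1) * bdist w powr (a $ 2)) \<le> ennreal (cmod (A f (z, w)))"
proof -
  have [measurable]: "g \<in> borel_measurable ball_vol" "h \<in> borel_measurable ball_vol"
    and g0: "\<And>u. 0 \<le> g u" and h0: "\<And>u. 0 \<le> h u" and x: "0 < x" and y: "0 < y"
    and fin: "G < top" "H < top"
    and zE: "E \<subseteq> ball 0 1" and wF: "F \<subseteq> ball 0 1"
    using g h sets.sets_into_space[of E ball_vol] sets.sets_into_space[of F ball_vol] by (auto simp: admissible_def G H)
  have z1: "norm z < 1" and w1: "norm w < 1" using z w zE wF by auto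
  have nz: "cmod (1 - hinner z u - of_real x) \<le> \<epsilon> * x" if "norm u < 1" "g u \<noteq> 0" for u
    using g z that by (auto simp: admissible_def)
  have nw: "cmod (1 - hinner w u - of_real y) \<le> \<epsilon> * y" if "norm u < 1" "h u \<noteq> 0" for u
    using h w that by (auto simp: admissible_def)
  have f_meas [measurable]: "f \<in> borel_measurable (ball_vol \<Otimes>\<^sub>M ball_vol)" unfolding f by measurable
  define k where "k = \<bar>c $ 1\<bar> + \<bar>c $ 2\<bar>"
  define D where "D v = (bdist (fst v) powr (b $ 1) * g (fst v)) * (bdist (snd v) powr (b $ 2) * h (snd v))"
    for v :: "(complex ^ 'n) \<times> (complex ^ 'n)"
  have D0: "0 \<le> D v" for v using g0 h0 by (simp add: D_def)
  define X where "X = x powr - (c $ 1) * y powr - (c $ 2)"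
  have X0: "0 \<le> X" by (simp add: X_def)
  have [measurable]: "D \<in> borel_measurable (ball_vol \<Otimes>\<^sub>M ball_vol)" unfolding D_def by measurable
  have intD: "(\<integral>\<^sup>+v. ennreal (D v) \<partial>(ball_vol \<Otimes>\<^sub>M ball_vol)) = G * H"
    unfolding G H D_def using g0 h0
    by (subst nn_integral_ball_vol_product[symmetric]) (auto intro!: nn_integral_cong simp: ennreal_mult)
  have J_meas [measurable]: "I f (z, w) \<in> borel_measurable (ball_vol \<Otimes>\<^sub>M ball_vol)"
    using measurable_Pair2[OF measurable_I[OF f_meas], of "(z, w)"] z1 w1 by (simp add: space_pair_measure)
  have bounds: "cmod (I f (z, w) v) \<le> 2 powr k * X * D v \<and> 1 / 2 * 2 powr - k * X * D v \<le> Re (I f (z, w) v)"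
    if v: "v \<in> space (ball_vol \<Otimes>\<^sub>M ball_vol)" for v
  proof -
    obtain u \<eta> where u: "v = (u, \<eta>)" "norm u < 1" "norm \<eta> < 1"
      using v by (cases v) (auto simp: space_pair_measure)
    have I: "I f (z, w) v = of_real (D v) * \<kappa> z w u \<eta>"
      by (simp add: u I_eq f D_def mult_ac)
    show ?thesis
    proof (cases "g u = 0 \<or> h \<eta> = 0")
      case True
      then have "D v = 0" by (auto simp: D_def u)
      then show ?thesis by (simp add: I)
    next
      case False
      then have near: "cmod (1 - hinner z u - of_real x) \<le> \<epsilon> * x" "cmod (1 - hinner w \<eta> - of_real y) \<le> \<epsilon> * y"
        using nz nw u by auto
      note c1 = powr_comparable[OF x cmod_near[OF near(1) x \<epsilon>], of "- (c $ 1)"]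
      note c2 = powr_comparable[OF y cmod_near[OF near(2) y \<epsilon>], of "- (c $ 2)"]
      have n: "cmod (\<kappa> z w u \<eta>) = cmod (1 - hinner z u) powr - (c $ 1) * cmod (1 - hinner w \<eta>) powr - (c $ 2)"
        using z1 w1 u by (intro norm_\<kappa>)
      have "cmod (\<kappa> z w u \<eta>) \<le> (2 powr \<bar>- (c $ 1)\<bar> * x powr - (c $ 1)) * (2 powr \<bar>- (c $ 2)\<bar> * y powr - (c $ 2))"
        unfolding n by (intro mult_mono c1 c2) auto
      also have "\<dots> = 2 powr k * X" by (simp add: k_def X_def powr_add)
      finally have up: "cmod (\<kappa> z w u \<eta>) \<le> 2 powr k * X" .
      have "2 powr - k * X = (2 powr - \<bar>- (c $ 1)\<bar> * x powr - (c $ 1)) * (2 powr - \<bar>- (c $ 2)\<bar> * y powr - (c $ 2))"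
      proof -
        have "- k = - \<bar>c $ 1\<bar> + - \<bar>c $ 2\<bar>" by (simp add: k_def)
        then have "2 powr - k = (2 powr - \<bar>c $ 1\<bar> * 2 powr - \<bar>c $ 2\<bar> :: real)" by (simp only: powr_add)
        then show ?thesis by (simp add: X_def)
      qed
      also have "\<dots> \<le> cmod (\<kappa> z w u \<eta>)"
        unfolding n by (intro mult_mono c1 c2) auto
      also have "\<dots> \<le> 2 * Re (\<kappa> z w u \<eta>)"
        using z1 w1 u x y near by (intro phase)
      finally have lo: "1 / 2 * 2 powr - k * X \<le> Re (\<kappa> z w u \<eta>)" by simp
      show ?thesis
        using mult_left_mono[OF up D0[of v]] mult_left_mono[OF lo D0[of v]] D0[of v]
        by (simp add: I norm_mult mult_ac)
    qed
  qed
  \<comment> \<open>Without integrability the Bochner integral would be 0 and the lower bound could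
    fail; the upper half of \<open>bounds\<close> supplies it.\<close>
  have J_int: "integrable (ball_vol \<Otimes>\<^sub>M ball_vol) (I f (z, w))"
  proof (rule integrableI_bounded)
    have "(\<integral>\<^sup>+v. ennreal (cmod (I f (z, w) v)) \<partial>(ball_vol \<Otimes>\<^sub>M ball_vol))
        \<le> (\<integral>\<^sup>+v. ennreal (2 powr k * X) * ennreal (D v) \<partial>(ball_vol \<Otimes>\<^sub>M ball_vol))"
      using bounds X0 D0 by (intro nn_integral_mono) (simp add: ennreal_mult[symmetric] ennreal_leI)
    also have "\<dots> = ennreal (2 powr k * X) * (G * H)"
      unfolding intD[symmetric] by (rule nn_integral_cmult) measurable
    also have "\<dots> < \<infinity>" using fin by (simp add: ennreal_mult_less_top)
    finally show "(\<integral>\<^sup>+v. ennreal (cmod (I f (z, w) v)) \<partial>(ball_vol \<Otimes>\<^sub>M ball_vol)) < \<infinity>" .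
  qed measurable
  have "ennreal (1 / 2 * 2 powr - k * X) * (G * H)
      = (\<integral>\<^sup>+v. ennreal (1 / 2 * 2 powr - k * X) * ennreal (D v) \<partial>(ball_vol \<Otimes>\<^sub>M ball_vol))"
    unfolding intD[symmetric] by (rule nn_integral_cmult[symmetric]) measurable
  also have "\<dots> \<le> (\<integral>\<^sup>+v. ennreal (Re (I f (z, w) v)) \<partial>(ball_vol \<Otimes>\<^sub>M ball_vol))"
    using bounds X0 D0 by (intro nn_integral_mono) (simp add: ennreal_mult[symmetric] ennreal_leI)
  also have "\<dots> = ennreal (\<integral>v. Re (I f (z, w) v) \<partial>(ball_vol \<Otimes>\<^sub>M ball_vol))"
  proof (rule nn_integral_eq_integral)
    have "0 \<le> Re (I f (z, w) v)" if "v \<in> space (ball_vol \<Otimes>\<^sub>M ball_vol)" for v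
    proof -
      have "0 \<le> 1 / 2 * 2 powr - k * X * D v" using X0 D0[of v] by simp
      then show ?thesis using bounds[OF that] by linarith
    qed
    then show "AE v in ball_vol \<Otimes>\<^sub>M ball_vol. 0 \<le> Re (I f (z, w) v)" by (rule AE_I2)
  qed (use J_int in auto)
  also have "\<dots> = ennreal (Re (\<integral>v. I f (z, w) v \<partial>(ball_vol \<Otimes>\<^sub>M ball_vol)))"
    using J_int by simp
  also have "\<dots> \<le> ennreal (cmod (\<integral>v. I f (z, w) v \<partial>(ball_vol \<Otimes>\<^sub>M ball_vol)))"
    by (intro ennreal_leI complex_Re_le_cmod)
  finally have "ennreal (1 / 2 * 2 powr - k * X) * (G * H) * ennreal (bdist z powr (a $ 1) * bdist w powr (a $ 2))
      \<le> ennreal (cmod (\<integral>v. I f (z, w) v \<partial>(ball_vol \<Otimes>\<^sub>M ball_vol))) * ennreal (bdist z powr (a $ 1) * bdist w powr (a $ 2))"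
    by (rule mult_right_mono) simp
  also have "\<dots> = ennreal (cmod (A f (z, w)))"
    by (simp add: A_eq norm_mult ennreal_mult[symmetric] mult_ac)
  finally have le: "ennreal (1 / 2 * 2 powr - k * X) * (G * H) * ennreal (bdist z powr (a $ 1) * bdist w powr (a $ 2))
      \<le> ennreal (cmod (A f (z, w)))" .
  have "ennreal (1 / 2 * 2 powr - k * X) = ennreal (1 / 2 * 2 powr - k) * (ennreal (x powr - (c $ 1)) * ennreal (y powr - (c $ 2)))"
    unfolding X_def by (simp add: ennreal_mult[symmetric])
  with le show ?thesis by (simp only: k_def mult_ac)
qed

text \<open>Mixed norms of products g(u) h(\<eta>) factor, so boundedness becomes an inequality
  between products of one-variable quantities. Both \<epsilon> and C are fixed before the test data,
  which may then degenerate towards the boundary.\<close>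

lemma product_test:
  fixes p q \<alpha> \<beta> :: "real ^ 2"
  assumes bd: "bounded_mixed_Lp I A p \<alpha> q \<beta>" and p: "\<forall>i. 0 < p $ i" and q: "\<forall>i. 0 < q $ i"
  shows "\<exists>\<epsilon>>0. \<epsilon> \<le> 1 / 2 \<and> (\<exists>C<top. \<forall>(g :: complex ^ 'n \<Rightarrow> real) (h :: complex ^ 'n \<Rightarrow> real) E F x y.
    admissible \<epsilon> (b $ 1) g E x \<longrightarrow> admissible \<epsilon> (b $ 2) h F y \<longrightarrow>
    Lp_norm (p $ 1) (ball_vol_wt (\<alpha> $ 1)) (\<lambda>u. ennreal (g u)) < top \<longrightarrow>
    Lp_norm (p $ 2) (ball_vol_wt (\<alpha> $ 2)) (\<lambda>u. ennreal (h u)) < top \<longrightarrow>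
    test_value (a $ 1) (b $ 1) (c $ 1) (\<beta> $ 1) (q $ 1) g E x * test_value (a $ 2) (b $ 2) (c $ 2) (\<beta> $ 2) (q $ 2) h F y
    \<le> C * (Lp_norm (p $ 1) (ball_vol_wt (\<alpha> $ 1)) (\<lambda>u. ennreal (g u))
      * Lp_norm (p $ 2) (ball_vol_wt (\<alpha> $ 2)) (\<lambda>u. ennreal (h u))))"
proof -
  obtain \<epsilon> where \<epsilon>: "\<epsilon> > 0" "\<epsilon> \<le> 1 / 2"
    and phase: "\<And>z w u \<eta> x y. \<lbrakk>norm z < 1; norm w < 1; norm u < 1; norm \<eta> < 1; 0 < x; 0 < y;
      cmod (1 - hinner z u - of_real x) \<le> \<epsilon> * x; cmod (1 - hinner w \<eta> - of_real y) \<le> \<epsilon> * y\<rbrakk>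
      \<Longrightarrow> cmod (\<kappa> z w u \<eta>) \<le> 2 * Re (\<kappa> z w u \<eta>)"
    using phase_\<kappa> by blast
  obtain C where C: "\<And>f. f \<in> mixed_Lp p \<alpha> \<Longrightarrow> mixed_norm q \<beta> (A f) \<le> ennreal C * mixed_norm p \<alpha> f"
    using bd unfolding bounded_mixed_Lp_def by blast
  have p0: "p $ 1 > 0" "p $ 2 > 0" and q0: "q $ 1 > 0" "q $ 2 > 0" using p q by auto
  define K where "K = 1 / 2 * 2 powr - (\<bar>c $ 1\<bar> + \<bar>c $ 2\<bar>)"
  have K: "K > 0" by (simp add: K_def)
  have main: "test_value (a $ 1) (b $ 1) (c $ 1) (\<beta> $ 1) (q $ 1) g E x * test_value (a $ 2) (b $ 2) (c $ 2) (\<beta> $ 2) (q $ 2) h F y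
    \<le> (ennreal (1 / K) * ennreal C) * (Lp_norm (p $ 1) (ball_vol_wt (\<alpha> $ 1)) (\<lambda>u. ennreal (g u))
      * Lp_norm (p $ 2) (ball_vol_wt (\<alpha> $ 2)) (\<lambda>u. ennreal (h u)))"
    if g: "admissible \<epsilon> (b $ 1) g E x" and h: "admissible \<epsilon> (b $ 2) h F y"
    and gp: "Lp_norm (p $ 1) (ball_vol_wt (\<alpha> $ 1)) (\<lambda>u. ennreal (g u)) < top"
    and hp: "Lp_norm (p $ 2) (ball_vol_wt (\<alpha> $ 2)) (\<lambda>u. ennreal (h u)) < top"
    for g h :: "complex ^ 'n \<Rightarrow> real" and E F :: "(complex ^ 'n) set" and x y
  proof -
    have [measurable]: "g \<in> borel_measurable ball_vol" "h \<in> borel_measurable ball_vol" "E \<in> sets ball_vol" "F \<in> sets ball_vol"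
      and g0: "\<And>u. 0 \<le> g u" and h0: "\<And>u. 0 \<le> h u" using g h by (auto simp: admissible_def)
    define f :: "(complex ^ 'n) \<times> (complex ^ 'n) \<Rightarrow> complex" where "f = (\<lambda>(u, \<eta>). of_real (g u * h \<eta>))"
    have f_meas [measurable]: "f \<in> borel_measurable (ball_vol \<Otimes>\<^sub>M ball_vol)" unfolding f_def by measurable
    have f_norm: "mixed_norm p \<alpha> f = Lp_norm (p $ 1) (ball_vol_wt (\<alpha> $ 1)) (\<lambda>u. ennreal (g u))
      * Lp_norm (p $ 2) (ball_vol_wt (\<alpha> $ 2)) (\<lambda>u. ennreal (h u))"
    proof -
      have "mixed_norm p \<alpha> f = Lp_norm (p $ 2) (ball_vol_wt (\<alpha> $ 2))
          (\<lambda>w. Lp_norm (p $ 1) (ball_vol_wt (\<alpha> $ 1)) (\<lambda>z. ennreal (g z) * ennreal (h w)))"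
        unfolding mixed_norm_eq_Lp_norm[OF p0] using g0 h0 by (simp add: f_def norm_mult ennreal_mult)
      also have "\<dots> = Lp_norm (p $ 2) (ball_vol_wt (\<alpha> $ 2))
          (\<lambda>w. Lp_norm (p $ 1) (ball_vol_wt (\<alpha> $ 1)) (\<lambda>z. ennreal (g z)) * ennreal (h w))"
        using p0 by (subst Lp_norm_multc) auto
      also have "\<dots> = Lp_norm (p $ 1) (ball_vol_wt (\<alpha> $ 1)) (\<lambda>u. ennreal (g u))
          * Lp_norm (p $ 2) (ball_vol_wt (\<alpha> $ 2)) (\<lambda>u. ennreal (h u))"
        using p0 by (intro Lp_norm_cmult) auto
      finally show ?thesis .
    qed
    have "f \<in> mixed_Lp p \<alpha>"
      unfolding mixed_Lp_def using gp hp by (simp add: f_norm ennreal_mult_less_top)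
    then have Af: "mixed_norm q \<beta> (A f) \<le> ennreal C * mixed_norm p \<alpha> f" by (rule C)
    define G where "G = (\<integral>\<^sup>+u. ennreal (bdist u powr (b $ 1) * g u) \<partial>ball_vol)"
    define H where "H = (\<integral>\<^sup>+u. ennreal (bdist u powr (b $ 2) * h u) \<partial>ball_vol)"
    define X where "X = ennreal K * (ennreal (x powr - (c $ 1)) * G * (ennreal (y powr - (c $ 2)) * H))"
    define e1 where "e1 z = indicator E z * ennreal (bdist z powr (a $ 1))" for z
    define e2 where "e2 z = indicator F z * ennreal (bdist z powr (a $ 2))" for z
    have [measurable]: "e1 \<in> borel_measurable ball_vol" "e2 \<in> borel_measurable ball_vol"
      unfolding e1_def e2_def by measurable
    have lower: "X * e2 w * e1 z \<le> ennreal (cmod (A f (z, w)))" for z w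
    proof (cases "z \<in> E \<and> w \<in> F")
      case True
      then show ?thesis
        using A_product_lower[OF \<epsilon>(2) phase g h conjunct1[OF True] conjunct2[OF True] f_def G_def H_def]
        by (simp add: X_def K_def e1_def e2_def ennreal_mult mult_ac)
    next
      case False
      then show ?thesis by (auto simp: e1_def e2_def)
    qed
    have "X * (Lp_norm (q $ 1) (ball_vol_wt (\<beta> $ 1)) e1 * Lp_norm (q $ 2) (ball_vol_wt (\<beta> $ 2)) e2)
        = Lp_norm (q $ 2) (ball_vol_wt (\<beta> $ 2)) (\<lambda>w. X * Lp_norm (q $ 1) (ball_vol_wt (\<beta> $ 1)) e1 * e2 w)"
      using q0 by (subst Lp_norm_cmult) (auto simp: mult_ac)
    also have "\<dots> = Lp_norm (q $ 2) (ball_vol_wt (\<beta> $ 2)) (\<lambda>w. Lp_norm (q $ 1) (ball_vol_wt (\<beta> $ 1)) (\<lambda>z. X * e2 w * e1 z))"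
      using q0 by (subst Lp_norm_cmult) (auto simp: mult_ac)
    also have "\<dots> \<le> mixed_norm q \<beta> (A f)"
      unfolding mixed_norm_eq_Lp_norm[OF q0] using q0 by (intro Lp_norm_mono lower)
    also note Af
    finally have "ennreal (1 / K) * (X * (Lp_norm (q $ 1) (ball_vol_wt (\<beta> $ 1)) e1 * Lp_norm (q $ 2) (ball_vol_wt (\<beta> $ 2)) e2))
        \<le> ennreal (1 / K) * (ennreal C * mixed_norm p \<alpha> f)"
      by (rule mult_left_mono) simp
    moreover have "ennreal (1 / K) * (X * (Lp_norm (q $ 1) (ball_vol_wt (\<beta> $ 1)) e1 * Lp_norm (q $ 2) (ball_vol_wt (\<beta> $ 2)) e2))
      = test_value (a $ 1) (b $ 1) (c $ 1) (\<beta> $ 1) (q $ 1) g E x * test_value (a $ 2) (b $ 2) (c $ 2) (\<beta> $ 2) (q $ 2) h F y"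
    proof -
      have "ennreal (1 / K) * ennreal K = 1" using K by (simp flip: ennreal_mult)
      then have "ennreal (1 / K) * X = ennreal (x powr - (c $ 1)) * G * (ennreal (y powr - (c $ 2)) * H)"
        unfolding X_def by (simp only: mult.assoc[symmetric] mult_1)
      then show ?thesis
        unfolding test_value_def G_def[symmetric] H_def[symmetric] e1_def[abs_def] e2_def[abs_def]
        by (simp only: mult.assoc[symmetric]) (simp only: mult_ac)
    qed
    ultimately show ?thesis by (simp add: f_norm mult.assoc)
  qed
  moreover have "ennreal (1 / K) * ennreal C < top" by (simp add: ennreal_mult_less_top)
  ultimately show ?thesis
    using \<epsilon> by (intro exI[of _ \<epsilon>] exI[of _ "ennreal (1 / K) * ennreal C"] conjI allI impI main) auto
qed

end

section \<open>One variable: necessity\<close>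

text \<open>The norms of the test functions, their integrals against the weight, and the norms of
  the outer weight over E are all expressed through these numbers.\<close>

definition moment :: "(complex ^ 'n) set \<Rightarrow> real \<Rightarrow> ennreal" where
  "moment S s = (\<integral>\<^sup>+u. indicator S u * ennreal (bdist u powr s) \<partial>ball_vol)"

lemma moment_mono: "S \<subseteq> T \<Longrightarrow> moment S s \<le> moment T s"
  unfolding moment_def by (intro nn_integral_mono mult_right_mono) (auto simp: indicator_def)

lemma moment_near:
  fixes S :: "(complex ^ 'n) set"
  assumes S: "S \<in> sets ball_vol" and x: "0 < x" and near: "\<And>u. u \<in> S \<Longrightarrow> x / 2 \<le> bdist u \<and> bdist u \<le> 2 * x"
  shows "moment S s \<le> ennreal (2 powr \<bar>s\<bar> * x powr s) * emeasure ball_vol S"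
    and "ennreal (2 powr - \<bar>s\<bar> * x powr s) * emeasure ball_vol S \<le> moment S s"
proof -
  have c: "bdist u powr s \<le> 2 powr \<bar>s\<bar> * x powr s" "2 powr - \<bar>s\<bar> * x powr s \<le> bdist u powr s" if "u \<in> S" for u
    using powr_comparable[OF x, of "bdist u" s] near[OF that] by auto
  have "moment S s \<le> (\<integral>\<^sup>+u. ennreal (2 powr \<bar>s\<bar> * x powr s) * indicator S u \<partial>ball_vol)"
    unfolding moment_def using c by (intro nn_integral_mono) (auto simp: indicator_def ennreal_leI)
  then show "moment S s \<le> ennreal (2 powr \<bar>s\<bar> * x powr s) * emeasure ball_vol S"
    using S by (simp add: nn_integral_cmult_indicator)
  have "(\<integral>\<^sup>+u. ennreal (2 powr - \<bar>s\<bar> * x powr s) * indicator S u \<partial>ball_vol) \<le> moment S s"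
    unfolding moment_def using c by (intro nn_integral_mono) (auto simp: indicator_def ennreal_leI)
  then show "ennreal (2 powr - \<bar>s\<bar> * x powr s) * emeasure ball_vol S \<le> moment S s"
    using S by (simp add: nn_integral_cmult_indicator)
qed

lemma emeasure_ball_vol_ball:
  assumes "0 \<le> r" "r \<le> 1"
  shows "emeasure ball_vol (ball (0 :: complex ^ 'n) r) = ennreal (r ^ (2 * CARD('n)))"
proof -
  have "emeasure ball_vol (ball (0 :: complex ^ 'n) r)
      = ennreal (measure lebesgue (ball (0 :: complex ^ 'n) r) / unit_ball_vol (2 * real CARD('n)))"
    using assms by (intro emeasure_ball_vol) auto
  moreover have "unit_ball_vol (real CARD('n) * 2) \<noteq> 0"
    by (rule less_imp_neq[OF unit_ball_vol_pos, symmetric]) simp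
  ultimately show ?thesis using assms by (simp add: content_ball mult.commute)
qed

lemma ball_sets_ball_vol: "r \<le> 1 \<Longrightarrow> ball 0 r \<in> sets ball_vol"
  by (intro subset_ball_sets_ball_vol) auto

lemma moment_small_ball_pos:
  assumes "0 < r" "r \<le> 1 / 2"
  shows "0 < moment (ball (0 :: complex ^ 'n) r) s"
proof -
  have "0 < ennreal (2 powr - \<bar>s\<bar> * 1 powr s) * emeasure ball_vol (ball (0 :: complex ^ 'n) r)"
    using assms by (simp add: emeasure_ball_vol_ball ennreal_zero_less_mult_iff)
  also have "\<dots> \<le> moment (ball (0 :: complex ^ 'n) r) s"
  proof (rule moment_near)
    fix u :: "complex ^ 'n" assume "u \<in> ball 0 r"
    then have "(norm u)\<^sup>2 \<le> (1 / 2)\<^sup>2" using assms by (intro power_mono) auto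
    then have "(norm u)\<^sup>2 \<le> 1 / 4" by (simp add: power_divide)
    then show "1 / 2 \<le> bdist u \<and> bdist u \<le> 2 * 1" using zero_le_power2[of "norm u"] by linarith
  qed (use assms in \<open>auto intro: ball_sets_ball_vol\<close>)
  finally show ?thesis .
qed

lemma moment_ball_finite:
  assumes r: "r < 1"
  shows "moment (ball (0 :: complex ^ 'n) r) s < top"
proof -
  \<comment> \<open>The sum covers both signs of s: the weight is at most 1 for s >= 0 and at most
    (1 - r)^s for s < 0.\<close>
  have "moment (ball (0 :: complex ^ 'n) r) s \<le> (\<integral>\<^sup>+u. ennreal ((1 - r) powr s + 1) \<partial>(ball_vol :: (complex ^ 'n) measure))"
    unfolding moment_def
  proof (intro nn_integral_mono)
    fix u :: "complex ^ 'n" assume u: "u \<in> space ball_vol"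
    show "indicator (ball 0 r) u * ennreal (bdist u powr s) \<le> ennreal ((1 - r) powr s + 1)"
    proof (cases "norm u < r")
      case True
      have "bdist u powr s \<le> (1 - r) powr s + 1"
      proof (cases "0 \<le> s")
        case True
        have "bdist u powr s \<le> 1 powr s" using True bdist_pos[OF u] by (intro powr_mono2) auto
        then show ?thesis using powr_ge_zero[of "1 - r" s] by (simp del: powr_ge_zero)
      next
        case False
        have "bdist u powr s \<le> (1 - r) powr s"
          using False r True one_minus_norm_le_square[of u] u by (intro powr_mono2') auto
        then show ?thesis by simp
      qed
      from ennreal_leI[OF this] show ?thesis using True by (simp del: ennreal_plus)
    qed (auto simp: indicator_def)
  qed
  also have "\<dots> < top"
    using emeasure_ball_vol_UNIV[where 'n = 'n] by (simp add: ennreal_mult_less_top)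
  finally show ?thesis .
qed

lemma emeasure_ball_vol_shell_ge:
  assumes h: "0 < h" "h \<le> 1"
  shows "ennreal h \<le> emeasure ball_vol {u :: complex ^ 'n. 1 - h \<le> norm u \<and> norm u < 1}"
proof -
  have eq: "{u :: complex ^ 'n. 1 - h \<le> norm u \<and> norm u < 1} = ball 0 1 - ball 0 (1 - h)"
    by auto
  have "(1 - h) ^ (2 * CARD('n)) \<le> (1 - h) ^ 1"
    using h by (intro power_decreasing) (auto simp: Suc_leI)
  then have "ennreal h \<le> ennreal (1 - (1 - h) ^ (2 * CARD('n)))" by (intro ennreal_leI) simp
  also have "\<dots> = 1 - ennreal ((1 - h) ^ (2 * CARD('n)))"
    using h ennreal_minus[of "(1 - h) ^ (2 * CARD('n))" 1] by simp
  also have "\<dots> = emeasure ball_vol (ball (0 :: complex ^ 'n) 1 - ball 0 (1 - h))"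
    using h by (subst emeasure_Diff) (auto simp: emeasure_ball_vol_ball ball_sets_ball_vol)
  finally show ?thesis unfolding eq .
qed

text \<open>The shell \<open>B k\<close> of thickness 1/(k+1) has volume at least 1/(k+1), and the
  weight is at least (k+1)/2 on it, so its weighted mass is at least 1/2 for every k. The shells
  decrease to the empty set; were the mass of \<open>B 0\<close>, the whole ball, finite, continuity
  from above would force the masses to 0.\<close>

lemma moment_infinite:
  assumes s: "s \<le> -1"
  shows "moment (ball (0 :: complex ^ 'n) 1) s = top"
proof -
  define \<nu> where "\<nu> = density ball_vol (\<lambda>u :: complex ^ 'n. ennreal (bdist u powr s))"
  define B where "B k = {u :: complex ^ 'n. 1 - 1 / real (Suc k) \<le> norm u \<and> norm u < 1}" for k
  have B_sets: "B k \<in> sets ball_vol" for k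
    by (intro subset_ball_sets_ball_vol) (auto simp: B_def)
  have \<nu>: "emeasure \<nu> S = moment S s" if "S \<in> sets ball_vol" for S
    unfolding \<nu>_def moment_def using that by (subst emeasure_density) (auto simp: mult.commute)
  have half: "ennreal (1 / 2) \<le> emeasure \<nu> (B k)" for k
  proof -
    have "ennreal (1 / 2) = ennreal (real (Suc k) / 2) * ennreal (1 / real (Suc k))"
    proof -
      have "1 / 2 = real (Suc k) / 2 * (1 / real (Suc k))" by simp
      then show ?thesis by (simp only: ennreal_mult[symmetric] divide_nonneg_nonneg of_nat_0_le_iff zero_le_numeral zero_le_one)
    qed
    also have "\<dots> \<le> ennreal (real (Suc k) / 2) * emeasure ball_vol (B k)"
      unfolding B_def by (intro mult_left_mono emeasure_ball_vol_shell_ge) auto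
    also have "\<dots> = (\<integral>\<^sup>+u. ennreal (real (Suc k) / 2) * indicator (B k) u \<partial>ball_vol)"
      using B_sets by (simp add: nn_integral_cmult_indicator)
    also have "\<dots> \<le> moment (B k) s"
      unfolding moment_def
    proof (intro nn_integral_mono)
      fix u :: "complex ^ 'n" assume u: "u \<in> space ball_vol"
      show "ennreal (real (Suc k) / 2) * indicator (B k) u \<le> indicator (B k) u * ennreal (bdist u powr s)"
      proof (cases "u \<in> B k")
        case True
        then have "bdist u \<le> 2 / real (Suc k)"
          using one_minus_norm_square_le[of u] by (simp add: B_def)
        then have "real (Suc k) / 2 \<le> 1 / bdist u"
          using bdist_pos[OF u] by (simp add: field_simps)
        also have "\<dots> = bdist u powr -1" using bdist_pos[OF u] by (simp add: powr_minus_divide)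
        also have "\<dots> \<le> bdist u powr s"
          using bdist_pos[OF u] s by (intro powr_mono') auto
        finally show ?thesis using True by (simp add: ennreal_leI)
      qed auto
    qed
    finally show ?thesis using \<nu>[OF B_sets] by simp
  qed
  have "emeasure \<nu> (B 0) = top"
  proof (rule ccontr)
    assume fin: "emeasure \<nu> (B 0) \<noteq> top"
    have dec: "decseq B"
    proof (rule decseq_SucI)
      fix k
      have "1 / real (Suc (Suc k)) \<le> 1 / real (Suc k)" by (simp add: field_simps)
      then show "B (Suc k) \<subseteq> B k" by (auto simp: B_def)
    qed
    have fin': "emeasure \<nu> (B k) \<noteq> \<infinity>" for k
      using fin emeasure_mono[OF decseqD[OF dec], of 0 k \<nu>] B_sets by (auto simp: \<nu>_def top_unique)
    have "(\<lambda>k. emeasure \<nu> (B k)) \<longlonglongrightarrow> emeasure \<nu> (\<Inter>k. B k)"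
      using dec fin' B_sets by (intro Lim_emeasure_decseq) (auto simp: \<nu>_def)
    moreover have "(\<Inter>k. B k) = {}"
    proof -
      have "\<exists>k. u \<notin> B k" for u
      proof (cases "norm u < 1")
        case True
        then obtain k where "inverse (real (Suc k)) < 1 - norm u"
          using reals_Archimedean[of "1 - norm u"] by auto
        then have "u \<notin> B k" by (auto simp: B_def inverse_eq_divide)
        then show ?thesis ..
      qed (auto simp: B_def)
      then show ?thesis by blast
    qed
    ultimately have "(\<lambda>k. emeasure \<nu> (B k)) \<longlonglongrightarrow> 0" by simp
    then have "ennreal (1 / 2) \<le> 0"
      using half by (intro tendsto_lowerbound[of "\<lambda>k. emeasure \<nu> (B k)" 0 sequentially]) auto
    then show False by (simp add: ennreal_eq_0_iff)
  qed
  then have "moment (B 0) s = top" using \<nu>[OF B_sets] by simp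
  moreover have "B 0 \<subseteq> ball 0 1" by (auto simp: B_def)
  ultimately show ?thesis using moment_mono[of "B 0" "ball 0 1" s] by (simp add: top_unique)
qed

lemma SUP_moment_balls:
  "(SUP k. moment (ball (0 :: complex ^ 'n) (1 - 1 / real (Suc k))) s) = moment (ball (0 :: complex ^ 'n) 1) s"
proof -
  define S where "S k = ball (0 :: complex ^ 'n) (1 - 1 / real (Suc k))" for k
  have inc: "incseq S"
  proof (rule incseq_SucI)
    fix k
    have "1 / real (Suc (Suc k)) \<le> 1 / real (Suc k)" by (simp add: field_simps)
    then show "S k \<subseteq> S (Suc k)" by (auto simp: S_def)
  qed
  have S_sets: "S k \<in> sets ball_vol" for k unfolding S_def by (intro ball_sets_ball_vol) auto
  define \<nu> where "\<nu> = density ball_vol (\<lambda>u :: complex ^ 'n. ennreal (bdist u powr s))"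
  have \<nu>: "emeasure \<nu> S = moment S s" if "S \<in> sets ball_vol" for S
    unfolding \<nu>_def moment_def using that by (subst emeasure_density) (auto simp: mult.commute)
  have U: "(\<Union>k. S k) = ball 0 1"
  proof (intro equalityI subsetI)
    fix u :: "complex ^ 'n" assume "u \<in> ball 0 1"
    then obtain k where "inverse (real (Suc k)) < 1 - norm u"
      using reals_Archimedean[of "1 - norm u"] by auto
    then have "u \<in> S k" by (auto simp: S_def inverse_eq_divide)
    then show "u \<in> (\<Union>k. S k)" by blast
  next
    fix u assume "u \<in> (\<Union>k. S k)"
    then obtain k where "norm u < 1 - 1 / real (Suc k)" by (auto simp: S_def)
    moreover have "0 < 1 / real (Suc k)" by simp
    ultimately have "norm u < 1" by linarith
    then show "u \<in> ball 0 1" by simp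
  qed
  have "(SUP k. emeasure \<nu> (S k)) = emeasure \<nu> (\<Union>k. S k)"
    using inc S_sets by (intro SUP_emeasure_incseq) (auto simp: \<nu>_def)
  then show ?thesis
    unfolding U using \<nu>[OF S_sets] \<nu>[OF ball_sets_ball_vol[of 1]] by (simp add: S_def)
qed

lemma Lp_norm_bdist_indicator:
  fixes T :: "(complex ^ 'n) set"
  assumes r: "0 < r" and \<theta>: "-1 < \<theta>" and [measurable]: "T \<in> sets ball_vol"
  shows "Lp_norm r (ball_vol_wt \<theta>) (\<lambda>z. indicator T z * ennreal (bdist z powr s))
    = ennreal_powr (ennreal (wt_const TYPE('n) \<theta>) * moment T (\<theta> + r * s)) (1 / r)"
proof -
  have "(\<integral>\<^sup>+z. ennreal_powr (indicator T z * ennreal (bdist z powr s)) r \<partial>ball_vol_wt \<theta>)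
      = ennreal (wt_const TYPE('n) \<theta>) * (\<integral>\<^sup>+z. ennreal (bdist z powr \<theta>)
        * ennreal_powr (indicator T z * ennreal (bdist z powr s)) r \<partial>ball_vol)"
    by (rule nn_integral_ball_vol_wt[OF \<theta>]) measurable
  also have "(\<integral>\<^sup>+z. ennreal (bdist z powr \<theta>)
        * ennreal_powr (indicator T z * ennreal (bdist z powr s)) r \<partial>ball_vol) = moment T (\<theta> + r * s)"
    unfolding moment_def
    by (intro nn_integral_cong) (auto simp: indicator_def powr_powr powr_add mult.commute simp flip: ennreal_mult)
  finally show ?thesis by (simp add: Lp_norm_def)
qed

text \<open>All three conditions use g equal to (1 - |u|^2)^t on a set S and 0 elsewhere: t = 0 for
  the target condition and for the bound on c, and t = -(\<alpha> + 1)/p for the source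
  condition.\<close>

lemma test_moments:
  fixes S E :: "(complex ^ 'n) set"
  assumes test: "\<And>(g :: complex ^ 'n \<Rightarrow> real) E x. admissible \<epsilon> b g E x \<Longrightarrow>
      Lp_norm p (ball_vol_wt \<alpha>) (\<lambda>u. ennreal (g u)) < top \<Longrightarrow>
      test_value a b c \<beta> q g E x \<le> C * Lp_norm p (ball_vol_wt \<alpha>) (\<lambda>u. ennreal (g u))"
    and p: "0 < p" and q: "0 < q" and \<alpha>: "-1 < \<alpha>" and \<beta>: "-1 < \<beta>"
    and S [measurable]: "S \<in> sets ball_vol" and E [measurable]: "E \<in> sets ball_vol" and x: "0 < x"
    and near: "\<And>z u. z \<in> E \<Longrightarrow> u \<in> S \<Longrightarrow> cmod (1 - hinner z u - of_real x) \<le> \<epsilon> * x"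
    and fin: "moment S (b + t) < top" "moment S (\<alpha> + p * t) < top"
  shows "ennreal_powr (ennreal (wt_const TYPE('n) \<beta>) * moment E (\<beta> + q * a)) (1 / q)
      * ennreal (x powr - c) * moment S (b + t)
    \<le> C * ennreal_powr (ennreal (wt_const TYPE('n) \<alpha>) * moment S (\<alpha> + p * t)) (1 / p)"
proof -
  define g where "g u = indicator S u * bdist u powr t" for u
  have [measurable]: "g \<in> borel_measurable ball_vol" unfolding g_def by measurable
  have g_eq: "(\<lambda>u. ennreal (g u)) = (\<lambda>u. indicator S u * ennreal (bdist u powr t))"
    by (auto simp: g_def indicator_def)
  have int: "(\<integral>\<^sup>+u. ennreal (bdist u powr b * g u) \<partial>ball_vol) = moment S (b + t)"
    unfolding moment_def g_def
    by (intro nn_integral_cong) (auto simp: indicator_def powr_add)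
  have norm: "Lp_norm p (ball_vol_wt \<alpha>) (\<lambda>u. ennreal (g u))
      = ennreal_powr (ennreal (wt_const TYPE('n) \<alpha>) * moment S (\<alpha> + p * t)) (1 / p)"
    unfolding g_eq by (rule Lp_norm_bdist_indicator[OF p \<alpha> S])
  have "admissible \<epsilon> b g E x"
    unfolding admissible_def int using near x fin E by (auto simp: g_def indicator_def split: if_splits)
  moreover have "Lp_norm p (ball_vol_wt \<alpha>) (\<lambda>u. ennreal (g u)) < top"
    unfolding norm using fin by (simp add: ennreal_mult_less_top)
  ultimately have "test_value a b c \<beta> q g E x \<le> C * Lp_norm p (ball_vol_wt \<alpha>) (\<lambda>u. ennreal (g u))"
    by (rule test)
  then show ?thesis unfolding test_value_def norm int Lp_norm_bdist_indicator[OF q \<beta> E] .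
qed

text \<open>A nonisotropic box about (1-d)e, for a unit vector e: the displacement is below r d in
  its component along e and below sqrt (r d) in total norm. Using the total norm instead of the
  orthogonal part avoids projections.\<close>

definition box_at :: "real \<Rightarrow> real \<Rightarrow> (complex ^ 'n) \<Rightarrow> (complex ^ 'n) set" where
  "box_at r d e = {u. cmod (hinner (u - (1 - d) *\<^sub>R e) e) < r * d \<and> (norm (u - (1 - d) *\<^sub>R e))\<^sup>2 < r * d}"

lemma box_at_borel [measurable]: "box_at r d e \<in> sets borel"
  unfolding box_at_def by measurable

text \<open>Writing z = (1-d)e + z1 and u = (1-d)e + u1, the difference of 1 - <z,u> and 2d consists
  of d^2, two terms linear in the displacements and <z1,u1>. Each is at most r d in modulus, the
  first because d <= r, and 4 r d = 2r (2d).\<close>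

lemma box_at_near:
  fixes e :: "complex ^ 'n"
  assumes e: "norm e = 1" and d: "0 < d" "d \<le> r" and r: "r \<le> 1 / 4" and z: "z \<in> box_at r d e" and u: "u \<in> box_at r d e"
  shows "cmod (1 - hinner z u - of_real (2 * d)) \<le> 2 * r * (2 * d)"
proof -
  define z1 u1 where "z1 = z - (1 - d) *\<^sub>R e" and "u1 = u - (1 - d) *\<^sub>R e"
  have zu: "z = (1 - d) *\<^sub>R e + z1" "u = (1 - d) *\<^sub>R e + u1" by (simp_all add: z1_def u1_def)
  have z1: "cmod (hinner z1 e) \<le> r * d" "(norm z1)\<^sup>2 \<le> r * d" and u1: "cmod (hinner u1 e) \<le> r * d" "(norm u1)\<^sup>2 \<le> r * d"
    using z u by (auto simp: box_at_def z1_def u1_def)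
  have left: "hinner (t *\<^sub>R x) y = of_real t * hinner x y" for t and x y :: "complex ^ 'n"
    by (metis hinner_commute hinner_scaleR_right scaleR_conv_of_real complex_cnj_mult complex_cnj_complex_of_real)
  have right: "hinner x (t *\<^sub>R y) = of_real t * hinner x y" for t and x y :: "complex ^ 'n"
    by (subst hinner_scaleR_right) (rule scaleR_conv_of_real)
  have "hinner z u = of_real ((1 - d)\<^sup>2) + (of_real (1 - d) * hinner e u1 + of_real (1 - d) * hinner z1 e + hinner z1 u1)"
    unfolding zu hinner_add_left hinner_add_right left right
    using e by (simp add: hinner_self power2_eq_square algebra_simps)
  then have "1 - hinner z u - of_real (2 * d)
      = - (of_real (d\<^sup>2) + of_real (1 - d) * hinner e u1 + of_real (1 - d) * hinner z1 e + hinner z1 u1)"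
    by (simp add: power2_eq_square algebra_simps)
  then have "cmod (1 - hinner z u - of_real (2 * d))
      = cmod (of_real (d\<^sup>2) + of_real (1 - d) * hinner e u1 + of_real (1 - d) * hinner z1 e + hinner z1 u1)"
    by (simp only: norm_minus_cancel)
  also have "\<dots> \<le> cmod (of_real (d\<^sup>2)) + cmod (of_real (1 - d) * hinner e u1)
      + cmod (of_real (1 - d) * hinner z1 e) + cmod (hinner z1 u1)"
    by (intro norm_triangle_le add_mono order.refl)
  also have "\<dots> \<le> r * d + r * d + r * d + r * d"
  proof (intro add_mono)
    show "cmod (of_real (d\<^sup>2)) \<le> r * d"
      unfolding norm_of_real using d by (simp add: power2_eq_square mult_right_mono)
    have "cmod (of_real (1 - d)) \<le> 1" unfolding norm_of_real using d r by auto
    then have le: "cmod (of_real (1 - d) * x) \<le> cmod x" for x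
      unfolding norm_mult using mult_right_mono[of _ 1 "cmod x"] by simp
    show "cmod (of_real (1 - d) * hinner e u1) \<le> r * d"
      using le[of "hinner e u1"] u1(1) by (metis hinner_commute complex_mod_cnj order.trans)
    show "cmod (of_real (1 - d) * hinner z1 e) \<le> r * d"
      using le[of "hinner z1 e"] z1(1) by linarith
    have "norm z1 * norm u1 \<le> sqrt (r * d) * sqrt (r * d)"
      using z1(2) u1(2) d by (intro mult_mono) (auto intro: real_le_rsqrt)
    then show "cmod (hinner z1 u1) \<le> r * d"
      using norm_hinner_le[of z1 u1] d by simp
  qed
  finally show ?thesis by (simp add: mult_ac)
qed

text \<open>The preceding estimate with z = u, since 1 - <u,u> = 1 - |u|^2, with relative error 2r
  <= 1/2. The box is not cut off at the sphere, so |u| < 1 is a conclusion.\<close>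

lemma box_at_bdist:
  fixes e :: "complex ^ 'n"
  assumes e: "norm e = 1" and d: "0 < d" "d \<le> r" and r: "r \<le> 1 / 4" and u: "u \<in> box_at r d e"
  shows "2 * d / 2 \<le> bdist u" "bdist u \<le> 2 * (2 * d)" "norm u < 1"
proof -
  have "1 - hinner u u - of_real (2 * d) = of_real (bdist u - 2 * d)"
    unfolding hinner_self by simp
  then have "cmod (1 - hinner u u - of_real (2 * d)) = \<bar>bdist u - 2 * d\<bar>"
    by (simp only: norm_of_real)
  moreover have "cmod (1 - hinner u u - of_real (2 * d)) \<le> 2 * r * (2 * d)"
    by (rule box_at_near[OF e d r u u])
  moreover have "2 * r * (2 * d) \<le> d" using r d mult_right_mono[of "4 * r" 1 d] by simp
  ultimately have "\<bar>bdist u - 2 * d\<bar> \<le> d" by linarith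
  then show "2 * d / 2 \<le> bdist u" "bdist u \<le> 2 * (2 * d)" using d by linarith+
  then have "(norm u)\<^sup>2 < 1" using d by linarith
  then show "norm u < 1" by (simp add: power_less_one_iff)
qed

text \<open>A Euclidean ball of radius comparable to \<open>sqrt d\<close> is covered by about \<open>1/d\<close> translates of the
  box along the complex line through \<open>e\<close>.\<close>

lemma box_at_volume:
  fixes e :: "complex ^ 'n"
  assumes e: "norm e = 1" and d: "0 < d" "d \<le> r" and r: "r \<le> 1 / 4"
  shows "unit_ball_vol (2 * real CARD('n)) * (r / 16) ^ CARD('n) * (r * 4 / 25) * d ^ (CARD('n) + 1) \<le> measure lebesgue (box_at r d e)"
proof -
  define z0 where "z0 = (1 - d) *\<^sub>R e"
  \<comment> \<open>t is the Euclidean size of the box, s the lattice step with 2s = r d, and \<rho>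
    = t/4 the radius of the ball to be covered.\<close>
  define t where "t = sqrt (r * d)"
  define s where "s = r * d / 2"
  define \<rho> where "\<rho> = t / 4"
  have rd: "0 < r * d" using d by simp
  have t0: "0 < t" "t * t = r * d" using rd by (auto simp: t_def)
  have "r * d \<le> 1 / 4 * (1 / 4)" using d r by (intro mult_mono) auto
  then have "t \<le> sqrt ((1 / 4)\<^sup>2)" unfolding t_def by (intro real_sqrt_le_mono) (simp add: power2_eq_square)
  then have t4: "t \<le> 1 / 4" by simp
  have s: "0 < s" "2 * s = t * t" using rd t0 by (auto simp: s_def)
  define N where "N = \<lceil>\<rho> / s\<rceil>"
  define I where "I = {-N..N} \<times> {-N..N}"
  define v where "v = (\<lambda>(k, l). Complex (s * of_int k) (s * of_int l) *s e)"
  define B where "B i = (\<lambda>x. 1 *\<^sub>R x + v i) ` box_at r d e" for i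
  have Q_sets: "B i \<in> sets lebesgue" for i
  proof -
    have "B i \<in> sets borel" unfolding B_def by (rule affine_image_borel) auto
    then show ?thesis by (intro sets_completionI_sets) simp
  qed
  have cover: "ball z0 \<rho> \<subseteq> (\<Union>i\<in>I. B i)"
  proof
    fix y assume y: "y \<in> ball z0 \<rho>"
    define L where "L = hinner (y - z0) e"
    have ny: "norm (y - z0) < \<rho>" using y by (simp add: dist_norm norm_minus_commute)
    have L: "cmod L \<le> \<rho>" using norm_hinner_le[of "y - z0" e] ny e by (simp add: L_def)
    define k where "k = \<lfloor>Re L / s\<rfloor>"
    define l where "l = \<lfloor>Im L / s\<rfloor>"
    have in_range: "\<lfloor>x / s\<rfloor> \<in> {-N..N}" if "\<bar>x\<bar> \<le> \<rho>" for x
    proof -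
      have "- (\<rho> / s) \<le> x / s" "x / s \<le> \<rho> / s" using that s by (auto simp: field_simps)
      then show ?thesis unfolding N_def by (auto simp: floor_le_iff le_floor_iff) linarith+
    qed
    have kl: "(k, l) \<in> I"
      unfolding I_def k_def l_def using in_range abs_Re_le_cmod[of L] abs_Im_le_cmod[of L] L by auto
    define w where "w = Complex (s * of_int k) (s * of_int l)"
    have part: "0 \<le> x - s * of_int \<lfloor>x / s\<rfloor> \<and> x - s * of_int \<lfloor>x / s\<rfloor> < s" for x
    proof -
      have "s * of_int \<lfloor>x / s\<rfloor> \<le> s * (x / s)" "s * (x / s) < s * (of_int \<lfloor>x / s\<rfloor> + 1)"
        using s by (intro mult_left_mono mult_strict_left_mono; linarith)+
      moreover have "s * (x / s) = x" using s by simp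
      ultimately show ?thesis unfolding distrib_left by linarith
    qed
    \<comment> \<open>Rounding down leaves a remainder below s in each real coordinate, so the
      component of y - z0 along e is corrected to modulus below 2s = r d, as the box
      demands.\<close>
    have Lw: "cmod (L - w) < 2 * s"
      using part[of "Re L"] part[of "Im L"] cmod_le[of "L - w"] by (simp add: w_def k_def l_def)
    define x where "x = y - w *s e"
    have yx: "y = x + w *s e" by (simp add: x_def)
    have "hinner (x - z0) e = L - w"
    proof -
      have "L = hinner ((x - z0) + w *s e) e" unfolding L_def yx by (simp add: algebra_simps)
      also have "\<dots> = hinner (x - z0) e + w"
        unfolding hinner_add_left hinner_smult_left using e by (simp add: hinner_self)
      finally show ?thesis by simp
    qed
    then have x1: "cmod (hinner (x - z0) e) < r * d" using Lw s t0 by simp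
    have "norm (x - z0) \<le> norm (y - z0) + norm (w *s e)"
      unfolding x_def using norm_triangle_ineq4[of "y - z0" "w *s e"] by (simp add: algebra_simps)
    also have "norm (w *s e) = cmod w" using e by (simp add: norm_smult_cvec)
    also have "cmod w \<le> cmod L + cmod (L - w)" using norm_triangle_ineq3[of w L] norm_minus_commute[of w L] by linarith
    \<comment> \<open>The radius t/4 and the smallness t <= 1/4 were chosen for this: 2\<rho> + 2s =
      t/2 + t^2 stays below t.\<close>
    finally have "norm (x - z0) < 2 * \<rho> + 2 * s" using ny L Lw by linarith
    also have "\<dots> = t / 2 + t * t" using s by (simp add: \<rho>_def)
    also have "\<dots> \<le> t / 2 + t * (1 / 2)" using t0 t4 by (intro add_left_mono mult_left_mono) auto
    finally have "norm (x - z0) < t" by simp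
    then have "norm (x - z0) * norm (x - z0) < t * t" by (intro mult_strict_mono') auto
    then have "x \<in> box_at r d e"
      using x1 t0 by (simp add: box_at_def z0_def power2_eq_square)
    then have "y \<in> B (k, l)"
      unfolding B_def v_def using yx w_def by auto
    then show "y \<in> (\<Union>i\<in>I. B i)" using kl by blast
  qed
  have \<rho>s: "\<rho> / s = 1 / (2 * t)" "1 \<le> \<rho> / s"
  proof -
    have "s = t * t / 2" using s by simp
    then show eq: "\<rho> / s = 1 / (2 * t)" using t0(1) by (simp add: \<rho>_def field_simps)
    show "1 \<le> \<rho> / s" unfolding eq using t0(1) t4 by (simp add: field_simps)
  qed
  \<comment> \<open>N < \<rho>/s + 1 and \<rho>/s >= 1 give 2N + 1 < 2\<rho>/s + 3 <= 5\<rho>/s. The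
    square of this count per direction produces the 25 in the volume constant.\<close>
  have N: "0 \<le> N" "of_int (2 * N + 1) \<le> 5 * (\<rho> / s)"
    using \<rho>s(2) unfolding N_def by linarith+
  have cardI: "real (card I) \<le> 25 / (4 * (r * d))"
  proof -
    have "real (card I) = of_int (2 * N + 1) * of_int (2 * N + 1)"
      using N(1) by (simp add: I_def card_cartesian_product)
    also have "\<dots> \<le> (5 * (\<rho> / s)) * (5 * (\<rho> / s))"
      using N \<rho>s(2) by (intro mult_mono) linarith+
    also have "\<dots> = 25 / (4 * (t * t))" unfolding \<rho>s(1) by simp
    finally show ?thesis by (simp only: t0)
  qed
  have bounded_box: "bounded (box_at r d e)"
    using box_at_bdist(3)[OF e d r] by (intro bounded_subset[OF bounded_ball[of 0 1]]) auto
  have "unit_ball_vol (2 * real CARD('n)) * \<rho> ^ (2 * CARD('n)) = measure lebesgue (ball z0 \<rho>)"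
    using t0 by (simp add: content_ball \<rho>_def mult.commute)
  also have "\<dots> \<le> measure lebesgue (\<Union>i\<in>I. B i)"
  proof (rule measure_mono_fmeasurable[OF cover])
    have "bounded (B i)" for i
      unfolding B_def using bounded_translation[OF bounded_box, of "v i"] by (simp add: add.commute)
    then show "(\<Union>i\<in>I. B i) \<in> lmeasurable"
      using Q_sets by (intro fmeasurable.finite_UN bounded_set_imp_lmeasurable) (auto simp: I_def)
  qed auto
  also have "\<dots> \<le> (\<Sum>i\<in>I. measure lebesgue (B i))"
    using Q_sets by (intro measure_UNION_le) (auto simp: I_def)
  also have "\<dots> = real (card I) * measure lebesgue (box_at r d e)"
    unfolding B_def measure_lebesgue_affine by simp
  also have "\<dots> \<le> 25 / (4 * (r * d)) * measure lebesgue (box_at r d e)"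
    by (intro mult_right_mono cardI) auto
  finally have "unit_ball_vol (2 * real CARD('n)) * \<rho> ^ (2 * CARD('n)) * (4 * (r * d) / 25) \<le> measure lebesgue (box_at r d e)"
    using rd by (simp add: field_simps)
  moreover have "\<rho> ^ (2 * CARD('n)) = (r / 16) ^ CARD('n) * d ^ CARD('n)"
  proof -
    have "\<rho>\<^sup>2 = r / 16 * d" using t0 by (simp add: \<rho>_def power2_eq_square)
    then show ?thesis by (simp only: power_mult power_mult_distrib)
  qed
  ultimately show ?thesis by (simp add: mult_ac)
qed

lemma powr_unbounded_at_0:
  assumes "\<And>x. 0 < x \<Longrightarrow> x \<le> x0 \<Longrightarrow> x powr e \<le> K" and "0 < x0"
  shows "0 \<le> (e :: real)"
proof (rule ccontr)
  assume e: "\<not> 0 \<le> e"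
  have K: "0 \<le> K" using assms(1)[of x0] assms(2) powr_ge_zero[of x0 e] by linarith
  define x where "x = min x0 ((K + 1) powr (1 / e))"
  have x: "0 < x" "x \<le> x0" "x \<le> (K + 1) powr (1 / e)" using assms K by (auto simp: x_def)
  have "((K + 1) powr (1 / e)) powr e \<le> x powr e" using x e by (intro powr_mono2') auto
  then have "K + 1 \<le> x powr e" using e K by (simp add: powr_powr)
  with assms(1)[OF x(1,2)] show False by simp
qed

lemma real_of_ennreal:
  assumes "(x :: ennreal) < top"
  obtains r where "0 \<le> r" "x = ennreal r"
  using assms by (cases x) auto

text \<open>Keeps only what the tests say about one variable, so that the three conditions are
  proved once for S and T and for both indices. The parameter \<open>dim\<close> names the dimension
  type, which the real parameters do not mention.\<close>

locale one_variable_test =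
  fixes dim :: "'n::finite itself" and a b c \<alpha> \<beta> p q \<epsilon> :: real and C :: ennreal
  assumes \<epsilon>: "0 < \<epsilon>" "\<epsilon> \<le> 1 / 2" and p: "1 < p" and pq: "p \<le> q" and \<alpha>: "-1 < \<alpha>" and \<beta>: "-1 < \<beta>"
    and C: "C < top"
    and test: "\<And>(g :: complex ^ 'n \<Rightarrow> real) E x. admissible \<epsilon> b g E x \<Longrightarrow>
      Lp_norm p (ball_vol_wt \<alpha>) (\<lambda>u. ennreal (g u)) < top \<Longrightarrow>
      test_value a b c \<beta> q g E x \<le> C * Lp_norm p (ball_vol_wt \<alpha>) (\<lambda>u. ennreal (g u))"
begin

lemma p0: "0 < p" and q0: "0 < q"
  using p pq by auto


lemmas moments = test_moments[OF test p0 q0 \<alpha> \<beta>]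

text \<open>With g supported in the ball of radius \<epsilon>, |<z,u>| <= \<epsilon> for every z in
  the ball, so E may be the whole ball. Then the norm of (1 - |z|^2)^a in the target space must be
  finite, that is, its moment exponent \<beta> + q a exceeds -1.\<close>

lemma necessity_target: "- q * a < \<beta> + 1"
proof (rule ccontr)
  assume "\<not> ?thesis"
  then have inf: "moment (ball (0 :: complex ^ 'n) 1) (\<beta> + q * a) = top"
    by (intro moment_infinite) auto
  have "ennreal_powr (ennreal (wt_const TYPE('n) \<beta>) * moment (ball (0 :: complex ^ 'n) 1) (\<beta> + q * a)) (1 / q)
      * ennreal (1 powr - c) * moment (ball (0 :: complex ^ 'n) \<epsilon>) (b + 0)
    \<le> C * ennreal_powr (ennreal (wt_const TYPE('n) \<alpha>) * moment (ball (0 :: complex ^ 'n) \<epsilon>) (\<alpha> + p * 0)) (1 / p)"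
  proof (rule moments)
    fix z u :: "complex ^ 'n" assume "z \<in> ball 0 1" "u \<in> ball 0 \<epsilon>"
    then have "norm z * norm u \<le> 1 * \<epsilon>" by (intro mult_mono) auto
    then show "cmod (1 - hinner z u - of_real 1) \<le> \<epsilon> * 1"
      using norm_hinner_le[of z u] by simp
  qed (use \<epsilon> in \<open>auto intro!: moment_ball_finite ball_sets_ball_vol\<close>)
  also have "\<dots> < top"
    using C \<epsilon> moment_ball_finite[of \<epsilon> \<alpha>, where 'n = 'n] by (simp add: ennreal_mult_less_top)
  finally show False
    using inf wt_const_pos[OF \<beta>, where 'n = 'n] moment_small_ball_pos[OF \<epsilon>, of b, where 'n = 'n]
    by (auto simp: ennreal_mult_top ennreal_top_mult ennreal_eq_0_iff split: if_splits)
qed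

text \<open>The power t is critical: \<alpha> + p t = -1, and failure of the condition means b + t
  <= -1. With m the moment of exponent -1 over a smaller concentric ball, the test gives l m <= C'
  (w m)^(1/p) for fixed positive constants l and w. As p > 1 this bounds m uniformly, although m
  tends to infinity as the balls exhaust the unit ball. The truncation keeps both moments finite, as
  the test requires.\<close>

lemma necessity_source: "\<alpha> + 1 < p * (b + 1)"
proof (rule ccontr)
  assume neg: "\<not> ?thesis"
  define t where "t = - (\<alpha> + 1) / p"
  have pt: "\<alpha> + p * t = -1" using p0 by (simp add: t_def)
  have bt: "b + t \<le> -1" using neg p0 by (simp add: t_def field_simps)
  define S where "S k = ball (0 :: complex ^ 'n) (1 - 1 / real (Suc k))" for k
  have S_sets: "S k \<in> sets ball_vol" and fin: "moment (S k) s < top" for k s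
    unfolding S_def by (intro ball_sets_ball_vol moment_ball_finite; simp)+
  define L where "L = ennreal_powr (ennreal (wt_const TYPE('n) \<beta>) * moment (ball (0 :: complex ^ 'n) \<epsilon>) (\<beta> + q * a)) (1 / q)"
  have "L < top" unfolding L_def using moment_ball_finite[of \<epsilon> "\<beta> + q * a", where 'n = 'n] \<epsilon>
    by (simp add: ennreal_mult_less_top)
  then obtain l where l: "L = ennreal l" "0 \<le> l" by (rule real_of_ennreal)
  have "L \<noteq> 0" unfolding L_def
    using wt_const_pos[OF \<beta>, where 'n = 'n] moment_small_ball_pos[OF \<epsilon>, of "\<beta> + q * a", where 'n = 'n]
    by (auto simp: ennreal_eq_0_iff)
  with l have l0: "0 < l" by (cases "l = 0") auto
  obtain C' where C': "C = ennreal C'" "0 \<le> C'" using C by (rule real_of_ennreal)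
  define K where "K = C' * (wt_const TYPE('n) \<alpha>) powr (1 / p) / l"
  have bound: "moment (S k) (-1) \<le> ennreal (K powr (p / (p - 1)))" for k
  proof -
    obtain m where m: "moment (S k) (-1) = ennreal m" "0 \<le> m" using fin by (rule real_of_ennreal)
    have "L * ennreal (1 powr - c) * moment (S k) (b + t)
        \<le> C * ennreal_powr (ennreal (wt_const TYPE('n) \<alpha>) * moment (S k) (\<alpha> + p * t)) (1 / p)"
      unfolding L_def
    proof (rule moments)
      fix z u :: "complex ^ 'n" assume z: "z \<in> ball 0 \<epsilon>" and u: "u \<in> S k"
      have "0 < 1 / real (Suc k)" by simp
      with u have "norm u \<le> 1" unfolding S_def mem_ball dist_0_norm by linarith
      with z \<epsilon> have "norm z * norm u \<le> \<epsilon> * 1" by (intro mult_mono) auto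
      then show "cmod (1 - hinner z u - of_real 1) \<le> \<epsilon> * 1"
        using norm_hinner_le[of z u] by simp
    qed (use \<epsilon> S_sets fin in \<open>auto intro!: ball_sets_ball_vol\<close>)
    moreover have "moment (S k) (-1) \<le> moment (S k) (b + t)"
      unfolding moment_def
    proof (intro nn_integral_mono mult_left_mono ennreal_leI)
      fix u :: "complex ^ 'n" assume "u \<in> space ball_vol"
      from bdist_pos[OF this] bt show "bdist u powr -1 \<le> bdist u powr (b + t)"
        by (intro powr_mono') auto
    qed auto
    ultimately have "L * moment (S k) (-1) \<le> C * ennreal_powr (ennreal (wt_const TYPE('n) \<alpha>) * moment (S k) (-1)) (1 / p)"
      unfolding pt by (simp add: order.trans[OF mult_left_mono])
    then have "ennreal (l * m) \<le> ennreal (C' * (wt_const TYPE('n) \<alpha> * m) powr (1 / p))"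
      using wt_const_pos[OF \<alpha>, where 'n = 'n] m l C' by (simp flip: ennreal_mult)
    then have le: "l * m \<le> C' * (wt_const TYPE('n) \<alpha> powr (1 / p) * m powr (1 / p))"
      using wt_const_pos[OF \<alpha>, where 'n = 'n] C' m by (simp add: powr_mult)
    have "m \<le> K powr (p / (p - 1))"
    proof (cases "m = 0")
      case False
      then have m0: "0 < m" using m by simp
      have "m powr (1 - 1 / p) * m powr (1 / p) = m" using m0 by (simp flip: powr_add)
      with le have "l * (m powr (1 - 1 / p) * m powr (1 / p)) \<le> C' * (wt_const TYPE('n) \<alpha> powr (1 / p) * m powr (1 / p))"
        by simp
      then have "m powr (1 - 1 / p) \<le> K"
        using m0 l0 by (simp add: K_def field_simps)
      then have "(m powr (1 - 1 / p)) powr (p / (p - 1)) \<le> K powr (p / (p - 1))"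
        using p by (intro powr_mono2) auto
      moreover have e: "(1 - 1 / p) * (p / (p - 1)) = 1" using p by (simp add: field_simps)
      have "(m powr (1 - 1 / p)) powr (p / (p - 1)) = m"
        unfolding powr_powr e using m0 by simp
      ultimately show ?thesis by simp
    qed simp
    then show ?thesis by (simp add: m ennreal_leI)
  qed
  have "top = (SUP k. moment (S k) (-1))"
    unfolding S_def SUP_moment_balls by (simp add: moment_infinite)
  also have "\<dots> \<le> ennreal (K powr (p / (p - 1)))" by (intro SUP_least bound)
  finally show False by (simp add: top_unique)
qed

text \<open>With the same box for support and evaluation set, all weights are powers of x = 2d up to
  constants, and the test reads x^g v^h <= constant, where v is the volume of the box and h = 1 +
  1/q - 1/p. Because h > 0, the lower bound v >= k x^(n+1) suffices; letting x tend to 0 forces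
  (n+1) h + g >= 0, which is the bound on c.\<close>

lemma necessity_exponent:
  "c \<le> real CARD('n) + 1 + a + b + (real CARD('n) + 1 + \<beta>) / q - (real CARD('n) + 1 + \<alpha>) / p"
proof -
  define n1 where "n1 = real CARD('n) + 1"
  \<comment> \<open>Then the relative error 2r in \<open>box_at_near\<close> is exactly \<epsilon>,
    and r <= 1/4.\<close>
  define r where "r = \<epsilon> / 2"
  have r: "0 < r" "r \<le> 1 / 4" using \<epsilon> by (auto simp: r_def)
  define e :: "complex ^ 'n" where "e = axis undefined 1"
  have e: "norm e = 1" by (simp add: e_def norm_eq_sqrt_inner inner_axis_axis)
  define k where "k = (r / 16) ^ CARD('n) * (r * 4 / 25) * (1 / 2) ^ (CARD('n) + 1)"
  have k: "0 < k" unfolding k_def using r by simp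
  obtain C' where C': "C = ennreal C'" "0 \<le> C'" using C by (rule real_of_ennreal)
  define wa where "wa = wt_const TYPE('n) \<alpha>"
  define wb where "wb = wt_const TYPE('n) \<beta>"
  have w: "0 < wa" "0 < wb" unfolding wa_def wb_def using \<alpha> \<beta> by (auto intro: wt_const_pos)
  define g where "g = \<beta> / q + a - c + b - \<alpha> / p"
  define h where "h = 1 + 1 / q - 1 / p"
  have "1 / p < 1" "0 < 1 / q" using p q0 by auto
  then have h: "0 < h" unfolding h_def by linarith
  define K1 where "K1 = (wb * 2 powr - \<bar>\<beta> + q * a\<bar>) powr (1 / q) * 2 powr - \<bar>b\<bar>"
  define K2 where "K2 = C' * (wa * 2 powr \<bar>\<alpha>\<bar>) powr (1 / p)"
  have K1: "0 < K1" using w by (simp add: K1_def)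
  have "x powr (n1 * h + g) \<le> K2 / K1 / k powr h" if x: "0 < x" "x \<le> 2 * r" for x
  proof -
    define d where "d = x / 2"
    have d: "0 < d" "d \<le> r" and xd: "x = 2 * d" using x by (auto simp: d_def)
    define Q where "Q = box_at r d e"
    have Q_ball: "Q \<subseteq> ball 0 1" using box_at_bdist(3)[OF e d r(2)] by (auto simp: Q_def)
    have Q: "Q \<in> sets ball_vol" unfolding Q_def
      by (rule subset_ball_sets_ball_vol) (use Q_ball in \<open>auto simp: Q_def\<close>)
    define v where "v = measure lebesgue Q / unit_ball_vol (2 * real CARD('n))"
    have v: "emeasure ball_vol Q = ennreal v"
      unfolding v_def by (rule emeasure_ball_vol) (use Q_ball in \<open>auto simp: Q_def\<close>)
    have kv: "k * x powr n1 \<le> v"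
    proof -
      have "n1 = real (CARD('n) + 1)" by (simp add: n1_def)
      then have "x powr n1 = x ^ (CARD('n) + 1)" using x by (simp only: powr_realpow)
      also have "\<dots> = 2 ^ (CARD('n) + 1) * d ^ (CARD('n) + 1)" unfolding xd by (rule power_mult_distrib)
      finally have "k * x powr n1 = (r / 16) ^ CARD('n) * (r * 4 / 25) * d ^ (CARD('n) + 1) * ((1 / 2) ^ (CARD('n) + 1) * 2 ^ (CARD('n) + 1))"
        unfolding k_def by (simp only: mult_ac)
      also have "(1 / 2) ^ (CARD('n) + 1) * 2 ^ (CARD('n) + 1) = (1 :: real)"
        by (simp add: power_mult_distrib[symmetric] del: power_Suc)
      also have "(r / 16) ^ CARD('n) * (r * 4 / 25) * d ^ (CARD('n) + 1) * 1 \<le> v"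
        using box_at_volume[OF e d r(2)] unfolding v_def Q_def
        by (simp add: pos_le_divide_eq unit_ball_vol_pos mult_ac)
      finally show ?thesis .
    qed
    have v0: "0 < v" using kv k x by (smt (verit) mult_pos_pos powr_gt_zero)
    have near: "x / 2 \<le> bdist u \<and> bdist u \<le> 2 * x" if "u \<in> Q" for u
      using box_at_bdist(1,2)[OF e d r(2)] that unfolding Q_def xd by blast
    note m = moment_near[OF Q x(1) near, unfolded v]
    have lower: "ennreal (2 powr - \<bar>s\<bar> * x powr s * v) \<le> moment Q s" for s
      using m(2)[of s] v0 by (simp add: ennreal_mult)
    have upper: "moment Q s \<le> ennreal (2 powr \<bar>s\<bar> * x powr s * v)" for s
      using m(1)[of s] v0 by (simp add: ennreal_mult)
    have fin: "moment Q s < top" for s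
      using upper[of s] by (rule le_less_trans) simp
    have "ennreal ((wb * (2 powr - \<bar>\<beta> + q * a\<bar> * x powr (\<beta> + q * a) * v)) powr (1 / q) * x powr - c * (2 powr - \<bar>b\<bar> * x powr b * v))
        = ennreal_powr (ennreal wb * ennreal (2 powr - \<bar>\<beta> + q * a\<bar> * x powr (\<beta> + q * a) * v)) (1 / q)
          * ennreal (x powr - c) * ennreal (2 powr - \<bar>b\<bar> * x powr b * v)"
      using w v0 by (simp add: ennreal_mult[symmetric])
    also have "\<dots> \<le> ennreal_powr (ennreal wb * moment Q (\<beta> + q * a)) (1 / q) * ennreal (x powr - c) * moment Q (b + 0)"
      using q0 lower[of "b + 0"] by (intro mult_mono ennreal_powr_mono lower) auto
    also have "\<dots> \<le> C * ennreal_powr (ennreal wa * moment Q (\<alpha> + p * 0)) (1 / p)"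
      unfolding wa_def wb_def
    proof (rule moments)
      fix z u assume "z \<in> Q" "u \<in> Q"
      then show "cmod (1 - hinner z u - of_real x) \<le> \<epsilon> * x"
        using box_at_near[OF e d r(2), of z u] unfolding Q_def xd by (simp add: r_def)
    qed (use Q x fin in auto)
    also have "\<dots> \<le> C * ennreal_powr (ennreal wa * ennreal (2 powr \<bar>\<alpha>\<bar> * x powr \<alpha> * v)) (1 / p)"
      using p0 upper[of \<alpha>] by (intro mult_left_mono ennreal_powr_mono) auto
    also have "\<dots> = ennreal (C' * (wa * (2 powr \<bar>\<alpha>\<bar> * x powr \<alpha> * v)) powr (1 / p))"
      using w v0 C' by (simp add: ennreal_mult[symmetric])
    finally have "(wb * (2 powr - \<bar>\<beta> + q * a\<bar> * x powr (\<beta> + q * a) * v)) powr (1 / q) * x powr - c * (2 powr - \<bar>b\<bar> * x powr b * v)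
        \<le> C' * (wa * (2 powr \<bar>\<alpha>\<bar> * x powr \<alpha> * v)) powr (1 / p)"
      using C' by (subst (asm) ennreal_le_iff) auto
    also have "C' * (wa * (2 powr \<bar>\<alpha>\<bar> * x powr \<alpha> * v)) powr (1 / p) = K2 * (x powr (\<alpha> / p) * v powr (1 / p))"
      using w v0 by (simp add: K2_def powr_mult powr_powr)
    also have "(wb * (2 powr - \<bar>\<beta> + q * a\<bar> * x powr (\<beta> + q * a) * v)) powr (1 / q) * x powr - c * (2 powr - \<bar>b\<bar> * x powr b * v)
        = K1 * ((x powr (\<beta> / q + a) * x powr - c * x powr b) * (v powr (1 / q) * v))"
      using w v0 q0 by (simp add: K1_def powr_mult powr_powr add_divide_distrib)
    also have "x powr (\<beta> / q + a) * x powr - c * x powr b = x powr (\<alpha> / p) * x powr g"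
      unfolding powr_add[symmetric] by (simp add: g_def algebra_simps)
    also have "v powr (1 / q) * v = v powr (1 / p) * v powr h"
    proof -
      have "v powr (1 / q) * v = v powr (1 / q) * v powr 1" using v0 by simp
      also have "\<dots> = v powr (1 / p) * v powr h" unfolding powr_add[symmetric] by (simp add: h_def add.commute)
      finally show ?thesis .
    qed
    finally have "(x powr (\<alpha> / p) * v powr (1 / p)) * (K1 * (x powr g * v powr h)) \<le> (x powr (\<alpha> / p) * v powr (1 / p)) * K2"
      by (simp only: mult_ac)
    then have "K1 * (x powr g * v powr h) \<le> K2"
      using x v0 by (subst (asm) mult_le_cancel_left_pos) auto
    moreover have "K1 * (x powr g * (k * x powr n1) powr h) \<le> K1 * (x powr g * v powr h)"
      using K1 kv k h by (intro mult_left_mono powr_mono2) auto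
    moreover have "x powr g * (k * x powr n1) powr h = k powr h * x powr (n1 * h + g)"
      using k by (simp add: powr_mult powr_powr powr_add)
    ultimately have "K1 * (k powr h * x powr (n1 * h + g)) \<le> K2" by simp
    then show ?thesis using K1 k by (simp add: field_simps)
  qed
  then have "0 \<le> n1 * h + g" by (rule powr_unbounded_at_0) (use r in auto)
  then show ?thesis
    by (simp add: g_def h_def n1_def add_divide_distrib diff_divide_distrib algebra_simps)
qed

end

section \<open>The equivalence\<close>

text \<open>The datum frozen in the variable that is not being examined: its test value is positive
  and its norm finite, so it can be divided out.\<close>

lemma base_test:
  assumes \<epsilon>: "0 < \<epsilon>" "\<epsilon> \<le> 1 / 2" and p: "0 < p" and q: "0 < q" and \<alpha>: "-1 < \<alpha>" and \<beta>: "-1 < \<beta>"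
  shows "admissible \<epsilon> b (indicator (ball (0 :: complex ^ 'n) \<epsilon>)) (ball 0 \<epsilon>) 1"
    and "Lp_norm p (ball_vol_wt \<alpha>) (\<lambda>u. ennreal (indicator (ball (0 :: complex ^ 'n) \<epsilon>) u)) < top"
    and "0 < test_value a b c \<beta> q (indicator (ball (0 :: complex ^ 'n) \<epsilon>)) (ball 0 \<epsilon>) 1"
proof -
  let ?B = "ball (0 :: complex ^ 'n) \<epsilon>"
  have B [measurable]: "?B \<in> sets ball_vol" using \<epsilon> by (intro ball_sets_ball_vol) auto
  have int: "(\<integral>\<^sup>+u. ennreal (bdist u powr b * indicator ?B u) \<partial>ball_vol) = moment ?B b"
    unfolding moment_def by (intro nn_integral_cong) (auto simp: indicator_def)
  have fin: "moment ?B s < top" for s using \<epsilon> by (intro moment_ball_finite) auto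
  have pos: "moment ?B s \<noteq> 0" for s using moment_small_ball_pos[OF \<epsilon>, of s, where 'n = 'n] by auto
  show "admissible \<epsilon> b (indicator ?B) ?B 1"
    unfolding admissible_def int
  proof (intro conjI allI ballI impI)
    fix z u :: "complex ^ 'n" assume z: "z \<in> ?B" and u: "norm u < 1"
    have "norm z * norm u \<le> \<epsilon> * 1" using z u \<epsilon> by (intro mult_mono) auto
    then show "cmod (1 - hinner z u - of_real 1) \<le> \<epsilon> * 1"
      using norm_hinner_le[of z u] by simp
  qed (use fin B in auto)
  have "Lp_norm p (ball_vol_wt \<alpha>) (\<lambda>u. ennreal (indicator ?B u))
      \<le> Lp_norm p (ball_vol_wt \<alpha>) (\<lambda>u. indicator ?B u * ennreal (bdist u powr 0))"
    using p bdist_pos by (intro Lp_norm_mono) (force simp: indicator_def)+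
  also have "\<dots> < top"
    unfolding Lp_norm_bdist_indicator[OF p \<alpha> B] using fin by (simp add: ennreal_mult_less_top)
  finally show "Lp_norm p (ball_vol_wt \<alpha>) (\<lambda>u. ennreal (indicator ?B u)) < top" .
  show "0 < test_value a b c \<beta> q (indicator ?B) ?B 1"
    unfolding test_value_def int Lp_norm_bdist_indicator[OF q \<beta> B]
    using pos wt_const_pos[OF \<beta>, where 'n = 'n] by (auto simp: ennreal_zero_less_mult_iff zero_less_iff_neq_zero)
qed

text \<open>The factor m is positive but may be infinite, so the division is by min m 1, a positive
  real number. The new constant does not depend on x and y.\<close>

lemma ennreal_cancel_factor:
  fixes C L m :: ennreal
  assumes "0 < m" "C < top" "L < top"
  obtains C' where "C' < top" "\<And>x y. x * m \<le> C * (y * L) \<Longrightarrow> x \<le> C' * y"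
proof -
  have "min m 1 < top" by (simp add: min_less_iff_disj)
  then obtain r where r: "0 \<le> r" "min m 1 = ennreal r" by (rule real_of_ennreal)
  with assms(1) have r0: "0 < r" by (cases "r = 0") (auto simp: min_def split: if_splits)
  show ?thesis
  proof (rule that)
    show "ennreal (1 / r) * (C * L) < top" using assms by (simp add: ennreal_mult_less_top)
    fix x y assume *: "x * m \<le> C * (y * L)"
    have "x = ennreal (1 / r) * ennreal r * x" using r0 by (simp flip: ennreal_mult)
    also have "\<dots> = ennreal (1 / r) * (x * min m 1)" unfolding r(2) by (simp add: mult_ac)
    also have "\<dots> \<le> ennreal (1 / r) * (x * m)" by (intro mult_left_mono) auto
    also have "\<dots> \<le> ennreal (1 / r) * (C * (y * L))" using * by (rule mult_left_mono) simp
    finally show "x \<le> ennreal (1 / r) * (C * L) * y" by (simp add: mult_ac)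
  qed
qed

context mixed_operator
begin

text \<open>For each index the other variable receives the fixed test on the ball of radius
  \<epsilon>; cancelling its contribution from the product inequality leaves the one-variable
  inequality.\<close>

lemma necessity:
  fixes p q \<alpha> \<beta> :: "real ^ 2"
  assumes bd: "bounded_mixed_Lp I A p \<alpha> q \<beta>"
    and \<alpha>: "\<forall>i. \<alpha> $ i > -1" and \<beta>: "\<forall>i. \<beta> $ i > -1"
    and p: "\<forall>i. 1 < p $ i" and pq: "\<forall>i. p $ i \<le> q $ i"
  shows "\<forall>i. - (q $ i) * a $ i < \<beta> $ i + 1
           \<and> \<alpha> $ i + 1 < p $ i * (b $ i + 1)
           \<and> c $ i \<le> real CARD('n) + 1 + a $ i + b $ i
               + (real CARD('n) + 1 + \<beta> $ i) / q $ i - (real CARD('n) + 1 + \<alpha> $ i) / p $ i"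
proof -
  have p0: "\<forall>i. 0 < p $ i" and q0: "\<forall>i. 0 < q $ i" using p pq by (meson less_trans zero_less_one less_le_trans)+
  define T where "T i = (test_value (a $ i) (b $ i) (c $ i) (\<beta> $ i) (q $ i) :: (complex ^ 'n \<Rightarrow> real) \<Rightarrow> _)" for i :: 2
  define L where "L i g = Lp_norm (p $ i) (ball_vol_wt (\<alpha> $ i)) (\<lambda>u. ennreal (g u))" for i and g :: "complex ^ 'n \<Rightarrow> real"
  obtain \<epsilon> C where \<epsilon>: "0 < \<epsilon>" "\<epsilon> \<le> 1 / 2" and C: "C < top"
    and test: "\<And>(g :: complex ^ 'n \<Rightarrow> real) (h :: complex ^ 'n \<Rightarrow> real) E F x y.
      \<lbrakk>admissible \<epsilon> (b $ 1) g E x; admissible \<epsilon> (b $ 2) h F y; L 1 g < top; L 2 h < top\<rbrakk>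
      \<Longrightarrow> T 1 g E x * T 2 h F y \<le> C * (L 1 g * L 2 h)"
    using product_test[OF bd p0 q0] unfolding T_def L_def by blast
  have base: "admissible \<epsilon> (b $ i) (indicator (ball (0 :: complex ^ 'n) \<epsilon>)) (ball 0 \<epsilon>) 1"
    "L i (indicator (ball (0 :: complex ^ 'n) \<epsilon>)) < top"
    "0 < T i (indicator (ball (0 :: complex ^ 'n) \<epsilon>)) (ball 0 \<epsilon>) 1" for i :: 2
    using base_test[OF \<epsilon> p0[rule_format, of i] q0[rule_format, of i] \<alpha>[rule_format, of i] \<beta>[rule_format, of i]]
    unfolding L_def T_def by auto
  have "\<exists>C'<top. \<forall>(g :: complex ^ 'n \<Rightarrow> real) E x. admissible \<epsilon> (b $ i) g E x \<longrightarrow> L i g < top \<longrightarrow> T i g E x \<le> C' * L i g" for i :: 2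
  proof -
    consider "i = 1" | "i = 2" using exhaust_2 by blast
    then show ?thesis
    proof cases
      case 1
      obtain C' where C': "C' < top"
        "\<And>x y. x * T 2 (indicator (ball (0 :: complex ^ 'n) \<epsilon>)) (ball 0 \<epsilon>) 1 \<le> C * (y * L 2 (indicator (ball (0 :: complex ^ 'n) \<epsilon>))) \<Longrightarrow> x \<le> C' * y"
        using ennreal_cancel_factor[OF base(3)[of 2] C base(2)[of 2]] by blast
      show ?thesis unfolding 1
        by (intro exI[of _ C'] conjI C' allI impI test base)
    next
      case 2
      obtain C' where C': "C' < top"
        "\<And>x y. x * T 1 (indicator (ball (0 :: complex ^ 'n) \<epsilon>)) (ball 0 \<epsilon>) 1 \<le> C * (y * L 1 (indicator (ball (0 :: complex ^ 'n) \<epsilon>))) \<Longrightarrow> x \<le> C' * y"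
        using ennreal_cancel_factor[OF base(3)[of 1] C base(2)[of 1]] by blast
      show ?thesis unfolding 2
      proof (intro exI[of _ C'] conjI C' allI impI)
        fix g :: "complex ^ 'n \<Rightarrow> real" and E x assume "admissible \<epsilon> (b $ 2) g E x" "L 2 g < top"
        from test[OF base(1)[of 1] this(1) base(2)[of 1] this(2)]
        show "T 2 g E x * T 1 (indicator (ball 0 \<epsilon>)) (ball 0 \<epsilon>) 1 \<le> C * (L 2 g * L 1 (indicator (ball 0 \<epsilon>)))"
          by (simp only: mult_ac)
      qed
    qed
  qed
  then obtain C' where C': "\<And>i. C' i < top" "\<And>i (g :: complex ^ 'n \<Rightarrow> real) E x.
      admissible \<epsilon> (b $ i) g E x \<Longrightarrow> L i g < top \<Longrightarrow> T i g E x \<le> C' i * L i g" by metis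
  show ?thesis
  proof
    fix i :: 2
    interpret one_variable_test "TYPE('n)" "a $ i" "b $ i" "c $ i" "\<alpha> $ i" "\<beta> $ i" "p $ i" "q $ i" \<epsilon> "C' i"
      using \<epsilon> p pq \<alpha> \<beta> C' unfolding T_def L_def by unfold_locales auto
    show "- (q $ i) * a $ i < \<beta> $ i + 1
           \<and> \<alpha> $ i + 1 < p $ i * (b $ i + 1)
           \<and> c $ i \<le> real CARD('n) + 1 + a $ i + b $ i
               + (real CARD('n) + 1 + \<beta> $ i) / q $ i - (real CARD('n) + 1 + \<alpha> $ i) / p $ i"
      using necessity_target necessity_source necessity_exponent by blast
  qed
qed

lemma bounded_iff:
  fixes p q \<alpha> \<beta> :: "real ^ 2"
  assumes "\<forall>i. \<alpha> $ i > -1" and "\<forall>i. \<beta> $ i > -1" and "\<forall>i. 1 < p $ i" and "\<forall>i. p $ i \<le> q $ i"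
  shows "bounded_mixed_Lp I A p \<alpha> q \<beta> \<longleftrightarrow> (\<forall>i. - (q $ i) * a $ i < \<beta> $ i + 1
           \<and> \<alpha> $ i + 1 < p $ i * (b $ i + 1)
           \<and> c $ i \<le> real CARD('n) + 1 + a $ i + b $ i
               + (real CARD('n) + 1 + \<beta> $ i) / q $ i - (real CARD('n) + 1 + \<alpha> $ i) / p $ i)"
  using necessity[OF _ assms] sufficiency[OF assms] by blast

end

section \<open>The kernels of S and T as instances of the common framework\<close>

lemma one_minus_hinner_Re_pos:
  assumes "norm z < 1" "norm u < 1"
  shows "0 < Re (1 - hinner z u)"
proof -
  have "norm z * norm u < 1" using assms mult_strict_mono'[of "norm z" 1 "norm u" 1] by simp
  then show ?thesis using complex_Re_le_cmod[of "hinner z u"] norm_hinner_le[of z u] by simp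
qed

lemma norm_powr_of_real: "X \<noteq> 0 \<Longrightarrow> cmod (X powr of_real s) = cmod X powr s"
  by (simp add: powr_def norm_exp_eq_Re)

lemma mixed_operator_S:
  fixes a b c :: "real ^ 2"
  shows "mixed_operator (\<lambda>z w u (\<eta> :: complex ^ 'n). of_real (1 / (cmod (1 - hinner z u) powr (c $ 1) * cmod (1 - hinner w \<eta>) powr (c $ 2))))
    a b c (S_integrand b c) (S_op a b c)"
proof
  fix f z w u and \<eta> :: "complex ^ 'n"
  show "S_integrand b c f (z, w) (u, \<eta>) = of_real (bdist u powr (b $ 1) * bdist \<eta> powr (b $ 2))
      * of_real (1 / (cmod (1 - hinner z u) powr (c $ 1) * cmod (1 - hinner w \<eta>) powr (c $ 2))) * f (u, \<eta>)"
    by (simp add: S_integrand_def)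
  show "S_op a b c f (z, w) = of_real (bdist z powr (a $ 1) * bdist w powr (a $ 2))
      * (\<integral>x. S_integrand b c f (z, w) x \<partial>(ball_vol \<Otimes>\<^sub>M ball_vol))"
    by (simp add: S_op_def)
  show "cmod (of_real (1 / (cmod (1 - hinner z u) powr (c $ 1) * cmod (1 - hinner w \<eta>) powr (c $ 2))))
      = cmod (1 - hinner z u) powr - (c $ 1) * cmod (1 - hinner w \<eta>) powr - (c $ 2)"
    unfolding norm_of_real by (simp add: powr_minus_divide)
next
  show "\<exists>\<epsilon>>0. \<epsilon> \<le> 1 / 2 \<and> (\<forall>z w u \<eta> x y. norm z < 1 \<longrightarrow> norm w < 1 \<longrightarrow> norm u < 1 \<longrightarrow> norm \<eta> < 1 \<longrightarrow>
      0 < x \<longrightarrow> 0 < y \<longrightarrow> cmod (1 - hinner z u - of_real x) \<le> \<epsilon> * x \<longrightarrow>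
      cmod (1 - hinner w \<eta> - of_real y) \<le> \<epsilon> * y \<longrightarrow>
      cmod (of_real (1 / (cmod (1 - hinner z u) powr (c $ 1) * cmod (1 - hinner w (\<eta> :: complex ^ 'n)) powr (c $ 2))))
      \<le> 2 * Re (of_real (1 / (cmod (1 - hinner z u) powr (c $ 1) * cmod (1 - hinner w \<eta>) powr (c $ 2)))))"
  proof -
    have real: "cmod (of_real r) \<le> 2 * Re (of_real r)" if "0 \<le> r" for r
      using that by simp
    \<comment> \<open>This kernel is real and nonnegative, so its phase is trivial and the largest
      \<epsilon> allowed can be taken.\<close>
    show ?thesis by (intro exI[of _ "1 / 2"] conjI allI impI real) auto
  qed
  show "(\<lambda>x. complex_of_real (1 / (cmod (1 - hinner (fst (fst x)) (fst (snd x))) powr (c $ 1)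
      * cmod (1 - hinner (snd (fst x)) (snd (snd x) :: complex ^ 'n)) powr (c $ 2))))
      \<in> borel_measurable ((ball_vol \<Otimes>\<^sub>M ball_vol) \<Otimes>\<^sub>M (ball_vol \<Otimes>\<^sub>M ball_vol))"
    by measurable
qed

text \<open>The principal power is continuous on the right half plane, which contains every 1 -
  <z,u>. Extending it by 0 gives a Borel function that agrees with the power at all these
  values.\<close>

lemma measurable_powr_right_half_plane:
  "(\<lambda>X. if 0 < Re X then X powr of_real s else 0) \<in> borel_measurable borel"
proof -
  have "(\<lambda>X. if X \<in> {X. 0 < Re X} then X powr of_real s else 0) \<in> borel_measurable borel"
  proof (rule borel_measurable_continuous_on_if)
    show "{X. 0 < Re X} \<in> sets borel" by measurable
    show "continuous_on {X. 0 < Re X} (\<lambda>X. X powr of_real s)"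
      by (intro continuous_intros) auto
  qed auto
  then show ?thesis by simp
qed

text \<open>The kernel is exp (-W) with W = s Ln X + t Ln Y. The imaginary part of Ln X is invariant
  under positive scaling, so continuity of Ln at 1 makes it at most \<eta> when X is relatively
  close to a positive number. The choice of \<eta> gives |Im W| <= 1.\<close>

lemma phase_small:
  fixes s t :: real
  shows "\<exists>\<epsilon>>0. \<epsilon> \<le> 1 / 2 \<and> (\<forall>X Y x y. 0 < x \<longrightarrow> 0 < y \<longrightarrow> cmod (X - of_real x) \<le> \<epsilon> * x \<longrightarrow>
    cmod (Y - of_real y) \<le> \<epsilon> * y \<longrightarrow>
    cmod (1 / (X powr of_real s * Y powr of_real t)) \<le> 2 * Re (1 / (X powr of_real s * Y powr of_real t)))"
proof -
  define \<eta> where "\<eta> = 1 / (\<bar>s\<bar> + \<bar>t\<bar> + 1)"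
  have \<eta>: "0 < \<eta>" by (simp add: \<eta>_def add_nonneg_pos)
  have "isCont Ln 1" by (intro continuous_at_Ln) auto
  then obtain \<delta> where \<delta>: "0 < \<delta>" "\<And>W. dist W 1 < \<delta> \<Longrightarrow> dist (Ln W) (Ln 1) < \<eta>"
    unfolding continuous_at_eps_delta using \<eta> by blast
  define \<epsilon> where "\<epsilon> = min (\<delta> / 2) (1 / 2)"
  have \<epsilon>: "0 < \<epsilon>" "\<epsilon> \<le> 1 / 2" "\<epsilon> < \<delta>" using \<delta>(1) by (auto simp: \<epsilon>_def)
  have arg: "\<bar>Im (Ln X)\<bar> \<le> \<eta> \<and> X \<noteq> 0" if x: "0 < x" and X: "cmod (X - of_real x) \<le> \<epsilon> * x" for X x
  proof -
    define W where "W = X / of_real x"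
    have XW: "X = of_real x * W" using x by (simp add: W_def)
    have "cmod (X - of_real x) = x * cmod (W - 1)"
      unfolding XW using x norm_mult[of "of_real x" "W - 1"] by (simp add: algebra_simps)
    with X x have W: "cmod (W - 1) \<le> \<epsilon>" by (simp add: mult.commute)
    have W0: "W \<noteq> 0" using W \<epsilon> by auto
    have "cmod (Ln W) < \<eta>" using \<delta>(2)[of W] W \<epsilon> by (simp add: dist_norm)
    moreover have "Im (Ln X) = Im (Ln W)"
      unfolding XW using Ln_times_of_real[OF x W0] Ln_of_real[OF x] by simp
    ultimately show ?thesis using abs_Im_le_cmod[of "Ln W"] XW W0 x by auto
  qed
  show ?thesis
  proof (intro exI[of _ \<epsilon>] conjI \<epsilon> allI impI)
    fix X Y x y assume "0 < x" "0 < y" "cmod (X - of_real x) \<le> \<epsilon> * x" "cmod (Y - of_real y) \<le> \<epsilon> * y"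
    then have X: "\<bar>Im (Ln X)\<bar> \<le> \<eta>" "X \<noteq> 0" and Y: "\<bar>Im (Ln Y)\<bar> \<le> \<eta>" "Y \<noteq> 0" using arg by blast+
    define W where "W = of_real s * Ln X + of_real t * Ln Y"
    have "X powr of_real s * Y powr of_real t = exp W"
      using X Y by (simp add: W_def powr_def exp_add)
    then have eq: "1 / (X powr of_real s * Y powr of_real t) = exp (- W)"
      by (simp add: exp_minus inverse_eq_divide)
    have "\<bar>Im W\<bar> \<le> \<bar>s\<bar> * \<bar>Im (Ln X)\<bar> + \<bar>t\<bar> * \<bar>Im (Ln Y)\<bar>"
      unfolding W_def using abs_triangle_ineq[of "s * Im (Ln X)" "t * Im (Ln Y)"] by (simp add: abs_mult)
    also have "\<dots> \<le> \<bar>s\<bar> * \<eta> + \<bar>t\<bar> * \<eta>" using X Y by (intro add_mono mult_left_mono) auto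
    also have "\<dots> = (\<bar>s\<bar> + \<bar>t\<bar>) / (\<bar>s\<bar> + \<bar>t\<bar> + 1)" by (simp add: \<eta>_def add_divide_distrib)
    also have "\<dots> \<le> 1" by simp
    finally have "\<bar>Im W\<bar> \<le> 1" .
    \<comment> \<open>1 < pi/3 because pi > 3, so the real part is at least cos (pi/3) = 1/2 of the
      modulus.\<close>
    then have "cos (pi / 3) \<le> cos \<bar>Im W\<bar>"
      using pi_gt3 by (intro cos_monotone_0_pi_le) auto
    then have "1 / 2 \<le> cos (Im W)" by (simp add: cos_60)
    then have "exp (- Re W) * (1 / 2) \<le> exp (- Re W) * cos (Im W)" by (intro mult_left_mono) auto
    then show "cmod (1 / (X powr of_real s * Y powr of_real t)) \<le> 2 * Re (1 / (X powr of_real s * Y powr of_real t))"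
      unfolding eq by (simp add: norm_exp_eq_Re Re_exp)
  qed
qed

lemma mixed_operator_T:
  fixes a b c :: "real ^ 2"
  shows "mixed_operator (\<lambda>z w u (\<eta> :: complex ^ 'n). 1 / ((1 - hinner z u) powr of_real (c $ 1) * (1 - hinner w \<eta>) powr of_real (c $ 2)))
    a b c (T_integrand b c) (T_op a b c)"
proof
  fix f z w u and \<eta> :: "complex ^ 'n"
  show "T_integrand b c f (z, w) (u, \<eta>) = of_real (bdist u powr (b $ 1) * bdist \<eta> powr (b $ 2))
      * (1 / ((1 - hinner z u) powr of_real (c $ 1) * (1 - hinner w \<eta>) powr of_real (c $ 2))) * f (u, \<eta>)"
    by (simp add: T_integrand_def)
  show "T_op a b c f (z, w) = of_real (bdist z powr (a $ 1) * bdist w powr (a $ 2))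
      * (\<integral>x. T_integrand b c f (z, w) x \<partial>(ball_vol \<Otimes>\<^sub>M ball_vol))"
    by (simp add: T_op_def)
  assume "norm z < 1" "norm w < 1" "norm u < 1" "norm \<eta> < 1"
  then have "1 - hinner z u \<noteq> 0" "1 - hinner w \<eta> \<noteq> 0"
    using cmod_one_minus_hinner_pos[of z u] cmod_one_minus_hinner_pos[of w \<eta>] by auto
  then show "cmod (1 / ((1 - hinner z u) powr of_real (c $ 1) * (1 - hinner w \<eta>) powr of_real (c $ 2)))
      = cmod (1 - hinner z u) powr - (c $ 1) * cmod (1 - hinner w \<eta>) powr - (c $ 2)"
    by (simp add: norm_divide norm_mult norm_powr_of_real powr_minus_divide)
next
  show "\<exists>\<epsilon>>0. \<epsilon> \<le> 1 / 2 \<and> (\<forall>z w u \<eta> x y. norm z < 1 \<longrightarrow> norm w < 1 \<longrightarrow> norm u < 1 \<longrightarrow> norm \<eta> < 1 \<longrightarrow>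
      0 < x \<longrightarrow> 0 < y \<longrightarrow> cmod (1 - hinner z u - of_real x) \<le> \<epsilon> * x \<longrightarrow>
      cmod (1 - hinner w \<eta> - of_real y) \<le> \<epsilon> * y \<longrightarrow>
      cmod (1 / ((1 - hinner z u) powr of_real (c $ 1) * (1 - hinner w (\<eta> :: complex ^ 'n)) powr of_real (c $ 2)))
      \<le> 2 * Re (1 / ((1 - hinner z u) powr of_real (c $ 1) * (1 - hinner w \<eta>) powr of_real (c $ 2))))"
    using phase_small[of "c $ 1" "c $ 2"] by blast
  let ?r = "\<lambda>s X. if 0 < Re X then X powr complex_of_real s else 0"
  have [measurable]: "(\<lambda>x. ?r s (h x)) \<in> borel_measurable M" if "h \<in> borel_measurable M" for s h and M :: "'m measure"
    by (rule measurable_compose[OF that measurable_powr_right_half_plane])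
  let ?M = "(ball_vol \<Otimes>\<^sub>M ball_vol) \<Otimes>\<^sub>M (ball_vol \<Otimes>\<^sub>M ball_vol)
    :: (((complex ^ 'n) \<times> (complex ^ 'n)) \<times> ((complex ^ 'n) \<times> (complex ^ 'n))) measure"
  let ?g = "\<lambda>x. 1 / (?r (c $ 1) (1 - hinner (fst (fst x)) (fst (snd x) :: complex ^ 'n))
      * ?r (c $ 2) (1 - hinner (snd (fst x)) (snd (snd x) :: complex ^ 'n)))"
  have meas: "?g \<in> borel_measurable ?M" by measurable
  show "(\<lambda>x. 1 / ((1 - hinner (fst (fst x)) (fst (snd x))) powr of_real (c $ 1)
      * (1 - hinner (snd (fst x)) (snd (snd x) :: complex ^ 'n)) powr of_real (c $ 2))) \<in> borel_measurable ?M"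
  \<comment> \<open>The zero extension never takes effect on the product of balls, where both bases
    have positive real part.\<close>
  proof (rule iffD1[OF measurable_cong meas])
    fix x :: "((complex ^ 'n) \<times> (complex ^ 'n)) \<times> ((complex ^ 'n) \<times> (complex ^ 'n))"
    assume "x \<in> space ?M"
    then have "0 < Re (1 - hinner (fst (fst x)) (fst (snd x)))" "0 < Re (1 - hinner (snd (fst x)) (snd (snd x)))"
      by (auto simp: space_pair_measure intro!: one_minus_hinner_Re_pos simp del: one_complex.sel minus_complex.sel)
    then show "?g x
        = 1 / ((1 - hinner (fst (fst x)) (fst (snd x))) powr of_real (c $ 1) * (1 - hinner (snd (fst x)) (snd (snd x))) powr of_real (c $ 2))"
      by (simp only: if_True)
  qed
qed

theorem theorem1p3:
  fixes a b c \<alpha> \<beta> p q :: "real ^ 2"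
  assumes "\<forall>i. \<alpha> $ i > -1" and "\<forall>i. \<beta> $ i > -1"
    and "1 < min (p $ 1) (p $ 2)"
    and "min (p $ 1) (p $ 2) \<le> max (p $ 1) (p $ 2)"
    and "max (p $ 1) (p $ 2) \<le> min (q $ 1) (q $ 2)"
  shows "(S_bounded TYPE('n::finite) a b c p \<alpha> q \<beta> \<longleftrightarrow> T_bounded TYPE('n) a b c p \<alpha> q \<beta>)
    \<and> (T_bounded TYPE('n) a b c p \<alpha> q \<beta> \<longleftrightarrow>
        (\<forall>i. - (q $ i) * a $ i < \<beta> $ i + 1
           \<and> \<alpha> $ i + 1 < p $ i * (b $ i + 1)
           \<and> c $ i \<le> real CARD('n) + 1 + a $ i + b $ i
               + (real CARD('n) + 1 + \<beta> $ i) / q $ i - (real CARD('n) + 1 + \<alpha> $ i) / p $ i))"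
proof -
  have "\<forall>i. 1 < p $ i" "\<forall>i. p $ i \<le> q $ i"
    using assms(3,5) by (auto simp: forall_2)
  note * = assms(1,2) this
  show ?thesis
    unfolding S_bounded_def T_bounded_def
    using mixed_operator.bounded_iff[OF mixed_operator_S[where a = a and b = b and c = c, where 'n = 'n] *]
      mixed_operator.bounded_iff[OF mixed_operator_T[where a = a and b = b and c = c, where 'n = 'n] *] by blast
qed

end
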